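(* Let $u_0\in\mathcal{B}$ and $M=\|u_0\|_{L^\infty(\mathbb{R})}$. Let $f,g:\mathbb{R}\to\mathbb{R}$ be convex and superlinear, with $f(0)=0$ being the minimum of $f$ and $g(0)=0$ the minimum of $g$, and suppose that for some constant $C$ and for each $h\in\{f,g\}$ $$\|a_h\|_{L^\infty([0,M])}\leq C,\qquad a_h(w):=\frac{h'(w)w-h(w)}{w^2}.$$ Let $u$ and $v$ be the entropy solutions of $u_t+f(u)_x=0$ and $v_t+g(v)_x=0$, respectively, both with initial data $u_0$. Then for all $t>0$ $$W_\infty\big(u(t),v(t)\big)\leq t\sup_{\gamma\in[0,1]}\left|\left(\tilde{f}-\tilde{g}\right)\left(\frac{\gamma}{t}\right)\right|,$$ where $\tilde f$ and $\tilde g$ are the inverses of the Legendre transforms $f^*$ and $g^*$ restricted to $[0,\infty)$.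
   Context: $\mathcal{B}:=\{u\in L^\infty(\mathbb{R}): u\geq0,\ \mathrm{supp}(u)\text{ compact},\ \int_{\mathbb{R}}u\,dx=1\}$. Superlinear means $\lim_{|u|\to\infty}f(u)/|u|=\infty$. The derivative of a convex function exists almost everywhere. Legendre transform: $f^*(p)=\sup_{u\in\mathbb{R}}\{pu-f(u)\}$. Under the assumptions, $f^*$ is finite, convex, nondecreasing and unbounded on $[0,\infty)$ with $f^*(0)=0$; its inverse there is understood as $\tilde f(q)=\sup\{p\geq0:f^*(p)\leq q\}$, $q\geq0$ (the ordinary inverse wherever $f^*$ is strictly increasing), and similarly for $\tilde g$. For $u,v\in\mathcal{B}$, $W_\infty(u,v)=\|U^{-1}-V^{-1}\|_{L^\infty([0,1])}$, where $U(x)=\int_{-\infty}^xu\,dy$, $U^{-1}(\xi)=\inf\{x:U(x)>\xi\}$, and similarly for $V$. *)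

theory Defs
  imports "HOL-Analysis.Analysis" "HOL-Probability.Essential_Supremum"
begin

text \<open>
  Elements of \<open>L\<^sup>\<infinity>(S)\<close> are represented by functions, and everything below is invariant under
  changes on null sets.  Note that \<^const>\<open>esssup\<close> is \<open>\<infinity>\<close> for functions that are not measurable.
\<close>

definition Linf_norm :: "'a::euclidean_space set \<Rightarrow> ('a \<Rightarrow> real) \<Rightarrow> ereal" where
  "Linf_norm S u = esssup (lebesgue_on S) (\<lambda>x. ereal \<bar>u x\<bar>)"

definition Linf :: "'a::euclidean_space set \<Rightarrow> ('a \<Rightarrow> real) set" where
  "Linf S = {u. u \<in> borel_measurable (lebesgue_on S) \<and> Linf_norm S u < \<infinity>}"

text \<open>The support is the essential support: \<open>u\<close> vanishes almost everywhere off a compact set.\<close>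

definition BB :: "(real \<Rightarrow> real) set" where
  "BB = {u. u \<in> Linf UNIV \<and> (AE x in lebesgue. 0 \<le> u x) \<and>
            (\<exists>K. compact K \<and> (AE x in lebesgue. x \<notin> K \<longrightarrow> u x = 0)) \<and>
            (LINT x|lebesgue. u x) = 1}"

definition superlinear :: "(real \<Rightarrow> real) \<Rightarrow> bool" where
  "superlinear f \<longleftrightarrow> filterlim (\<lambda>u. f u / \<bar>u\<bar>) at_top at_infinity"

text \<open>
  Where \<open>h\<close> is not differentiable or \<open>w = 0\<close> (a null set if \<open>h\<close> is convex), the value is
  immaterial.
\<close>

definition a_fun :: "(real \<Rightarrow> real) \<Rightarrow> real \<Rightarrow> real" where
  "a_fun h w = (deriv h w * w - h w) / w\<^sup>2"

text \<open>
  For convex superlinear \<open>f\<close> with minimum \<open>f 0 = 0\<close>, the suprema in the next two definitions are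
  over nonempty sets bounded above, so the real-valued \<^const>\<open>Sup\<close> is the true supremum.
\<close>

definition legendre :: "(real \<Rightarrow> real) \<Rightarrow> real \<Rightarrow> real" where
  "legendre f p = (SUP u. p * u - f u)"

definition legendre_inv :: "(real \<Rightarrow> real) \<Rightarrow> real \<Rightarrow> real" where
  "legendre_inv f q = Sup {p. 0 \<le> p \<and> legendre f p \<le> q}"

definition primitive :: "(real \<Rightarrow> real) \<Rightarrow> real \<Rightarrow> real" where
  "primitive u x = (LINT y:{..x}|lebesgue. u y)"

text \<open>
  For \<open>u\<close> in \<^const>\<open>BB\<close> the set below is nonempty and bounded below when \<open>0 \<le> \<xi> < 1\<close>.  At
  \<open>\<xi> = 1\<close> it is empty and the value is a junk value (the usual one is \<open>\<infinity>\<close>), which does not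
  affect the essential supremum over \<open>[0,1]\<close>.
\<close>

definition pseudo_inv :: "(real \<Rightarrow> real) \<Rightarrow> real \<Rightarrow> real" where
  "pseudo_inv U \<xi> = Inf {x. \<xi> < U x}"

definition W_inf :: "(real \<Rightarrow> real) \<Rightarrow> (real \<Rightarrow> real) \<Rightarrow> ereal" where
  "W_inf u v =
     Linf_norm {0..1} (\<lambda>\<xi>. pseudo_inv (primitive u) \<xi> - pseudo_inv (primitive v) \<xi>)"

text \<open>
  Nonnegative \<open>C\<^sup>1\<close> functions with compact support in the open half plane, with their partial
  derivatives.  Points are pairs \<open>(t, x)\<close>.
\<close>

definition test_function ::
  "(real \<times> real \<Rightarrow> real) \<Rightarrow> (real \<times> real \<Rightarrow> real) \<Rightarrow> (real \<times> real \<Rightarrow> real) \<Rightarrow> bool" where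
  "test_function \<phi> \<phi>t \<phi>x \<longleftrightarrow>
     (\<forall>p. (\<phi> has_derivative (\<lambda>h. \<phi>t p * fst h + \<phi>x p * snd h)) (at p)) \<and>
     continuous_on UNIV \<phi>t \<and> continuous_on UNIV \<phi>x \<and> (\<forall>p. 0 \<le> \<phi> p) \<and>
     compact (closure {p. \<phi> p \<noteq> 0}) \<and> closure {p. \<phi> p \<noteq> 0} \<subseteq> {0<..} \<times> UNIV"

text \<open>
  Kruzkov entropy solution of \<open>u\<^sub>t + f(u)\<^sub>x = 0\<close>, \<open>u(0) = u0\<close>: \<open>u\<close> is essentially bounded on
  \<open>(0,\<infinity>) \<times> \<real>\<close>, is a continuous map from \<open>[0,\<infinity>)\<close> to \<open>L\<^sup>1\<close>-\<open>loc\<close> attaining the initial datum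
  (this gives \<open>u(t)\<close> a meaning for every \<open>t\<close>), and satisfies
  \<open>\<bar>u - k\<bar>\<^sub>t + (sgn (u - k) (f u - f k))\<^sub>x \<le> 0\<close> in the sense of distributions for all constants \<open>k\<close>.
\<close>

definition entropy_solution ::
  "(real \<Rightarrow> real) \<Rightarrow> (real \<Rightarrow> real) \<Rightarrow> (real \<Rightarrow> real \<Rightarrow> real) \<Rightarrow> bool" where
  "entropy_solution f u0 u \<longleftrightarrow>
     (\<lambda>(t, x). u t x) \<in> Linf ({0<..} \<times> UNIV) \<and>
     (\<forall>t\<ge>0. \<forall>R. set_integrable lebesgue {-R..R} (u t)) \<and>
     (\<forall>t\<ge>0. \<forall>R. ((\<lambda>s. LINT x:{-R..R}|lebesgue. \<bar>u s x - u t x\<bar>) \<longlongrightarrow> 0) (at t within {0..})) \<and>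
     (AE x in lebesgue. u 0 x = u0 x) \<and>
     (\<forall>k \<phi> \<phi>t \<phi>x. test_function \<phi> \<phi>t \<phi>x \<longrightarrow>
        0 \<le> (LINT (t, x)|lebesgue_on ({0<..} \<times> UNIV).
               \<bar>u t x - k\<bar> * \<phi>t (t, x) + sgn (u t x - k) * (f (u t x) - f k) * \<phi>x (t, x)))"

end

theory Submission
  imports Defs
begin

text \<open>
  The primitive \<open>A\<close> of a solution in \<open>x\<close> solves \<open>A\<^sub>t + f(A\<^sub>x) = 0\<close>, and it equals the Hopf-Lax
  function \<open>inf\<^sub>y U\<^sub>0 y + t f\<^sup>*((x - y) / t)\<close>.  The upper bound holds since
  \<open>p A\<^sub>x - f(A\<^sub>x) \<le> f\<^sup>*(p)\<close> along lines of slope \<open>p\<close>.  The lower bound rests on a comparison with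
  affine solutions \<open>k x - f(k) t + m\<close>: put \<open>V = A - k x + f(k) t\<close>, so \<open>V\<^sub>x = u - k\<close> and
  \<open>V\<^sub>t = -(f(u) - f(k))\<close>.  Testing the entropy inequality for the constant \<open>k\<close> with a function
  \<open>\<beta>(V)\<close> vanishing for \<open>V \<ge> m\<close>, localized to a cone of dependence, the terms with \<open>\<beta>'\<close> cancel,
  so \<open>\<integral>\<bar>u - k\<bar> \<beta>(V) dx\<close> remains zero if it is zero initially; then \<open>\<integral>(m - V)\<^sub>+\<^sup>3 dx\<close> remains zero
  as well, that is, \<open>V \<ge> m\<close> persists.  Locally averaged Hopf-Lax functions are semiconvex
  subsolutions, so a time discretization reduces the lower bound to this affine comparison.

  By the Hopf-Lax formula and monotonicity of the initial primitive, the pseudo-inverse of \<open>A(t)\<close>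
  is the supremum of \<open>y + t f~((\<xi> - U\<^sub>0 y) / t)\<close> over all \<open>y\<close> with \<open>U\<^sub>0 y \<le> \<xi>\<close>, and replacing \<open>f~\<close> by
  \<open>g~\<close> changes it by at most the right-hand side.
\<close>

section \<open>Local averages and primitives of bounded functions\<close>

text \<open>The weight \<open>\<beta>(V)\<close> is not an admissible test function:
  \<open>V\<close> is only Lipschitz in \<open>x\<close>, with derivative a bounded measurable
  function. Everything is therefore done with averages of \<open>A\<close> over windows
  \<open>[x-h, x+h]\<close>, which are C1 at positive times. The cancellation of the terms with
  \<open>\<beta>'\<close> is then broken by the distance of \<open>u\<close> and \<open>f(u)\<close>
  from their averages. That distance is small only in L1, so all constants must be independent of
  \<open>h\<close>. The weighted entropy alone does not suffice, as it also vanishes where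
  \<open>u = k\<close>. But the time derivative of \<open>(m - V)+^3\<close> is controlled by
  \<open>(m - V)+^2 |f(u) - f(k)|\<close>, up to averaging, and this is at most a Lipschitz constant
  times the weighted entropy density; hence the exponents 2 and 3. The potential of
  \<open>u(t)\<close> is determined only up to a function of time; the right normalization is found
  by testing with densities of mean zero. A time step of length \<open>d\<close> with averaging
  width \<open>\<delta>\<close> loses a multiple of \<open>d^2 / \<delta>\<close>, so
  \<open>n\<close> steps lose a multiple of \<open>1 / (n \<delta>)\<close>: the number of steps has
  to tend to infinity before \<open>\<delta>\<close> tends to 0.\<close>

definition bmeas :: "real \<Rightarrow> (real \<Rightarrow> real) \<Rightarrow> bool" where
  "bmeas B v \<longleftrightarrow> v \<in> borel_measurable lebesgue \<and> (\<forall>x. \<bar>v x\<bar> \<le> B)"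

text \<open>An integral over a reversed interval is 0, so this is the signed integral from 0 to
  \<open>x\<close>.\<close>

definition pot :: "(real \<Rightarrow> real) \<Rightarrow> real \<Rightarrow> real" where
  "pot v x = integral {0..x} v - integral {x..0} v"

text \<open>A plain window mean in place of a smooth kernel: its derivative is a symmetric
  difference quotient of the averaged function, so averaging a continuous function already gives a
  C1 function.\<close>

definition avg :: "real \<Rightarrow> (real \<Rightarrow> real) \<Rightarrow> real \<Rightarrow> real" where
  "avg h v x = integral {x-h..x+h} v / (2*h)"

lemma integrable_const_Icc [simp]: "(\<lambda>_. c::real) integrable_on {a..b::real}"
  by (rule Henstock_Kurzweil_Integration.integrable_const_ivl)

lemma measurable_bounded_integrable:
  fixes v :: "real \<Rightarrow> real"
  assumes "v \<in> borel_measurable lebesgue" "\<And>x. x \<in> {a..b} \<Longrightarrow> \<bar>v x\<bar> \<le> B"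
  shows "v integrable_on {a..b}"
proof (rule measurable_bounded_by_integrable_imp_integrable[where g="\<lambda>_. B"])
  show "v \<in> borel_measurable (lebesgue_on {a..b})"
    using assms(1) by (simp add: measurable_restrict_space1)
qed (use assms in auto)

lemma bmeas_bound: "bmeas B v \<Longrightarrow> \<bar>v x\<bar> \<le> B"
  by (simp add: bmeas_def)

lemma bmeas_nonneg: "bmeas B v \<Longrightarrow> 0 \<le> B"
  using bmeas_bound[of B v 0] by linarith

lemma bmeas_measurable: "bmeas B v \<Longrightarrow> v \<in> borel_measurable lebesgue"
  by (simp add: bmeas_def)

lemma bmeas_integrable: "bmeas B v \<Longrightarrow> v integrable_on {a..b}"
  unfolding bmeas_def by (rule measurable_bounded_integrable[where B=B]) auto

lemma continuous_measurable_lebesgue: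
  "continuous_on UNIV g \<Longrightarrow> (g :: real \<Rightarrow> real) \<in> borel_measurable lebesgue"
  by (simp add: borel_measurable_continuous_onI measurable_completion)

lemma bmeas_diff_abs:
  assumes "bmeas B v" "bmeas C w" shows "bmeas (B + C) (\<lambda>x. \<bar>v x - w x\<bar>)"
proof -
  have "\<bar>\<bar>v x - w x\<bar>\<bar> \<le> B + C" for x
    using bmeas_bound[OF assms(1), of x] bmeas_bound[OF assms(2), of x] by linarith
  moreover have [measurable]: "v \<in> borel_measurable lebesgue" "w \<in> borel_measurable lebesgue"
    using assms unfolding bmeas_def by auto
  have "(\<lambda>x. \<bar>v x - w x\<bar>) \<in> borel_measurable lebesgue" by measurable
  ultimately show ?thesis unfolding bmeas_def by auto
qed

lemma pot_diff:
  assumes "\<And>a b. v integrable_on {a..b}" "x \<le> y"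
  shows "pot v y - pot v x = integral {x..y} v"
proof -
  have c: "integral {a..c} v + integral {c..b} v = integral {a..b} v" if "a \<le> c" "c \<le> b" for a b c
    using Henstock_Kurzweil_Integration.integral_combine[OF that assms(1)] .
  have z: "integral {a..b} v = 0" if "b \<le> a" for a b
    using that by (cases "a = b") auto
  consider "0 \<le> x" | "x \<le> 0" "0 \<le> y" | "y \<le> 0" by linarith
  then show ?thesis
  proof cases
    case 1 then show ?thesis using c[of 0 x y] z[of 0 x] z[of 0 y] assms(2) by (simp add: pot_def)
  next
    case 2 then show ?thesis using c[of x 0 y] z[of x 0] z[of 0 y] by (simp add: pot_def)
  next
    case 3 then show ?thesis using c[of x y 0] z[of x 0] z[of y 0] assms(2) by (simp add: pot_def)
  qed
qed

lemma pot_0 [simp]: "pot v 0 = 0"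
  by (simp add: pot_def)

lemma pot_lipschitz:
  assumes "bmeas B v" shows "\<bar>pot v y - pot v x\<bar> \<le> B * \<bar>y - x\<bar>"
proof -
  have *: "\<bar>pot v y - pot v x\<bar> \<le> B * \<bar>y - x\<bar>" if "x \<le> y" for x y
  proof -
    have "B \<ge> 0" by (rule bmeas_nonneg[OF assms])
    then have "norm (integral {x..y} v) \<le> B * (y - x)"
      using has_integral_bound[OF _ integrable_integral[of v "cbox x y"], of B] assms that bmeas_integrable[OF assms, of x y]
      by (auto simp: bmeas_def)
    with that show ?thesis by (simp add: pot_diff bmeas_integrable[OF assms])
  qed
  show ?thesis using *[of x y] *[of y x] by (cases "x \<le> y") (auto simp: abs_minus_commute)
qed

lemma lipschitz_imp_continuous:
  fixes v :: "real \<Rightarrow> real"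
  assumes "\<And>x y. \<bar>v y - v x\<bar> \<le> B * \<bar>y - x\<bar>" shows "continuous_on S v"
proof -
  have "\<bar>B\<bar> * \<bar>x-y\<bar> \<ge> \<bar>v x - v y\<bar>" for x y
    using assms[of x y] mult_right_mono[of B "\<bar>B\<bar>" "\<bar>x - y\<bar>"] by linarith
  then have "\<bar>B\<bar>-lipschitz_on S v"
    by (auto intro!: lipschitz_onI simp: dist_real_def)
  then show ?thesis by (rule lipschitz_on_continuous_on)
qed

lemma continuous_pot: "bmeas B v \<Longrightarrow> continuous_on S (pot v)"
  by (rule lipschitz_imp_continuous) (rule pot_lipschitz)

lemma continuous_integrable_ivl:
  "continuous_on UNIV v \<Longrightarrow> (v :: real \<Rightarrow> real) integrable_on {a..b}"
  by (meson continuous_on_subset integrable_continuous_interval subset_UNIV)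

lemma avg_eq_pot:
  assumes "\<And>a b. v integrable_on {a..b}" "h > 0"
  shows "avg h v x = (pot v (x+h) - pot v (x-h)) / (2*h)"
  using assms by (simp add: avg_def pot_diff)

lemma continuous_avg:
  assumes "bmeas B v" "h > 0" shows "continuous_on S (avg h v)"
proof -
  have "avg h v = (\<lambda>x. (pot v (x+h) - pot v (x-h)) / (2*h))"
    using avg_eq_pot[OF bmeas_integrable[OF assms(1)] assms(2)] by blast
  then show ?thesis using assms
    by (auto intro!: continuous_intros continuous_on_compose2[OF continuous_pot[OF assms(1), where S=UNIV]])
qed

lemma avg_diff:
  assumes "v integrable_on {x-h..x+h}" "w integrable_on {x-h..x+h}"
  shows "avg h (\<lambda>x. v x - w x) x = avg h v x - avg h w x"
  using assms by (simp add: avg_def integral_diff diff_divide_distrib)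

lemma avg_const: "h > 0 \<Longrightarrow> avg h (\<lambda>_. c) x = c"
  by (simp add: avg_def)

lemma avg_mono:
  assumes "v integrable_on {x-h..x+h}" "w integrable_on {x-h..x+h}" "h > 0"
    "\<And>y. x-h \<le> y \<Longrightarrow> y \<le> x+h \<Longrightarrow> v y \<le> w y"
  shows "avg h v x \<le> avg h w x"
  using assms by (auto simp: avg_def intro!: divide_right_mono integral_le)

lemma avg_bound:
  assumes "v integrable_on {x-h..x+h}" "h > 0" "\<And>y. x-h \<le> y \<Longrightarrow> y \<le> x+h \<Longrightarrow> \<bar>v y - c\<bar> \<le> B"
  shows "\<bar>avg h v x - c\<bar> \<le> B"
proof -
  have "avg h v x \<le> avg h (\<lambda>_. c + B) x" "avg h (\<lambda>_. c - B) x \<le> avg h v x"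
    using assms by (auto intro!: avg_mono dest!: assms(3) simp: abs_le_iff)
  then show ?thesis using assms(2) by (auto simp: avg_const)
qed

lemma avg_abs_le:
  assumes "bmeas B v" "h > 0" shows "\<bar>avg h v x\<bar> \<le> B"
  using avg_bound[of v x h 0 B] assms bmeas_integrable[OF assms(1)] by (auto simp: bmeas_def)

lemma integral_shift_ivl:
  fixes P :: "real \<Rightarrow> real"
  shows "integral {a..b} (\<lambda>x. P (x + c)) = integral {a+c..b+c} P"
  using integral_shift_real_ivl[of "a+c" c "b+c" P] by simp

lemma pot_mono:
  assumes "bmeas B v" "\<And>x. 0 \<le> v x" "x \<le> y" shows "pot v x \<le> pot v y"
  using pot_diff[OF bmeas_integrable[OF assms(1)] assms(3)] integral_nonneg[OF bmeas_integrable[OF assms(1), of x y]] assms(2)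
  by fastforce

text \<open>Fubini for the window kernel without a double integral. In terms of a primitive
  \<open>P\<close> the left side is a difference of integrals of \<open>P\<close> over shifted
  intervals, which regroup into the means of \<open>P\<close> around \<open>b\<close> and around
  \<open>a\<close>; since \<open>P\<close> increases, the former is at most \<open>P (b+h)\<close>
  and the latter at least \<open>P (a-h)\<close>.\<close>

lemma integral_avg_le:
  assumes v: "bmeas B v" "\<And>x. 0 \<le> v x" and h: "h > 0" "a \<le> b"
  shows "integral {a..b} (avg h v) \<le> integral {a-h..b+h} v"
proof -
  note vi = bmeas_integrable[OF v(1)]
  define P where "P = pot v"
  have cP: "continuous_on UNIV P" unfolding P_def by (rule continuous_pot[OF v(1)])
  note Pi = continuous_integrable_ivl[OF cP]
  have cPs: "continuous_on UNIV (\<lambda>x. P (x + c))" for c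
    by (rule continuous_on_compose2[OF cP]) (auto intro!: continuous_intros)
  have "integral {a..b} (avg h v) = integral {a..b} (\<lambda>x. (P (x + h) - P (x + (-h))) / (2*h))"
    by (rule arg_cong[of _ _ "integral {a..b}"], rule ext) (simp add: avg_eq_pot[OF vi h(1)] P_def)
  also have "\<dots> = (integral {a..b} (\<lambda>x. P (x+h)) - integral {a..b} (\<lambda>x. P (x + (-h)))) / (2*h)"
    by (simp add: integral_diff continuous_integrable_ivl[OF cPs] del: add_uminus_conv_diff)
  also have "\<dots> = (integral {a+h..b+h} P - integral {a-h..b-h} P) / (2*h)"
    by (simp add: integral_shift_ivl del: add_uminus_conv_diff) simp
  also have "\<dots> = (integral {b-h..b+h} P - integral {a-h..a+h} P) / (2*h)"
    using h pot_diff[OF Pi, of "a+h" "b+h"] pot_diff[OF Pi, of "a-h" "b-h"]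
      pot_diff[OF Pi, of "b-h" "b+h"] pot_diff[OF Pi, of "a-h" "a+h"] by auto
  also have "\<dots> = avg h P b - avg h P a" by (simp add: avg_def diff_divide_distrib)
  also have "\<dots> \<le> avg h (\<lambda>_. P (b+h)) b - avg h (\<lambda>_. P (a-h)) a"
    by (intro diff_mono avg_mono Pi) (use h v in \<open>auto simp: P_def intro!: pot_mono\<close>)
  also have "\<dots> = integral {a-h..b+h} v"
    using h by (simp add: avg_const P_def pot_diff vi)
  finally show ?thesis .
qed

text \<open>Measurability supplies continuous functions converging off a negligible set. Clipping
  them to \<open>[-B, B]\<close> preserves the limit and gives dominated convergence a constant
  majorant.\<close>

lemma continuous_L1_approx:
  assumes v: "bmeas B v"
  obtains g where "\<And>n::nat. continuous_on UNIV (g n)" "\<And>n. bmeas B (g n)"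
    "\<And>a b. (\<lambda>n. integral {a..b} (\<lambda>x. \<bar>g n x - v x\<bar>)) \<longlonglongrightarrow> 0"
proof -
  have B: "B \<ge> 0" by (rule bmeas_nonneg[OF v])
  have "v measurable_on UNIV"
    using v by (auto simp: bmeas_def intro!: lebesgue_measurable_imp_measurable_on)
  then obtain N F where N: "negligible N" and F: "\<And>n. continuous_on UNIV (F n)"
    and lim: "\<And>x. x \<notin> N \<Longrightarrow> (\<lambda>n. F n x) \<longlonglongrightarrow> v x"
    unfolding measurable_on_def by auto
  define g where "g n x = max (-B) (min B (F n x))" for n :: nat and x
  have cg: "continuous_on UNIV (g n)" for n
    unfolding g_def by (intro continuous_intros F)
  have bg: "bmeas B (g n)" for n
    using continuous_measurable_lebesgue[OF cg] B by (auto simp: bmeas_def g_def)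
  have gl: "(\<lambda>n. g n x) \<longlonglongrightarrow> v x" if "x \<notin> N" for x
  proof -
    have "(\<lambda>n. g n x) \<longlonglongrightarrow> max (-B) (min B (v x))"
      unfolding g_def by (intro tendsto_intros lim that)
    moreover have "max (-B) (min B (v x)) = v x" using bmeas_bound[OF v, of x] by linarith
    ultimately show ?thesis by simp
  qed
  have "(\<lambda>n. integral {a..b} (\<lambda>x. \<bar>g n x - v x\<bar>)) \<longlonglongrightarrow> 0" for a b
  proof -
    define q where "q n x = (if x \<in> N then 0 else \<bar>g n x - v x\<bar>)" for n x
    have eq: "integral {a..b} (\<lambda>x. \<bar>g n x - v x\<bar>) = integral {a..b} (q n)" for n
      by (rule integral_spike[OF N]) (auto simp: q_def)
    have "(\<lambda>n. integral {a..b} (q n)) \<longlonglongrightarrow> integral {a..b} (\<lambda>_. 0)"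
    proof (rule dominated_convergence)
      show "q n integrable_on {a..b}" for n
        by (rule integrable_spike[OF bmeas_integrable[OF bmeas_diff_abs[OF bg[of n] v]] N])
           (auto simp: q_def)
      show "(\<lambda>_. 2*B) integrable_on {a..b}" by simp
      show "norm (q n x) \<le> 2*B" for n x
        using bmeas_diff_abs[OF bg[of n] v] B by (auto simp: q_def bmeas_def)
      show "(\<lambda>n. q n x) \<longlonglongrightarrow> 0" for x
      proof (cases "x \<in> N")
        case False
        then have "(\<lambda>n. \<bar>g n x - v x\<bar>) \<longlonglongrightarrow> 0" using gl[of x] by (intro tendsto_rabs_zero LIM_zero) auto
        with False show ?thesis by (simp add: q_def)
      qed (simp add: q_def)
    qed
    then show ?thesis by (simp add: eq)
  qed
  with cg bg that show ?thesis by blast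
qed

lemma bmeas_avg: "bmeas B v \<Longrightarrow> h > 0 \<Longrightarrow> bmeas B (avg h v)"
  unfolding bmeas_def[of B "avg h v"]
  using continuous_measurable_lebesgue[OF continuous_avg] avg_abs_le by blast

text \<open>Lebesgue differentiation in L1. Continuous functions are dense and converge under
  averaging by uniform continuity; averaging the remainder does not increase its L1 norm, by
  \<open>integral_avg_le\<close>, up to an enlargement of the interval by
  \<open>h < 1\<close>.\<close>

lemma avg_L1_tendsto:
  assumes v: "bmeas B v" and ab: "a \<le> b" and e: "e > 0"
  obtains d where "d > 0" "\<And>h. 0 < h \<Longrightarrow> h < d \<Longrightarrow> integral {a..b} (\<lambda>x. \<bar>avg h v x - v x\<bar>) < e"
proof -
  obtain G where G: "\<And>n::nat. continuous_on UNIV (G n)" "\<And>n. bmeas B (G n)"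
    "\<And>a b. (\<lambda>n. integral {a..b} (\<lambda>x. \<bar>G n x - v x\<bar>)) \<longlonglongrightarrow> 0"
    by (rule continuous_L1_approx[OF v]) blast
  obtain n where n: "\<bar>integral {a-1..b+1} (\<lambda>x. \<bar>G n x - v x\<bar>)\<bar> < e/4"
    using LIMSEQ_D[OF G(3)[of "a-1" "b+1"], of "e/4"] e by auto
  define g where "g = G n"
  have g: "continuous_on UNIV g" "bmeas B g" by (auto simp: g_def G)
  note dv = bmeas_diff_abs[OF g(2) v]
  have gv: "integral {a-1..b+1} (\<lambda>x. \<bar>g x - v x\<bar>) < e/4" using n by (simp add: g_def)
  \<comment> \<open>Chosen so that uniform continuity contributes at most \<open>e/4\<close>; the
    summand 1 keeps the denominator positive when \<open>a = b\<close>.\<close>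
  define e' where "e' = e / (4 * (b - a + 1))"
  have e': "e' > 0" using e ab by (auto simp: e'_def)
  have "uniformly_continuous_on {a-1..b+1} g"
    by (intro compact_uniformly_continuous continuous_on_subset[OF g(1)]) auto
  then obtain d where d: "d > 0" "\<And>x y. x \<in> {a-1..b+1} \<Longrightarrow> y \<in> {a-1..b+1} \<Longrightarrow> \<bar>y - x\<bar> < d \<Longrightarrow> \<bar>g y - g x\<bar> < e'"
    using e' unfolding uniformly_continuous_on_def dist_real_def by metis
  show ?thesis
  proof (rule that[of "min d 1"])
    show "min d 1 > 0" using d by auto
    fix h assume h: "0 < h" "h < min d 1"
    have s: "integral {p..q} (\<lambda>x. \<bar>g x - v x\<bar>) \<le> integral {a-1..b+1} (\<lambda>x. \<bar>g x - v x\<bar>)" 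
      if "{p..q} \<subseteq> {a-1..b+1}" for p q
      by (rule integral_subset_le[OF that]) (auto intro: bmeas_integrable[OF dv])
    have "integral {a..b} (\<lambda>x. \<bar>avg h v x - v x\<bar>) \<le>
       integral {a..b} (\<lambda>x. avg h (\<lambda>y. \<bar>g y - v y\<bar>) x + (e' + \<bar>g x - v x\<bar>))"
    proof (rule integral_le)
      show "(\<lambda>x. \<bar>avg h v x - v x\<bar>) integrable_on {a..b}"
        by (rule bmeas_integrable[OF bmeas_diff_abs[OF bmeas_avg[OF v h(1)] v]])
      show "(\<lambda>x. avg h (\<lambda>y. \<bar>g y - v y\<bar>) x + (e' + \<bar>g x - v x\<bar>)) integrable_on {a..b}"
        using bmeas_avg[OF dv h(1)] dv 
        by (intro integrable_add bmeas_integrable[OF dv] bmeas_integrable[OF bmeas_avg[OF dv h(1)]]) auto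
      fix x assume x: "x \<in> {a..b}"
      have "\<bar>avg h g x - g x\<bar> \<le> e'"
        by (rule avg_bound) (use h x in \<open>auto intro!: less_imp_le[OF d(2)] continuous_integrable_ivl[OF g(1)]\<close>)
      moreover have "avg h g x - avg h v x \<le> avg h (\<lambda>y. \<bar>g y - v y\<bar>) x"
        unfolding avg_diff[OF bmeas_integrable[OF g(2)] bmeas_integrable[OF v], symmetric]
        by (intro avg_mono integrable_diff bmeas_integrable[OF dv] bmeas_integrable[OF g(2)] bmeas_integrable[OF v] h) auto
      moreover have "avg h v x - avg h g x \<le> avg h (\<lambda>y. \<bar>g y - v y\<bar>) x"
        unfolding avg_diff[OF bmeas_integrable[OF v] bmeas_integrable[OF g(2)], symmetric]
        by (intro avg_mono integrable_diff bmeas_integrable[OF dv] bmeas_integrable[OF g(2)] bmeas_integrable[OF v] h) auto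
      ultimately show "\<bar>avg h v x - v x\<bar> \<le> avg h (\<lambda>y. \<bar>g y - v y\<bar>) x + (e' + \<bar>g x - v x\<bar>)"
        by linarith
    qed
    also have "\<dots> = integral {a..b} (avg h (\<lambda>y. \<bar>g y - v y\<bar>)) + (e' * (b - a) + integral {a..b} (\<lambda>x. \<bar>g x - v x\<bar>))"
      using ab by (simp add: integral_add integrable_add bmeas_integrable[OF dv] bmeas_integrable[OF bmeas_avg[OF dv h(1)]])
    also have "\<dots> < e"
    proof -
      have "integral {a..b} (avg h (\<lambda>y. \<bar>g y - v y\<bar>)) \<le> integral {a-h..b+h} (\<lambda>y. \<bar>g y - v y\<bar>)"
        by (rule integral_avg_le[OF dv _ h(1) ab]) auto
      also have "\<dots> < e/4" using s[of "a-h" "b+h"] h gv by auto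
      finally have 1: "integral {a..b} (avg h (\<lambda>y. \<bar>g y - v y\<bar>)) < e/4" .
      have 2: "integral {a..b} (\<lambda>x. \<bar>g x - v x\<bar>) < e/4" using s[of a b] gv by auto
      have "e' * (b - a) \<le> e' * (b - a + 1)" using e' by simp
      also have "\<dots> = e/4" using ab unfolding e'_def by (simp add: divide_simps)
      finally show ?thesis using 1 2 e by linarith
    qed
    finally show "integral {a..b} (\<lambda>x. \<bar>avg h v x - v x\<bar>) < e" .
  qed
qed

text \<open>All small window means of \<open>v\<close> around points of \<open>{a..b}\<close>
  vanish, the gap between \<open>b\<close> and \<open>c\<close> leaving room for the windows. Their
  L1 convergence to \<open>v\<close> forces \<open>v\<close> to vanish almost everywhere
  there.\<close>

lemma integral_abs_eq_0: 
  assumes v: "bmeas B v" and z: "\<And>x y. x \<le> y \<Longrightarrow> y \<le> c \<Longrightarrow> integral {x..y} v = 0"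
    and ab: "a \<le> b" "b < c"
  shows "integral {a..b} (\<lambda>x. \<bar>v x\<bar>) = 0"
proof (rule ccontr)
  assume n: "\<not> ?thesis"
  have "bmeas B (\<lambda>x. 0)" using bmeas_nonneg[OF v] by (simp add: bmeas_def)
  from bmeas_integrable[OF bmeas_diff_abs[OF v this]] have "(\<lambda>x. \<bar>v x\<bar>) integrable_on {a..b}" by simp
  then have "integral {a..b} (\<lambda>x. \<bar>v x\<bar>) \<ge> 0" by (rule integral_nonneg) auto
  with n have "integral {a..b} (\<lambda>x. \<bar>v x\<bar>) > 0" by simp
  from avg_L1_tendsto[OF v ab(1) this] obtain d where d: "d > 0"
    "\<And>h. 0 < h \<Longrightarrow> h < d \<Longrightarrow> integral {a..b} (\<lambda>x. \<bar>avg h v x - v x\<bar>) < integral {a..b} (\<lambda>x. \<bar>v x\<bar>)" by metis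
  define h where "h = min (d/2) (c - b)"
  have h: "0 < h" "h < d" "h \<le> c - b" using d ab by (auto simp: h_def)
  have "integral {a..b} (\<lambda>x. \<bar>avg h v x - v x\<bar>) = integral {a..b} (\<lambda>x. \<bar>v x\<bar>)"
    by (rule Henstock_Kurzweil_Integration.integral_cong) (use h z in \<open>auto simp: avg_def\<close>)
  with d(2)[OF h(1,2)] show False by simp
qed

lemma pot_deriv:
  assumes v: "continuous_on UNIV v" shows "(pot v has_real_derivative v x) (at x)"
proof -
  have "((\<lambda>u. integral {x-1..u} v) has_vector_derivative v x) (at x within {x-1..x+1})"
    by (rule integral_has_vector_derivative) (auto intro: continuous_on_subset[OF v])
  then have "((\<lambda>u. integral {x-1..u} v) has_real_derivative v x) (at x)"
    using at_within_Icc_at[of "x-1" x "x+1"] by (simp add: has_real_derivative_iff_has_vector_derivative)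
  then have "((\<lambda>u. pot v (x-1) + integral {x-1..u} v) has_real_derivative v x) (at x)"
    by (auto intro!: derivative_eq_intros)
  moreover have "\<forall>\<^sub>F u in nhds x. pot v (x-1) + integral {x-1..u} v = pot v u"
  proof -
    have "\<forall>\<^sub>F u in nhds x. u \<in> {x-1<..}" by (rule eventually_nhds_in_open) auto
    then show ?thesis
    proof eventually_elim
      case (elim u) then show ?case using pot_diff[OF continuous_integrable_ivl[OF v], of "x-1" u] by auto
    qed
  qed
  ultimately show ?thesis
    using DERIV_cong_ev[OF refl _ refl, of "\<lambda>u. pot v (x-1) + integral {x-1..u} v" "pot v" x] by blast
qed

text \<open>Since \<open>v\<close> is only bounded and measurable, the product rule is applied to
  continuous L1 approximations. Their potentials converge uniformly, with an error bounded by the L1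
  distance \<open>d n\<close>, so both sides pass to the limit.\<close>

lemma pot_by_parts:
  assumes v: "bmeas B v" and r: "\<And>x. (r has_real_derivative g x) (at x)" and g: "continuous_on UNIV g"
    and ab: "a \<le> b" "r a = 0" "r b = 0"
  shows "integral {a..b} (\<lambda>x. v x * r x) = - integral {a..b} (\<lambda>x. pot v x * g x)"
proof -
  obtain G where G: "\<And>n::nat. continuous_on UNIV (G n)" "\<And>n. bmeas B (G n)"
    "\<And>a b. (\<lambda>n. integral {a..b} (\<lambda>x. \<bar>G n x - v x\<bar>)) \<longlonglongrightarrow> 0"
    by (rule continuous_L1_approx[OF v]) blast
  have cr: "continuous_on UNIV r" using r by (meson DERIV_isCont continuous_at_imp_continuous_on)
  have bdd: "\<exists>C. \<forall>x\<in>{a..b}. \<bar>q x\<bar> \<le> C" if "continuous_on UNIV q" for q :: "real \<Rightarrow> real"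
  proof -
    have "compact (q ` {a..b})" by (intro compact_continuous_image continuous_on_subset[OF that]) auto
    then show ?thesis by (auto dest!: compact_imp_bounded simp: bounded_iff)
  qed
  obtain Cr where Cr: "\<And>x. x \<in> {a..b} \<Longrightarrow> \<bar>r x\<bar> \<le> Cr" using bdd[OF cr] by blast
  obtain Cg where Cg: "\<And>x. x \<in> {a..b} \<Longrightarrow> \<bar>g x\<bar> \<le> Cg" using bdd[OF g] by blast
  \<comment> \<open>Potentials are integrals from 0, and 0 may lie outside \<open>{a..b}\<close>;
    the L1 distance is therefore measured on a symmetric interval containing \<open>a\<close>,
    \<open>b\<close> and 0.\<close>
  define N where "N = max \<bar>a\<bar> \<bar>b\<bar>"
  define d where "d n = integral {-N..N} (\<lambda>x. \<bar>G n x - v x\<bar>)" for n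
  have d0: "d \<longlonglongrightarrow> 0" unfolding d_def by (rule G)
  have dn: "d n \<ge> 0" for n unfolding d_def
    by (rule integral_nonneg) (use bmeas_integrable[OF bmeas_diff_abs[OF G(2) v]] in auto)
  have mi: "(\<lambda>x. w x * q x) integrable_on {a..b}" if w: "bmeas C w" and q: "continuous_on UNIV q" for w q C
  proof -
    obtain D where D: "\<And>x. x \<in> {a..b} \<Longrightarrow> \<bar>q x\<bar> \<le> D" using bdd[OF q] by blast
    have [measurable]: "w \<in> borel_measurable lebesgue" "q \<in> borel_measurable lebesgue"
      using w continuous_measurable_lebesgue[OF q] by (auto simp: bmeas_def)
    show ?thesis
    proof (rule measurable_bounded_integrable[where B="C*D"])
      fix x assume "x \<in> {a..b}" then show "\<bar>w x * q x\<bar> \<le> C * D"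
        using D[of x] bmeas_bound[OF w, of x] bmeas_nonneg[OF w] unfolding abs_mult by (intro mult_mono) auto
    qed measurable
  qed
  have pi: "(\<lambda>x. pot w x * q x) integrable_on {a..b}" if w: "bmeas C w" and q: "continuous_on UNIV q" for w q C
    by (intro continuous_integrable_ivl continuous_intros continuous_pot[OF w] q)
  have classical: "integral {a..b} (\<lambda>x. G n x * r x) = - integral {a..b} (\<lambda>x. pot (G n) x * g x)" for n
  proof -
    note dp = pot_deriv[OF G(1), of n]
    have "((\<lambda>x. pot (G n) x * g x + G n x * r x) has_integral (pot (G n) b * r b - pot (G n) a * r a)) {a..b}"
    proof (rule fundamental_theorem_of_calculus[OF ab(1)])
      fix x
      have "((\<lambda>x. pot (G n) x * r x) has_real_derivative (pot (G n) x * g x + G n x * r x)) (at x)"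
        using DERIV_mult[OF dp[of x] r[of x]] by (simp add: algebra_simps)
      then show "((\<lambda>x. pot (G n) x * r x) has_vector_derivative (pot (G n) x * g x + G n x * r x)) (at x within {a..b})"
        unfolding has_real_derivative_iff_has_vector_derivative[symmetric] by (rule has_field_derivative_at_within)
    qed
    then have "integral {a..b} (\<lambda>x. pot (G n) x * g x + G n x * r x) = 0"
      using ab by (simp add: integral_unique)
    then show ?thesis using integral_add[OF pi[OF G(2) g, of n] mi[OF G(2) cr, of n]] by simp
  qed
  have 1: "(\<lambda>n. integral {a..b} (\<lambda>x. G n x * r x)) \<longlonglongrightarrow> integral {a..b} (\<lambda>x. v x * r x)"
  proof (rule Lim_null_comparison[where g = "\<lambda>n. Cr * d n", THEN Lim_null[THEN iffD2]])
    show "(\<lambda>n. Cr * d n) \<longlonglongrightarrow> 0" using d0 by (rule tendsto_mult_right_zero)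
    show "\<forall>\<^sub>F n in sequentially. norm (integral {a..b} (\<lambda>x. G n x * r x) - integral {a..b} (\<lambda>x. v x * r x)) \<le> Cr * d n"
    proof (rule always_eventually, rule allI)
      fix n
      have "norm (integral {a..b} (\<lambda>x. G n x * r x) - integral {a..b} (\<lambda>x. v x * r x)) = norm (integral {a..b} (\<lambda>x. G n x * r x - v x * r x))"
        by (simp add: integral_diff mi[OF G(2) cr] mi[OF v cr])
      also have "\<dots> \<le> integral {a..b} (\<lambda>x. Cr * \<bar>G n x - v x\<bar>)"
      proof (rule integral_norm_bound_integral)
        show "(\<lambda>x. G n x * r x - v x * r x) integrable_on {a..b}" by (intro integrable_diff mi[OF G(2) cr] mi[OF v cr])
        show "(\<lambda>x. Cr * \<bar>G n x - v x\<bar>) integrable_on {a..b}"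
          using bmeas_integrable[OF bmeas_diff_abs[OF G(2) v]] by (rule integrable_on_mult_right)
        fix x assume "x \<in> {a..b}"
        then have "\<bar>r x\<bar> * \<bar>G n x - v x\<bar> \<le> Cr * \<bar>G n x - v x\<bar>" using Cr[of x] by (intro mult_right_mono) auto
        then show "norm (G n x * r x - v x * r x) \<le> Cr * \<bar>G n x - v x\<bar>"
          unfolding left_diff_distrib[symmetric] by (simp add: abs_mult mult.commute)
      qed
      also have "\<dots> = Cr * integral {a..b} (\<lambda>x. \<bar>G n x - v x\<bar>)" by simp
      also have "\<dots> \<le> Cr * d n" unfolding d_def
      proof (intro mult_left_mono integral_subset_le bmeas_integrable[OF bmeas_diff_abs[OF G(2) v]])
        show "{a..b} \<subseteq> {-N..N}" unfolding N_def by auto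
        show "0 \<le> Cr" using Cr[of a] ab(1) by auto
      qed auto
      finally show "norm (integral {a..b} (\<lambda>x. G n x * r x) - integral {a..b} (\<lambda>x. v x * r x)) \<le> Cr * d n" .
    qed
  qed
  have potd: "\<bar>pot (G n) x - pot v x\<bar> \<le> d n" if "x \<in> {a..b}" for n x
  proof -
    have "\<bar>integral {p..q} (G n) - integral {p..q} v\<bar> \<le> d n" if "{p..q} \<subseteq> {-N..N}" for p q
    proof -
      have "\<bar>integral {p..q} (G n) - integral {p..q} v\<bar> = norm (integral {p..q} (\<lambda>x. G n x - v x))"
        by (simp add: integral_diff bmeas_integrable[OF G(2)] bmeas_integrable[OF v])
      also have "\<dots> \<le> integral {p..q} (\<lambda>x. \<bar>G n x - v x\<bar>)"
        by (intro integral_norm_bound_integral integrable_diff bmeas_integrable[OF G(2)] bmeas_integrable[OF v] bmeas_integrable[OF bmeas_diff_abs[OF G(2) v]]) auto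
      also have "\<dots> \<le> d n" unfolding d_def
        by (intro integral_subset_le that bmeas_integrable[OF bmeas_diff_abs[OF G(2) v]]) auto
      finally show ?thesis .
    qed
    note * = this
    have z1: "integral {0..x} w = 0" if "x \<le> 0" for w :: "real \<Rightarrow> real" using that by (cases "x = 0") auto
    have z2: "integral {x..0} w = 0" if "x \<ge> 0" for w :: "real \<Rightarrow> real" using that by (cases "x = 0") auto
    show ?thesis
    proof (cases "x \<ge> 0")
      case True
      have "{0..x} \<subseteq> {-N..N}" using that unfolding N_def by auto
      then show ?thesis using *[of 0 x] z2[OF True] by (simp add: pot_def)
    next
      case False
      then have "{x..0} \<subseteq> {-N..N}" using that unfolding N_def by auto
      then show ?thesis using *[of x 0] z1[of "G n"] z1[of v] False by (simp add: pot_def)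
    qed
  qed
  have 2: "(\<lambda>n. - integral {a..b} (\<lambda>x. pot (G n) x * g x)) \<longlonglongrightarrow> - integral {a..b} (\<lambda>x. pot v x * g x)"
  proof (rule tendsto_minus, rule Lim_null_comparison[where g = "\<lambda>n. d n * (Cg * (b - a))", THEN Lim_null[THEN iffD2]])
    show "(\<lambda>n. d n * (Cg * (b - a))) \<longlonglongrightarrow> 0" using d0 by (rule tendsto_mult_left_zero)
    show "\<forall>\<^sub>F n in sequentially. norm (integral {a..b} (\<lambda>x. pot (G n) x * g x) - integral {a..b} (\<lambda>x. pot v x * g x)) \<le> d n * (Cg * (b - a))"
    proof (rule always_eventually, rule allI)
      fix n
      have "norm (integral {a..b} (\<lambda>x. pot (G n) x * g x) - integral {a..b} (\<lambda>x. pot v x * g x)) = norm (integral {a..b} (\<lambda>x. pot (G n) x * g x - pot v x * g x))"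
        by (simp add: integral_diff pi[OF G(2) g] pi[OF v g])
      also have "\<dots> \<le> integral {a..b} (\<lambda>x. d n * Cg)"
      proof (rule integral_norm_bound_integral)
        fix x assume x: "x \<in> {a..b}"
        show "norm (pot (G n) x * g x - pot v x * g x) \<le> d n * Cg"
          using mult_mono[OF potd[OF x] Cg[OF x] dn] by (simp add: left_diff_distrib[symmetric] abs_mult)
      qed (auto intro!: integrable_diff pi[OF G(2) g] pi[OF v g])
      also have "\<dots> = d n * (Cg * (b - a))" using ab by simp
      finally show "norm (integral {a..b} (\<lambda>x. pot (G n) x * g x) - integral {a..b} (\<lambda>x. pot v x * g x)) \<le> d n * (Cg * (b - a))" .
    qed
  qed
  show ?thesis using LIMSEQ_unique[OF 1[unfolded classical] 2] .
qed

section \<open>Weak derivatives in time\<close>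

text \<open>From exponent 2 on, powers of the positive part are C1 across 0. The test functions
  below are built from them, since \<open>test_function\<close> asks for no more than C1.\<close>

lemma power_pos_part_deriv:
  "((\<lambda>z::real. max 0 z ^ Suc (Suc m)) has_real_derivative real (Suc (Suc m)) * max 0 z ^ Suc m) (at z)"
proof -
  consider "z > 0" | "z < 0" | "z = 0" by linarith
  then show ?thesis
  proof cases
    case 1
    have "((\<lambda>z. z ^ Suc (Suc m)) has_real_derivative real (Suc (Suc m)) * z ^ Suc m) (at z)"
      using DERIV_pow[of "Suc (Suc m)" z UNIV] by simp
    then have "((\<lambda>z. max 0 z ^ Suc (Suc m)) has_real_derivative real (Suc (Suc m)) * z ^ Suc m) (at z)"
      by (rule has_field_derivative_transform_within_open[where S="{0<..}"]) (use 1 in \<open>auto simp: max_def\<close>)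
    then show ?thesis using 1 by (simp add: max_def)
  next
    case 2
    have "((\<lambda>z. 0) has_real_derivative 0) (at z)" by simp
    then have "((\<lambda>z. max 0 z ^ Suc (Suc m)) has_real_derivative 0) (at z)"
      by (rule has_field_derivative_transform_within_open[where S="{..<0}"]) (use 2 in \<open>auto simp: max_def\<close>)
    then show ?thesis using 2 by (simp add: max_def)
  next
    case 3
    have "((\<lambda>h::real. max 0 h ^ Suc (Suc m) / h) \<longlongrightarrow> 0) (at 0)"
    proof (rule Lim_null_comparison)
      have "norm (max 0 h ^ Suc (Suc m) / h) \<le> max 0 h ^ Suc m" for h :: real
        by (cases "h > 0") (auto simp: max_def)
      then show "\<forall>\<^sub>F h in at (0::real). norm (max 0 h ^ Suc (Suc m) / h) \<le> max 0 h ^ Suc m" by simp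
      have "((\<lambda>h::real. max 0 h ^ Suc m) \<longlongrightarrow> max 0 0 ^ Suc m) (at 0)" by (intro tendsto_intros)
      then show "((\<lambda>h::real. max 0 h ^ Suc m) \<longlongrightarrow> 0) (at 0)" by simp
    qed
    then show ?thesis using 3 by (simp add: DERIV_def)
  qed
qed

text \<open>Half the second difference, at spacing \<open>d\<close>, of a squared positive part: a
  C1 step that rises from 0 at 0 to 1 at \<open>2 * d\<close>. Its derivative is a triangle of
  height \<open>1 / d\<close> with peak at \<open>d\<close>.\<close>

definition ramp :: "real \<Rightarrow> real \<Rightarrow> real" where
  "ramp d z = (max 0 (z/d) ^ 2 - 2 * max 0 (z/d - 1) ^ 2 + max 0 (z/d - 2) ^ 2) / 2"

definition ramp' :: "real \<Rightarrow> real \<Rightarrow> real" where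
  "ramp' d z = (max 0 (z/d) - 2 * max 0 (z/d - 1) + max 0 (z/d - 2)) / d"

lemma square_pos_part_deriv: "((\<lambda>z::real. max 0 z ^ 2) has_real_derivative 2 * max 0 z) (at z)"
  using power_pos_part_deriv[of 0 z] by (simp add: numeral_2_eq_2)

lemma square_pos_part_deriv_comp:
  assumes "(q has_real_derivative q') (at x)"
  shows "((\<lambda>x. max 0 (q x) ^ 2 :: real) has_real_derivative 2 * max 0 (q x) * q') (at x)"
  using DERIV_chain2[OF square_pos_part_deriv assms] .

lemma cube_pos_part_deriv_comp:
  assumes "(q has_real_derivative q') (at x)"
  shows "((\<lambda>x. max 0 (q x) ^ 3 :: real) has_real_derivative 3 * max 0 (q x) ^ 2 * q') (at x)"
proof -
  have "((\<lambda>z::real. max 0 z ^ 3) has_real_derivative 3 * max 0 z ^ 2) (at z)" for z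
    using power_pos_part_deriv[of 1 z] by (simp add: numeral_eq_Suc)
  from DERIV_chain2[OF this assms] show ?thesis .
qed

lemma ramp_deriv: "d > 0 \<Longrightarrow> (ramp d has_real_derivative ramp' d z) (at z)"
proof -
  assume d: "d > 0"
  have l: "((\<lambda>z. z/d - c) has_real_derivative 1/d) (at z)" for c
    using d by (auto intro!: derivative_eq_intros)
  have "((\<lambda>z. (max 0 (z/d - 0) ^ 2 - 2 * max 0 (z/d - 1) ^ 2 + max 0 (z/d - 2) ^ 2) / 2) has_real_derivative
    ((2 * max 0 (z/d - 0) * (1/d) - 2 * (2 * max 0 (z/d - 1) * (1/d)) + 2 * max 0 (z/d - 2) * (1/d)) / 2)) (at z)"
    by (intro DERIV_add DERIV_diff DERIV_cdivide DERIV_cmult square_pos_part_deriv_comp l)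
  moreover have "(2 * max 0 (z/d - 0) * (1/d) - 2 * (2 * max 0 (z/d - 1) * (1/d)) + 2 * max 0 (z/d - 2) * (1/d)) / 2 = ramp' d z"
    unfolding ramp'_def by (simp add: diff_divide_distrib add_divide_distrib)
  ultimately show ?thesis by (simp add: ramp_def[abs_def])
qed

lemma continuous_ramp': "continuous_on S (ramp' d)"
  unfolding ramp'_def[abs_def] divide_inverse by (intro continuous_intros)

lemma ramp_le_0: "d > 0 \<Longrightarrow> z \<le> 0 \<Longrightarrow> ramp d z = 0"
proof -
  assume "d > 0" "z \<le> 0"
  then have "z/d \<le> 0" by (simp add: divide_le_0_iff)
  then show ?thesis by (simp add: ramp_def max_def)
qed

lemma ramp_ge: assumes "d > 0" "z \<ge> 2 * d" shows "ramp d z = 1"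
proof -
  have "z/d \<ge> 2" using assms by (simp add: field_simps)
  then show ?thesis by (simp add: ramp_def max_def power2_eq_square algebra_simps)
qed

lemma ramp'_nonneg: "d > 0 \<Longrightarrow> 0 \<le> ramp' d z"
  unfolding ramp'_def by (intro divide_nonneg_pos) (auto simp: max_def)

lemma ramp'_eq_0: assumes "d > 0" "z \<le> 0 \<or> 2 * d \<le> z" shows "ramp' d z = 0"
proof -
  have "z/d \<le> 0 \<or> 2 \<le> z/d" using assms by (auto simp: divide_le_0_iff field_simps)
  then show ?thesis by (auto simp: ramp'_def max_def)
qed

lemma ramp_mono:
  assumes "d > 0" "x \<le> y" shows "ramp d x \<le> ramp d y"
  using assms(2)
proof (rule DERIV_nonneg_imp_nondecreasing)
  fix z show "\<exists>y. (ramp d has_real_derivative y) (at z) \<and> 0 \<le> y"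
    using ramp_deriv[OF assms(1)] ramp'_nonneg[OF assms(1)] by (intro exI[of _ "ramp' d z"] conjI)
qed

lemma continuous_antiderivative:
  fixes F :: "real \<Rightarrow> real"
  assumes F: "continuous_on {0..} F" and t: "t > 0"
  shows "((\<lambda>\<tau>. integral {0..\<tau>} F) has_real_derivative F t) (at t)"
proof -
  have "((\<lambda>u. integral {0..u} F) has_vector_derivative F t) (at t within {0..t+1})"
    by (rule integral_has_vector_derivative) (use t in \<open>auto intro: continuous_on_subset[OF F]\<close>)
  then show ?thesis
    using at_within_Icc_at[of 0 t "t+1"] t by (simp add: has_real_derivative_iff_has_vector_derivative)
qed

lemma continuous_antiderivative_on:
  fixes F :: "real \<Rightarrow> real"
  assumes F: "continuous_on {0..} F"
  shows "continuous_on {0..} (\<lambda>\<tau>. integral {0..\<tau>} F)"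
proof -
  have "continuous (at t within {0..}) (\<lambda>\<tau>. integral {0..\<tau>} F)" if "t \<ge> 0" for t
  proof -
    have "continuous_on {0..t+1} (\<lambda>\<tau>. integral {0..\<tau>} F)"
      by (intro indefinite_integral_continuous_1 integrable_continuous_interval continuous_on_subset[OF F]) auto
    then have "continuous (at t within {0..t+1}) (\<lambda>\<tau>. integral {0..\<tau>} F)"
      using that by (auto simp: continuous_on_eq_continuous_within)
    moreover have "at t within {0..} = at t within {0..t+1}"
      by (rule at_within_nhd[of t "{..<t+1}"]) auto
    ultimately show ?thesis by simp
  qed
  then show ?thesis by (auto simp: continuous_on_eq_continuous_within)
qed

text \<open>Hypothesis \<open>H\<close> says \<open>E' \<le> F\<close> weakly on positive times.
  Subtracting a primitive \<open>P\<close> of \<open>F\<close> reduces the claim to monotonicity of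
  \<open>D = E - P\<close>: if \<open>D\<close> rose from \<open>s\<close> to \<open>t\<close>, a
  plateau function climbing just after \<open>s\<close> and descending just after \<open>t\<close>
  would contradict \<open>H\<close>. The value \<open>s = 0\<close> is reached by
  continuity.\<close>

lemma weak_derivative_le:
  fixes E F :: "real \<Rightarrow> real"
  assumes E: "continuous_on {0..} E" and F: "continuous_on {0..} F"
    and H: "\<And>\<theta> \<theta>' a b. 0 < a \<Longrightarrow> a < b \<Longrightarrow> (\<And>x. (\<theta> has_real_derivative \<theta>' x) (at x)) \<Longrightarrow>
       continuous_on UNIV \<theta>' \<Longrightarrow> (\<And>x. 0 \<le> \<theta> x) \<Longrightarrow> (\<And>x. x \<notin> {a..b} \<Longrightarrow> \<theta> x = 0 \<and> \<theta>' x = 0) \<Longrightarrow>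
       0 \<le> integral {a..b} (\<lambda>\<tau>. E \<tau> * \<theta>' \<tau> + F \<tau> * \<theta> \<tau>)"
    and st: "0 \<le> s" "s \<le> t"
  shows "E t \<le> E s + integral {s..t} F"
proof -
  define P where "P \<tau> = integral {0..\<tau>} F" for \<tau>
  define D where "D \<tau> = E \<tau> - P \<tau>" for \<tau>
  have cP: "continuous_on {0..} P" unfolding P_def by (rule continuous_antiderivative_on[OF F])
  have cD: "continuous_on {0..} D" unfolding D_def by (intro continuous_intros E cP)
  have main: "D t \<le> D s" if st: "0 < s" "s < t" for s t
  proof (rule ccontr)
    assume "\<not> D t \<le> D s"
    define c where "c = (D s + D t) / 2"
    have c: "D s < c" "c < D t" using \<open>\<not> D t \<le> D s\<close> by (auto simp: c_def)
    have cD': "continuous_on {0<..} D" by (rule continuous_on_subset[OF cD]) auto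
    have cs: "isCont D s" "isCont D t" using cD' st by (auto simp: continuous_on_eq_continuous_at)
    obtain d1 where d1: "d1 > 0" "\<And>x. \<bar>x - s\<bar> < d1 \<Longrightarrow> \<bar>D x - D s\<bar> < c - D s"
    proof -
      have "c - D s > 0" using c by simp
      from LIM_D[OF cs(1)[unfolded isCont_def] this] obtain r
        where "r > 0" "\<forall>x. x \<noteq> s \<and> norm (x - s) < r \<longrightarrow> norm (D x - D s) < c - D s" by blast
      moreover have "\<bar>D x - D s\<bar> < c - D s" if "x = s" for x using that \<open>c - D s > 0\<close> by simp
      ultimately show ?thesis by (metis that real_norm_def)
    qed
    obtain d2 where d2: "d2 > 0" "\<And>x. \<bar>x - t\<bar> < d2 \<Longrightarrow> \<bar>D x - D t\<bar> < D t - c"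
    proof -
      have "D t - c > 0" using c by simp
      from LIM_D[OF cs(2)[unfolded isCont_def] this] obtain r
        where "r > 0" "\<forall>x. x \<noteq> t \<and> norm (x - t) < r \<longrightarrow> norm (D x - D t) < D t - c" by blast
      moreover have "\<bar>D x - D t\<bar> < D t - c" if "x = t" for x using that \<open>D t - c > 0\<close> by simp
      ultimately show ?thesis by (metis that real_norm_def)
    qed
    \<comment> \<open>A third leaves \<open>2 * d\<close> strictly below each bound, so the two
      triangles stay where \<open>D\<close> is close to its value at \<open>s\<close> or at
      \<open>t\<close>, and do not overlap.\<close>
    define d where "d = min (min d1 d2) (t - s) / 3"
    have d: "d > 0" "2*d < d1" "2*d < d2" "2*d < t - s" 
    proof -
      have "0 < d" "d \<le> d1 / 3" "d \<le> d2 / 3" "d \<le> (t - s) / 3" unfolding d_def using d1(1) d2(1) st by simp_all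
      then show "d > 0" "2*d < d1" "2*d < d2" "2*d < t - s" using d1(1) d2(1) st by simp_all
    qed
    define \<theta> where "\<theta> \<tau> = ramp d (\<tau> - s) - ramp d (\<tau> - t)" for \<tau>
    define \<theta>' where "\<theta>' \<tau> = ramp' d (\<tau> - s) - ramp' d (\<tau> - t)" for \<tau>
    have th: "(\<theta> has_real_derivative \<theta>' x) (at x)" for x
    proof -
      have "((\<lambda>\<tau>. ramp d (\<tau> - r)) has_real_derivative ramp' d (x - r) * (1 - 0)) (at x)" for r
        by (rule DERIV_chain2[OF ramp_deriv[OF d(1)]], rule DERIV_diff[OF DERIV_ident DERIV_const])
      from DERIV_diff[OF this[of s] this[of t]] show ?thesis unfolding \<theta>_def \<theta>'_def by simp
    qed
    have cth': "continuous_on S \<theta>'" for S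
      unfolding \<theta>'_def by (intro continuous_intros continuous_on_compose2[OF continuous_ramp'[of UNIV]]) auto
    have cth: "continuous_on S \<theta>" for S
      by (meson th DERIV_isCont continuous_at_imp_continuous_on)
    define b where "b = t + 2*d"
    have supp: "\<theta> x = 0 \<and> \<theta>' x = 0" if "x \<notin> {s..b}" for x
    proof -
      consider "x < s" | "x > b" using \<open>x \<notin> {s..b}\<close> by force
      then show ?thesis
      proof cases
        case 1 then show ?thesis using d(1) st by (simp add: \<theta>_def \<theta>'_def ramp_le_0 ramp'_eq_0)
      next
        case 2 then show ?thesis using d(1) st by (simp add: \<theta>_def \<theta>'_def ramp_ge ramp'_eq_0 b_def)
      qed
    qed
    have bnd: "\<theta> s = 0" "\<theta> b = 0" using d st by (simp_all add: \<theta>_def b_def ramp_le_0 ramp_ge)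
    have sb: "s < b" using st d by (simp add: b_def)
    have sub: "{s..b} \<subseteq> {0..}" using st by auto
    note cont = continuous_on_subset[OF E sub] continuous_on_subset[OF F sub] continuous_on_subset[OF cP sub] 
      continuous_on_subset[OF cD sub] cth cth'
    have 1: "0 \<le> integral {s..b} (\<lambda>\<tau>. E \<tau> * \<theta>' \<tau> + F \<tau> * \<theta> \<tau>)"
      by (rule H[OF st(1) sb th cth' _ supp]) (use ramp_mono[OF d(1)] st in \<open>auto simp: \<theta>_def\<close>)
    have 2: "((\<lambda>\<tau>. P \<tau> * \<theta>' \<tau> + F \<tau> * \<theta> \<tau>) has_integral (P b * \<theta> b - P s * \<theta> s)) {s..b}"
    proof (rule fundamental_theorem_of_calculus)
      fix x assume "x \<in> {s..b}"
      then have "x > 0" using st by auto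
      have "((\<lambda>x. P x * \<theta> x) has_real_derivative (P x * \<theta>' x + F x * \<theta> x)) (at x)"
        using DERIV_mult[OF continuous_antiderivative[OF F \<open>x > 0\<close>] th[of x]] by (simp add: P_def algebra_simps)
      then show "((\<lambda>x. P x * \<theta> x) has_vector_derivative (P x * \<theta>' x + F x * \<theta> x)) (at x within {s..b})"
        unfolding has_real_derivative_iff_has_vector_derivative[symmetric] by (rule has_field_derivative_at_within)
    qed (use sb in auto)
    have 3: "(\<theta>' has_integral (\<theta> b - \<theta> s)) {s..b}"
      by (rule fundamental_theorem_of_calculus)
        (use sb has_field_derivative_at_within[OF th] in \<open>auto simp: has_real_derivative_iff_has_vector_derivative[symmetric]\<close>)
    \<comment> \<open>Both \<open>(P \<theta>)'\<close> and \<open>\<theta>'\<close> integrate to 0,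
      because \<open>\<theta>\<close> vanishes at both ends. Hence \<open>E\<close> may be replaced
      by \<open>D\<close> and then lowered by the constant \<open>c\<close> without changing the
      integral.\<close>
    have "((\<lambda>\<tau>. (E \<tau> * \<theta>' \<tau> + F \<tau> * \<theta> \<tau>) - (P \<tau> * \<theta>' \<tau> + F \<tau> * \<theta> \<tau>) - c * \<theta>' \<tau>) has_integral
       (integral {s..b} (\<lambda>\<tau>. E \<tau> * \<theta>' \<tau> + F \<tau> * \<theta> \<tau>) - (P b * \<theta> b - P s * \<theta> s) - c * (\<theta> b - \<theta> s))) {s..b}"
      by (intro has_integral_diff has_integral_mult_right 2 3 integrable_integral integrable_continuous_interval continuous_intros cont)
    then have 4: "((\<lambda>\<tau>. (D \<tau> - c) * \<theta>' \<tau>) has_integral integral {s..b} (\<lambda>\<tau>. E \<tau> * \<theta>' \<tau> + F \<tau> * \<theta> \<tau>)) {s..b}"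
      unfolding bnd by (simp add: D_def algebra_simps)
    have neg: "(D \<tau> - c) * \<theta>' \<tau> \<le> 0" for \<tau>
    proof -
      consider "s < \<tau>" "\<tau> < s + 2*d" | "\<tau> \<le> s \<or> s + 2*d \<le> \<tau>" "t < \<tau>" "\<tau> < t + 2*d" 
        | "\<tau> \<le> s \<or> s + 2*d \<le> \<tau>" "\<tau> \<le> t \<or> t + 2*d \<le> \<tau>" by linarith
      then show ?thesis
      proof cases
        case 1
        then have "ramp' d (\<tau> - t) = 0" using d by (intro ramp'_eq_0) auto
        moreover have "D \<tau> < c" using d1(2)[of \<tau>] 1 d by auto
        ultimately show ?thesis using ramp'_nonneg[OF d(1)] by (auto simp: \<theta>'_def mult_le_0_iff)
      next
        case 2
        then have "ramp' d (\<tau> - s) = 0" using d by (intro ramp'_eq_0) auto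
        moreover have "D \<tau> > c" using d2(2)[of \<tau>] 2 d by auto
        ultimately show ?thesis using ramp'_nonneg[OF d(1)] by (auto simp: \<theta>'_def mult_le_0_iff)
      next
        case 3
        then have "ramp' d (\<tau> - s) = 0" "ramp' d (\<tau> - t) = 0" using d by (auto intro!: ramp'_eq_0)
        then show ?thesis by (simp add: \<theta>'_def)
      qed
    qed
    \<comment> \<open>The integrand has one sign and an integral of the opposite sign, so by
      continuity it vanishes identically; at \<open>s + d\<close>, the peak of the first triangle,
      it cannot.\<close>
    have "integral {s..b} (\<lambda>\<tau>. - ((D \<tau> - c) * \<theta>' \<tau>)) = 0"
      using 1 4 has_integral_le[OF 4 has_integral_0] neg by (simp add: integral_unique integral_neg)
    then have "\<forall>\<tau>\<in>{s..b}. - ((D \<tau> - c) * \<theta>' \<tau>) = 0"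
      by (subst (asm) integral_eq_0_iff) (use sb neg in \<open>auto intro!: continuous_intros cont\<close>)
    then have "(D (s+d) - c) * \<theta>' (s+d) = 0" using d by (auto simp: b_def)
    moreover have "D (s+d) < c" using d1(2)[of "s+d"] d by auto
    moreover have "ramp' d (s + d - t) = 0" using d by (intro ramp'_eq_0) auto
    ultimately show False using d by (simp add: \<theta>'_def ramp'_def)
  qed
  have "D t \<le> D s"
  proof (cases "s = t")
    case False
    show ?thesis
    proof (cases "s = 0")
      case False then show ?thesis using main[of s t] st \<open>s \<noteq> t\<close> by auto
    next
      case True
      have t: "t > 0" using True \<open>s \<noteq> t\<close> st by auto
      have "(D \<longlongrightarrow> D 0) (at 0 within {0..})" using cD by (auto simp: continuous_on_def)
      then have 1: "(D \<longlongrightarrow> D 0) (at_right 0)" by (rule tendsto_within_subset) auto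
      have "\<forall>\<^sub>F x in at_right 0. D t \<le> D x"
        using eventually_at_right_real[OF t] by eventually_elim (use main in auto)
      with 1 have "D t \<le> D 0" by (rule tendsto_lowerbound) simp
      then show ?thesis using True by simp
    qed
  qed simp
  moreover have "P s + integral {s..t} F = P t" unfolding P_def
    by (rule Henstock_Kurzweil_Integration.integral_combine) (use st in \<open>auto intro!: integrable_continuous_interval continuous_on_subset[OF F]\<close>)
  ultimately show ?thesis by (simp add: D_def)
qed

section \<open>Iterated integrals of Lebesgue measurable functions\<close>

lemma integral_AE_cong:
  fixes f g :: "real \<Rightarrow> real"
  assumes "AE x in lborel. f x = g x" shows "integral S f = integral S g"
proof -
  have "(f has_integral y) S \<longleftrightarrow> (g has_integral y) S" for y
    by (rule has_integral_AE) (use assms in auto)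
  then show ?thesis by (metis integral_unique not_integrable_integral integrable_on_def)
qed

text \<open>Lebesgue measure on the plane is a completion, not a product measure. \<open>G\<close>
  is replaced by a Borel function equal to it almost everywhere, for which Fubini holds; the two
  agree again on almost every slice.\<close>

lemma fubini_lebesgue:
  fixes G :: "real \<times> real \<Rightarrow> real"
  assumes G: "G \<in> borel_measurable lebesgue" "\<And>p. \<bar>G p\<bar> \<le> B" and z: "\<And>p. p \<notin> {a..b} \<times> {c..d} \<Longrightarrow> G p = 0"
  shows "integral\<^sup>L lebesgue G = integral {a..b} (\<lambda>t. integral {c..d} (\<lambda>x. G (t, x)))"
proof -
  have "G absolutely_integrable_on cbox (a,c) (b,d)"
    by (rule measurable_bounded_by_integrable_imp_absolutely_integrable[where g="\<lambda>_. B"])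
      (use G in \<open>auto intro: measurable_restrict_space1\<close>)
  then have "integrable lebesgue (\<lambda>p. indicator (cbox (a,c) (b,d)) p * G p)"
    by (simp add: set_integrable_def)
  moreover have "(\<lambda>p. indicator (cbox (a,c) (b,d)) p * G p) = G"
  proof (rule ext)
    fix p show "indicator (cbox (a,c) (b,d)) p * G p = G p"
    proof (cases "p \<in> {a..b} \<times> {c..d}")
      case False with z[of p] show ?thesis by simp
    qed (auto simp: cbox_Pair_eq)
  qed
  ultimately have Gi: "integrable lebesgue G" by simp
  obtain G' where G': "G' \<in> borel_measurable lborel" and AE: "AE p in lborel. G p = G' p"
    using completion_ex_borel_measurable_real[OF G(1)] by auto
  have AE': "AE p in lebesgue. G p = G' p" using AE by (rule AE_completion)
  have G'l: "G' \<in> borel_measurable lebesgue" using G' by (rule measurable_completion)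
  have "integrable lebesgue G'" using integrable_cong_AE[OF G(1) G'l AE'] Gi by simp
  then have G'i: "integrable lborel G'" using integrable_completion[OF G'] by simp
  have eq: "integral\<^sup>L lebesgue G = integral\<^sup>L lborel G'"
    using integral_cong_AE[OF G(1) G'l AE'] integral_completion[OF G'] by simp
  have G'p: "integrable (lborel \<Otimes>\<^sub>M lborel) (\<lambda>(t,x). G' (t,x))" using G'i by (simp add: lborel_prod)
  have F: "integral\<^sup>L lborel G' = (\<integral>t. (\<integral>x. G' (t,x) \<partial>lborel) \<partial>lborel)"
    using lborel_pair.integral_fst'[of G'] G'i by (simp add: lborel_prod)
  have Fi: "integrable lborel (\<lambda>t. \<integral>x. G' (t,x) \<partial>lborel)"
    using lborel_pair.integrable_fst'[of G'] G'i by (simp add: lborel_prod)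
  have A1: "AE t in lborel. integrable lborel (\<lambda>x. G' (t,x))"
    using lborel_pair.AE_integrable_fst'[of G'] G'i by (simp add: lborel_prod)
  have A2: "AE t in lborel. AE x in lborel. G (t,x) = G' (t,x)"
    by (rule lborel_pair.AE_pair[OF AE[folded lborel_prod]])
  have sec: "AE t in lborel. (\<integral>x. G' (t,x) \<partial>lborel) = (if t \<in> {a..b} then integral {c..d} (\<lambda>x. G (t,x)) else 0)"
    using A1 A2
  proof eventually_elim
    case (elim t)
    have "(\<integral>x. G' (t,x) \<partial>lborel) = integral UNIV (\<lambda>x. G' (t,x))" by (rule integral_lborel[OF elim(1), symmetric])
    also have "\<dots> = integral UNIV (\<lambda>x. G (t,x))" by (rule integral_AE_cong) (use elim(2) in auto)
    also have "\<dots> = integral UNIV (\<lambda>x. if x \<in> {c..d} then G (t,x) else 0)"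
      by (rule arg_cong[of _ _ "integral UNIV"]) (use z in auto)
    also have "\<dots> = integral {c..d} (\<lambda>x. G (t,x))" by (rule integral_restrict_UNIV)
    also have "\<dots> = (if t \<in> {a..b} then integral {c..d} (\<lambda>x. G (t,x)) else 0)"
    proof (cases "t \<in> {a..b}")
      case False then have "(\<lambda>x. G (t,x)) = (\<lambda>x. 0)" using z by auto
      then show ?thesis by simp
    qed simp
    finally show ?case .
  qed
  have "(\<integral>t. (\<integral>x. G' (t,x) \<partial>lborel) \<partial>lborel) = integral UNIV (\<lambda>t. \<integral>x. G' (t,x) \<partial>lborel)"
    by (rule integral_lborel[OF Fi, symmetric])
  also have "\<dots> = integral UNIV (\<lambda>t. if t \<in> {a..b} then integral {c..d} (\<lambda>x. G (t,x)) else 0)"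
    by (rule integral_AE_cong[OF sec])
  also have "\<dots> = integral {a..b} (\<lambda>t. integral {c..d} (\<lambda>x. G (t,x)))"
    by (rule integral_restrict_UNIV)
  finally show ?thesis using eq F by simp
qed

section \<open>The Kruzkov inequality between two times\<close>

locale evolution =
  fixes K :: real and u :: "real \<Rightarrow> real \<Rightarrow> real"
  assumes bm: "0 \<le> t \<Longrightarrow> bmeas K (u t)"
    and L1: "0 \<le> t \<Longrightarrow> ((\<lambda>s. integral {-R..R} (\<lambda>x. \<bar>u s x - u t x\<bar>)) \<longlongrightarrow> 0) (at t within {0..})"
begin

lemma u_bound: "0 \<le> t \<Longrightarrow> \<bar>u t x\<bar> \<le> K"
  using bm bmeas_bound by blast

lemma K_nonneg: "0 \<le> K"
  using bm[of 0] bmeas_nonneg by auto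

lemma measurable_slice:
  fixes H :: "real \<Rightarrow> real \<Rightarrow> real \<Rightarrow> real"
  assumes H: "continuous_on ({0..} \<times> UNIV) (\<lambda>(t, x, v). H t x v)" and t: "0 \<le> t"
  shows "(\<lambda>x. H t x (u t x)) \<in> borel_measurable lebesgue"
proof -
  have 1: "(\<lambda>x::real. x) \<in> borel_measurable lebesgue" using continuous_measurable_lebesgue[of "\<lambda>x. x"] by simp
  have 2: "u t \<in> borel_measurable lebesgue" using bmeas_measurable[OF bm[OF t]] .
  have c: "continuous_on UNIV (\<lambda>p. (t, fst p, snd p) :: real \<times> real \<times> real)" by (intro continuous_intros)
  have 3: "continuous_on UNIV (\<lambda>p. H t (fst p) (snd p))"
  proof -
    have "(\<lambda>p::real\<times>real. (t, fst p, snd p)) ` UNIV \<subseteq> {0..} \<times> UNIV" using t by auto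
    from continuous_on_compose2[OF H c this] show ?thesis by (simp add: case_prod_unfold)
  qed
  show ?thesis by (rule borel_measurable_continuous_Pair[OF 1 2 3])
qed

lemma integrable_slice:
  fixes H :: "real \<Rightarrow> real \<Rightarrow> real \<Rightarrow> real"
  assumes H: "continuous_on ({0..} \<times> UNIV) (\<lambda>(t, x, v). H t x v)" and t: "0 \<le> t"
  shows "(\<lambda>x. H t x (u t x)) integrable_on {a..b}"
proof -
  have "compact ((\<lambda>(t, x, v). H t x v) ` ({t} \<times> {a..b} \<times> {-K..K}))"
    by (intro compact_continuous_image continuous_on_subset[OF H] compact_Times) (use t in auto)
  then obtain B where B: "\<And>p. p \<in> {t} \<times> {a..b} \<times> {-K..K} \<Longrightarrow> \<bar>(\<lambda>(t, x, v). H t x v) p\<bar> \<le> B"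
    by (force dest!: compact_imp_bounded simp: bounded_iff)
  show ?thesis
  proof (rule measurable_bounded_integrable[OF measurable_slice[OF H t]])
    fix x assume "x \<in> {a..b}" then show "\<bar>H t x (u t x)\<bar> \<le> B"
      using B[of "(t, x, u t x)"] u_bound[OF t, of x] by (auto simp: abs_le_iff)
  qed
qed

text \<open>On a compact set \<open>H\<close> is uniformly continuous, while \<open>u\<close> is
  only L1 continuous in time. Where \<open>u s x\<close> and \<open>u t x\<close> are close,
  \<open>H\<close> changes by less than \<open>\<eta>\<close>; elsewhere its oscillation, at most
  \<open>2 * B\<close>, is bounded by \<open>C\<close> times their distance, which is why
  \<open>C\<close> is \<open>4 * B / d\<close>.\<close>

lemma continuous_slice_integral:
  fixes H :: "real \<Rightarrow> real \<Rightarrow> real \<Rightarrow> real"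
  assumes H: "continuous_on ({0..} \<times> UNIV) (\<lambda>(t, x, v). H t x v)" and ab: "a \<le> b"
  shows "continuous_on {0..} (\<lambda>t. integral {a..b} (\<lambda>x. H t x (u t x)))"
proof -
  let ?I = "\<lambda>t. integral {a..b} (\<lambda>x. H t x (u t x))"
  let ?h = "\<lambda>(t, x, v). H t x v"
  have "(?I \<longlongrightarrow> ?I t) (at t within {0..})" if t: "0 \<le> t" for t
  proof (rule tendstoI)
    fix e :: real assume e: "e > 0"
    define S where "S = {0..t+1} \<times> {a..b} \<times> {-K..K}"
    have cS: "compact S" unfolding S_def by (intro compact_Times) auto
    have HS: "continuous_on S ?h" by (rule continuous_on_subset[OF H]) (auto simp: S_def)
    obtain B where B: "\<And>p. p \<in> S \<Longrightarrow> \<bar>?h p\<bar> \<le> B"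
      using compact_imp_bounded[OF compact_continuous_image[OF HS cS]] by (force simp: bounded_iff)
    have B0: "B \<ge> 0" using B[of "(t, a, 0)"] K_nonneg t ab by (auto simp: S_def)
    define \<eta> where "\<eta> = e / (2 * (b - a + 1))"
    have \<eta>: "\<eta> > 0" using e ab by (simp add: \<eta>_def)
    obtain d where d: "d > 0" "\<And>p q. p \<in> S \<Longrightarrow> q \<in> S \<Longrightarrow> dist q p < d \<Longrightarrow> \<bar>?h q - ?h p\<bar> < \<eta>"
      using compact_uniformly_continuous[OF HS cS] \<eta> unfolding uniformly_continuous_on_def dist_real_def by metis
    define C where "C = 4 * B / d"
    have C0: "C \<ge> 0" using B0 d by (simp add: C_def)
    have pt: "\<bar>H s x (u s x) - H t x (u t x)\<bar> \<le> \<eta> + C * \<bar>u s x - u t x\<bar>"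
      if s: "0 \<le> s" "s \<le> t + 1" "\<bar>s - t\<bar> < d/2" and x: "x \<in> {a..b}" for s x
    proof -
      have S: "(s, x, u s x) \<in> S" "(t, x, u t x) \<in> S"
        using s x t u_bound[of s x] u_bound[of t x] by (auto simp: S_def abs_le_iff)
      show ?thesis
      proof (cases "\<bar>u s x - u t x\<bar> < d/2")
        case True
        have "dist (s, x, u s x) (t, x, u t x) \<le> \<bar>s - t\<bar> + \<bar>u s x - u t x\<bar>"
          by (simp add: dist_Pair_Pair dist_real_def sqrt_sum_squares_le_sum_abs)
        then have "dist (s, x, u s x) (t, x, u t x) < d" using True s by simp
        from d(2)[OF S(2,1) this] have "\<bar>H s x (u s x) - H t x (u t x)\<bar> < \<eta>" by simp
        then show ?thesis using mult_nonneg_nonneg[OF C0 abs_ge_zero[of "u s x - u t x"]] by linarith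
      next
        case False
        have "C * (d/2) \<le> C * \<bar>u s x - u t x\<bar>" using False C0 by (intro mult_left_mono) auto
        moreover have "C * (d/2) = 2 * B" using d by (simp add: C_def)
        moreover have "\<bar>H s x (u s x) - H t x (u t x)\<bar> \<le> 2 * B" using B[OF S(1)] B[OF S(2)] by auto
        ultimately show ?thesis using \<eta> by linarith
      qed
    qed
    define R where "R = max \<bar>a\<bar> \<bar>b\<bar>"
    have ab_sub: "{a..b} \<subseteq> {-R..R}" unfolding R_def by auto
    have "\<forall>\<^sub>F s in at t within {0..}. \<bar>integral {-R..R} (\<lambda>x. \<bar>u s x - u t x\<bar>)\<bar> < e / (2 * (C + 1))"
      using tendstoD[OF L1[OF t, of R], of "e / (2 * (C + 1))"] e C0 by simp
    moreover have "\<forall>\<^sub>F s in at t within {0..}. s \<in> {0..} \<and> \<bar>s - t\<bar> < min (d/2) 1"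
      unfolding eventually_at_filter using d 
      by (auto simp: eventually_nhds_metric dist_real_def intro!: exI[of _ "min (d/2) 1"])
    ultimately show "\<forall>\<^sub>F s in at t within {0..}. dist (?I s) (?I t) < e"
    proof eventually_elim
      case (elim s)
      then have s: "0 \<le> s" "s \<le> t + 1" "\<bar>s - t\<bar> < d/2" by auto
      note bd = bmeas_integrable[OF bmeas_diff_abs[OF bm[OF s(1)] bm[OF t]]]
      have "dist (?I s) (?I t) = norm (integral {a..b} (\<lambda>x. H s x (u s x) - H t x (u t x)))"
        by (simp add: dist_real_def integral_diff integrable_slice[OF H] s t)
      also have "\<dots> \<le> integral {a..b} (\<lambda>x. \<eta> + C * \<bar>u s x - u t x\<bar>)"
        by (intro integral_norm_bound_integral integrable_diff integrable_slice[OF H] s t integrable_add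
            integrable_on_mult_right bd integrable_const_Icc) (use pt[OF s] in auto)
      also have "\<dots> = \<eta> * (b - a) + C * integral {a..b} (\<lambda>x. \<bar>u s x - u t x\<bar>)"
        using ab by (simp add: integral_add integrable_on_mult_right bd)
      also have "\<dots> < e"
      proof -
        have "integral {a..b} (\<lambda>x. \<bar>u s x - u t x\<bar>) \<le> integral {-R..R} (\<lambda>x. \<bar>u s x - u t x\<bar>)"
          by (rule integral_subset_le[OF ab_sub bd bd]) auto
        then have "integral {a..b} (\<lambda>x. \<bar>u s x - u t x\<bar>) \<le> e / (2 * (C + 1))" using elim by linarith
        then have "C * integral {a..b} (\<lambda>x. \<bar>u s x - u t x\<bar>) \<le> C * (e / (2 * (C + 1)))"
          using C0 by (rule mult_left_mono)
        also have "\<dots> < (C + 1) * (e / (2 * (C + 1)))" using e C0 by (intro mult_strict_right_mono) auto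
        also have "\<dots> = e / 2" using C0 by (simp add: field_simps)
        finally have 1: "C * integral {a..b} (\<lambda>x. \<bar>u s x - u t x\<bar>) < e / 2" .
        have "\<eta> * (b - a) \<le> \<eta> * (b - a + 1)" using \<eta> by simp
        also have "\<dots> = e / 2" using ab unfolding \<eta>_def by (simp add: divide_simps)
        finally show ?thesis using 1 by linarith
      qed
      finally show ?case .
    qed
  qed
  then show ?thesis by (simp add: continuous_on_def)
qed

end

locale kruzkov = evolution +
  fixes f :: "real \<Rightarrow> real"
  assumes f_convex: "convex_on UNIV f"
    and joint: "(\<lambda>(t, x). u t x) \<in> borel_measurable (lebesgue_on ({0<..} \<times> UNIV))"
    and entropy: "test_function \<phi> \<phi>t \<phi>x \<Longrightarrow>
        0 \<le> (LINT (t, x)|lebesgue_on ({0<..} \<times> UNIV).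
               \<bar>u t x - k\<bar> * \<phi>t (t, x) + sgn (u t x - k) * (f (u t x) - f k) * \<phi>x (t, x))"
begin

definition flux :: "real \<Rightarrow> real \<Rightarrow> real" where
  "flux k v = sgn (v - k) * (f v - f k)"

lemma continuous_f: "continuous_on S f"
  using convex_on_continuous[OF open_UNIV f_convex] continuous_on_subset by blast

text \<open>The sign factor merely orders the two values of \<open>f\<close>; in this form
  continuity across \<open>v = k\<close> is evident.\<close>

lemma flux_eq: "flux k v = f (max v k) - f (min v k)"
  by (auto simp: flux_def sgn_if max_def min_def)

lemma continuous_flux: "continuous_on S (flux k)"
  unfolding flux_eq[abs_def] by (intro continuous_intros continuous_on_compose2[OF continuous_f[of UNIV]]) auto

text \<open>The entropy inequality is tested with products \<open>\<theta>(t) \<phi>(t,x)\<close>,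
  where \<open>\<theta>\<close> is supported in positive times. By Fubini it becomes the hypothesis
  of \<open>weak_derivative_le\<close> for the weighted entropy \<open>E\<close>; so
  \<open>\<phi>\<close> has to be differentiable at positive times only, and the initial time is
  included.\<close>

lemma kruzkov_slices:
  assumes der: "\<And>t x. 0 < t \<Longrightarrow> (\<phi> has_derivative (\<lambda>h. \<phi>t (t,x) * fst h + \<phi>x (t,x) * snd h)) (at (t,x))"
    and cont: "continuous_on ({0..} \<times> UNIV) \<phi>" "continuous_on ({0..} \<times> UNIV) \<phi>t" "continuous_on ({0..} \<times> UNIV) \<phi>x"
    and nonneg: "\<And>t x. 0 \<le> t \<Longrightarrow> 0 \<le> \<phi> (t,x)"
    and R: "0 \<le> R" and supp: "\<And>t x. 0 \<le> t \<Longrightarrow> R \<le> \<bar>x\<bar> \<Longrightarrow> \<phi> (t,x) = 0 \<and> \<phi>t (t,x) = 0 \<and> \<phi>x (t,x) = 0"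
    and st: "0 \<le> s" "s \<le> t"
  shows "integral {-R..R} (\<lambda>x. \<bar>u t x - k\<bar> * \<phi> (t,x)) \<le> integral {-R..R} (\<lambda>x. \<bar>u s x - k\<bar> * \<phi> (s,x))
     + integral {s..t} (\<lambda>\<tau>. integral {-R..R} (\<lambda>x. \<bar>u \<tau> x - k\<bar> * \<phi>t (\<tau>,x) + flux k (u \<tau> x) * \<phi>x (\<tau>,x)))"
proof -
  have comp: "continuous_on ({0..} \<times> UNIV) (\<lambda>(t, x, v::real). q (t, x))" if "continuous_on ({0..} \<times> UNIV) q" for q :: "real \<times> real \<Rightarrow> real"
  proof -
    have "continuous_on ({0..} \<times> UNIV) (\<lambda>p::real\<times>real\<times>real. q (fst p, fst (snd p)))"
      by (rule continuous_on_compose2[OF that]) (auto intro!: continuous_intros)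
    then show ?thesis by (simp add: case_prod_unfold)
  qed
  have fl: "continuous_on ({0..} \<times> UNIV) (\<lambda>(t::real, x::real, v). flux k v)"
    unfolding case_prod_unfold by (rule continuous_on_compose2[OF continuous_flux[of UNIV]]) (auto intro!: continuous_intros)
  have ab: "continuous_on ({0..} \<times> UNIV) (\<lambda>(t::real, x::real, v). \<bar>v - k\<bar>)"
    unfolding case_prod_unfold by (intro continuous_intros)
  have HE: "continuous_on ({0..} \<times> UNIV) (\<lambda>(t, x, v). \<bar>v - k\<bar> * \<phi> (t,x))"
    using continuous_on_mult[OF ab comp[OF cont(1)]] by (simp add: case_prod_unfold)
  have HF: "continuous_on ({0..} \<times> UNIV) (\<lambda>(t, x, v). \<bar>v - k\<bar> * \<phi>t (t,x) + flux k v * \<phi>x (t,x))"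
    using continuous_on_add[OF continuous_on_mult[OF ab comp[OF cont(2)]] continuous_on_mult[OF fl comp[OF cont(3)]]]
    by (simp add: case_prod_unfold)
  define E where "E t = integral {-R..R} (\<lambda>x. \<bar>u t x - k\<bar> * \<phi> (t,x))" for t
  define F where "F t = integral {-R..R} (\<lambda>x. \<bar>u t x - k\<bar> * \<phi>t (t,x) + flux k (u t x) * \<phi>x (t,x))" for t
  have cE: "continuous_on {0..} E" unfolding E_def using continuous_slice_integral[OF HE] R by auto
  have cF: "continuous_on {0..} F" unfolding F_def using continuous_slice_integral[OF HF] R by auto
  have "E t \<le> E s + integral {s..t} F"
  proof (rule weak_derivative_le[OF cE cF _ st])
    fix \<theta> \<theta>' :: "real \<Rightarrow> real" and a b :: real
    assume a: "0 < a" "a < b" and d\<theta>: "\<And>x. (\<theta> has_real_derivative \<theta>' x) (at x)"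
      and c\<theta>': "continuous_on UNIV \<theta>'" and n\<theta>: "\<And>x. 0 \<le> \<theta> x" and z\<theta>: "\<And>x. x \<notin> {a..b} \<Longrightarrow> \<theta> x = 0 \<and> \<theta>' x = 0"
    have c\<theta>: "continuous_on UNIV \<theta>" by (meson d\<theta> DERIV_isCont continuous_at_imp_continuous_on)
    define \<psi> where "\<psi> p = \<theta> (fst p) * \<phi> p" for p
    define \<psi>t where "\<psi>t p = \<theta>' (fst p) * \<phi> p + \<theta> (fst p) * \<phi>t p" for p
    define \<psi>x where "\<psi>x p = \<theta> (fst p) * \<phi>x p" for p
    have z\<psi>: "\<psi> p = 0 \<and> \<psi>t p = 0 \<and> \<psi>x p = 0" if "p \<notin> {a..b} \<times> {-R..R}" for p
    proof (cases p)
      case (Pair t x)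
      show ?thesis
      proof (cases "t \<in> {a..b}")
        case True
        then have "R \<le> \<bar>x\<bar>" "0 \<le> t" using that Pair a by auto
        from supp[OF this(2,1)] show ?thesis using Pair by (simp add: \<psi>_def \<psi>t_def \<psi>x_def)
      next
        case False with z\<theta>[of t] show ?thesis using Pair by (simp add: \<psi>_def \<psi>t_def \<psi>x_def)
      qed
    qed
    \<comment> \<open>The plane is covered by the open sets \<open>t > 0\<close> and
      \<open>t < a\<close>; on the second one the product with \<open>\<theta>\<close> vanishes,
      whatever the values of \<open>\<phi>\<close> at negative times.\<close>
    have cpos: "continuous_on UNIV q" if q: "continuous_on ({0<..} \<times> UNIV) q" "\<And>p. fst p < a \<Longrightarrow> q p = 0" for q :: "real \<times> real \<Rightarrow> real"
    proof -
      have "continuous_on ({..<a} \<times> UNIV) q"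
        by (rule continuous_on_cong[THEN iffD1, OF refl _ continuous_on_const[of _ 0]]) (use q(2) in auto)
      then have "continuous_on ({0<..} \<times> UNIV \<union> {..<a} \<times> UNIV) q"
        using q(1) by (intro continuous_on_open_Un open_Times) auto
      moreover have "({0<..} \<times> UNIV \<union> {..<a} \<times> UNIV) = (UNIV :: (real \<times> real) set)" using a by (auto intro: le_less_trans)
      ultimately show ?thesis by simp
    qed
    have sub: "continuous_on ({0<..} \<times> UNIV) q" if "continuous_on ({0..} \<times> UNIV) q" for q :: "real \<times> real \<Rightarrow> real"
      by (rule continuous_on_subset[OF that]) auto
    have cth: "continuous_on S (\<lambda>p. \<theta> (fst p))" "continuous_on S (\<lambda>p. \<theta>' (fst p))" for S :: "(real \<times> real) set"
      by (rule continuous_on_compose2[OF c\<theta>] continuous_on_compose2[OF c\<theta>'], auto intro!: continuous_intros)+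
    have c\<psi>t: "continuous_on UNIV \<psi>t" 
      by (rule cpos) (use z\<theta> in \<open>auto simp: \<psi>t_def intro!: continuous_intros cth sub cont\<close>)
    have c\<psi>x: "continuous_on UNIV \<psi>x" 
      by (rule cpos) (use z\<theta> in \<open>auto simp: \<psi>x_def intro!: continuous_intros cth sub cont\<close>)
    have der\<psi>: "(\<psi> has_derivative (\<lambda>h. \<psi>t p * fst h + \<psi>x p * snd h)) (at p)" for p
    proof (cases p)
      case (Pair t x)
      show ?thesis
      proof (cases "0 < t")
        case True
        have 1: "((\<lambda>p. \<theta> (fst p)) has_derivative (\<lambda>h. \<theta>' t * fst h)) (at (t,x))"
        proof -
          have "(\<theta> has_derivative (\<lambda>h. \<theta>' t * h)) (at (fst (t,x)))" using d\<theta>[of t] by (simp add: has_field_derivative_def)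
          from has_derivative_compose[OF has_derivative_fst[OF has_derivative_ident] this] show ?thesis by simp
        qed
        have "(\<psi> has_derivative (\<lambda>h. \<theta> (fst (t,x)) * (\<phi>t (t,x) * fst h + \<phi>x (t,x) * snd h) + (\<theta>' t * fst h) * \<phi> (t,x))) (at (t,x))"
          unfolding \<psi>_def[abs_def] by (rule has_derivative_mult[OF 1 der[OF True]])
        then show ?thesis unfolding Pair
          by (rule has_derivative_eq_rhs) (simp add: \<psi>t_def \<psi>x_def algebra_simps fun_eq_iff)
      next
        case False
        then have pa: "p \<in> {..<a} \<times> UNIV" using Pair a by auto
        have "((\<lambda>_. 0) has_derivative (\<lambda>h. \<psi>t p * fst h + \<psi>x p * snd h)) (at p)"
          using z\<psi>[of p] pa by (cases p) auto
        then show ?thesis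
        proof (rule has_derivative_transform_within_open[OF _ _ pa])
          fix q :: "real \<times> real" assume "q \<in> {..<a} \<times> UNIV"
          then show "0 = \<psi> q" using z\<psi>[of q] by (cases q) auto
        qed (intro open_Times; simp)
      qed
    qed
    have "{p. \<psi> p \<noteq> 0} \<subseteq> {a..b} \<times> {-R..R}" using z\<psi> by blast
    then have cl: "closure {p. \<psi> p \<noteq> 0} \<subseteq> {a..b} \<times> {-R..R}" by (rule closure_minimal) (intro closed_Times; simp)
    have "test_function \<psi> \<psi>t \<psi>x" unfolding test_function_def
    proof (intro conjI allI der\<psi> c\<psi>t c\<psi>x)
      show "0 \<le> \<psi> p" for p
      proof (cases "p \<in> {a..b} \<times> {-R..R}")
        case True then show ?thesis using nonneg[of "fst p" "snd p"] n\<theta> a by (auto simp: \<psi>_def)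
      next
        case False with z\<psi>[of p] show ?thesis by simp
      qed
      have "compact ({a..b} \<times> {-R..R})" by (intro compact_Times) auto
      from compact_Int_closed[OF this closed_closure[of "{p. \<psi> p \<noteq> 0}"]] cl show "compact (closure {p. \<psi> p \<noteq> 0})"
        by (simp add: Int_absorb1)
      show "closure {p. \<psi> p \<noteq> 0} \<subseteq> {0<..} \<times> UNIV" using cl a by auto
    qed
    from entropy[OF this, of k]
    have pos: "0 \<le> (LINT p|lebesgue_on ({0<..} \<times> UNIV). \<bar>u (fst p) (snd p) - k\<bar> * \<psi>t p + flux k (u (fst p) (snd p)) * \<psi>x p)"
      (is "0 \<le> integral\<^sup>L _ ?I") by (simp add: flux_def case_prod_unfold)
    define G where "G p = (if p \<in> {0<..} \<times> UNIV then ?I p else 0)" for p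
    have HP: "{0<..} \<times> (UNIV::real set) \<in> sets (lebesgue :: (real \<times> real) measure)"
      using open_Times[of "{0::real<..}" "UNIV::real set"] by (auto intro: lmeasurable_open)
    have Im: "?I \<in> borel_measurable (lebesgue_on ({0<..} \<times> UNIV))"
    proof -
      have [measurable]: "(\<lambda>p. u (fst p) (snd p)) \<in> borel_measurable (lebesgue_on ({0<..} \<times> UNIV))"
        using joint by (simp add: case_prod_unfold)
      have [measurable]: "\<psi>t \<in> borel_measurable (lebesgue_on ({0<..} \<times> UNIV))" "\<psi>x \<in> borel_measurable (lebesgue_on ({0<..} \<times> UNIV))"
        using c\<psi>t c\<psi>x by (auto intro!: measurable_restrict_space1 borel_measurable_continuous_onI measurable_completion)
      have [measurable]: "flux k \<in> borel_measurable borel"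
        by (rule borel_measurable_continuous_onI[OF continuous_flux])
      show ?thesis by measurable
    qed
    have Gm: "G \<in> borel_measurable lebesgue" unfolding G_def
      using borel_measurable_if[OF HP, of ?I] Im by simp
    have IG: "integral\<^sup>L (lebesgue_on ({0<..} \<times> UNIV)) ?I = integral\<^sup>L lebesgue G"
    proof -
      have "integral\<^sup>L (lebesgue_on ({0<..} \<times> UNIV)) ?I = (LINT p|lebesgue. indicator ({0<..} \<times> UNIV) p *\<^sub>R ?I p)"
        by (rule integral_restrict_space) (use HP in simp)
      also have "\<dots> = integral\<^sup>L lebesgue G"
        by (rule Bochner_Integration.integral_cong) (auto simp: G_def indicator_def)
      finally show ?thesis .
    qed
    have zG: "G p = 0" if "p \<notin> {a..b} \<times> {-R..R}" for p using z\<psi>[OF that] by (simp add: G_def)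
    have bdd: "\<exists>C. \<forall>p\<in>{a..b} \<times> {-R..R}. \<bar>q p\<bar> \<le> C" if "continuous_on UNIV q" for q :: "real \<times> real \<Rightarrow> real"
      using compact_imp_bounded[OF compact_continuous_image[OF continuous_on_subset[OF that subset_UNIV] compact_Times[OF compact_Icc compact_Icc]]]
      by (simp add: bounded_iff)
    obtain C1 where C1: "\<And>p. p \<in> {a..b} \<times> {-R..R} \<Longrightarrow> \<bar>\<psi>t p\<bar> \<le> C1" using bdd[OF c\<psi>t] by blast
    obtain C2 where C2: "\<And>p. p \<in> {a..b} \<times> {-R..R} \<Longrightarrow> \<bar>\<psi>x p\<bar> \<le> C2" using bdd[OF c\<psi>x] by blast
    have "\<exists>C. \<forall>v\<in>{-K..K}. \<bar>flux k v\<bar> \<le> C"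
      using compact_imp_bounded[OF compact_continuous_image[OF continuous_flux compact_Icc]]
      by (simp add: bounded_iff)
    then obtain C3 where "\<forall>v\<in>{-K..K}. \<bar>flux k v\<bar> \<le> C3" by blast
    then have C3: "\<bar>flux k v\<bar> \<le> C3" if "\<bar>v\<bar> \<le> K" for v
    proof -
      have "v \<in> {-K..K}" using that by auto
      then show ?thesis using \<open>\<forall>v\<in>{-K..K}. \<bar>flux k v\<bar> \<le> C3\<close> by blast
    qed
    define B where "B = (K + \<bar>k\<bar>) * C1 + C3 * C2"
    have GB: "\<bar>G p\<bar> \<le> \<bar>B\<bar>" for p
    proof (cases "p \<in> {a..b} \<times> {-R..R}")
      case True
      then have t: "fst p \<ge> 0" "fst p > 0" using a by auto
      have "\<bar>?I p\<bar> \<le> \<bar>u (fst p) (snd p) - k\<bar> * \<bar>\<psi>t p\<bar> + \<bar>flux k (u (fst p) (snd p))\<bar> * \<bar>\<psi>x p\<bar>"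
        by (rule order_trans[OF abs_triangle_ineq]) (simp add: abs_mult)
      also have "\<dots> \<le> B" unfolding B_def
        by (intro add_mono mult_mono C1 C2 C3 True u_bound t order_trans[OF abs_triangle_ineq4 add_right_mono]) 
          (use K_nonneg C3[OF u_bound[OF t(1), of 0]] in auto)
      finally show ?thesis using True a by (auto simp: G_def)
    qed (simp add: zG)
    have "0 \<le> integral\<^sup>L lebesgue G" using pos IG by simp
    also have "\<dots> = integral {a..b} (\<lambda>t. integral {-R..R} (\<lambda>x. G (t,x)))"
      by (rule fubini_lebesgue[OF Gm GB zG])
    also have "\<dots> = integral {a..b} (\<lambda>\<tau>. E \<tau> * \<theta>' \<tau> + F \<tau> * \<theta> \<tau>)"
    proof (rule Henstock_Kurzweil_Integration.integral_cong)
      fix t assume "t \<in> {a..b}"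
      then have t: "0 < t" "0 \<le> t" using a by auto
      have "integral {-R..R} (\<lambda>x. G (t,x)) = integral {-R..R} (\<lambda>x. (\<bar>u t x - k\<bar> * \<phi> (t,x)) * \<theta>' t + (\<bar>u t x - k\<bar> * \<phi>t (t,x) + flux k (u t x) * \<phi>x (t,x)) * \<theta> t)"
        by (rule Henstock_Kurzweil_Integration.integral_cong) (use t in \<open>simp add: G_def \<psi>t_def \<psi>x_def algebra_simps\<close>)
      also have "\<dots> = E t * \<theta>' t + F t * \<theta> t"
        unfolding E_def F_def using integrable_slice[OF HE t(2)] integrable_slice[OF HF t(2)]
        by (subst integral_add) (auto intro!: integrable_on_mult_left)
      finally show "integral {-R..R} (\<lambda>x. G (t,x)) = E t * \<theta>' t + F t * \<theta> t" .
    qed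
    finally show "0 \<le> integral {a..b} (\<lambda>\<tau>. E \<tau> * \<theta>' \<tau> + F \<tau> * \<theta> \<tau>)" .
  qed
  then show ?thesis by (simp add: E_def F_def[abs_def])
qed

end

section \<open>Conservation and the potential of a solution\<close>

text \<open>Trapezoids with flanks of slope \<open>n\<close> inside \<open>[c, d]\<close>: they
  converge to the indicator of the open interval without enlarging the support.\<close>

definition hat :: "nat \<Rightarrow> real \<Rightarrow> real \<Rightarrow> real \<Rightarrow> real" where
  "hat n c d x = min 1 (real n * max 0 (min (x - c) (d - x)))"

lemma continuous_hat: "continuous_on S (hat n c d)"
  unfolding hat_def[abs_def] by (intro continuous_intros)

lemma hat_bounds: "0 \<le> hat n c d x" "hat n c d x \<le> 1"
  by (auto simp: hat_def)

lemma hat_eq_0: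
  assumes "x \<le> c \<or> d \<le> x" shows "hat n c d x = 0"
proof -
  have "min (x - c) (d - x) \<le> 0" using assms by (auto simp: min_le_iff_disj)
  then have "max 0 (min (x - c) (d - x)) = 0" by (rule max_absorb1)
  then show ?thesis by (simp add: hat_def)
qed

lemma hat_tendsto: "(\<lambda>n. hat n c d x) \<longlonglongrightarrow> (if x \<in> {c<..<d} then 1 else 0)"
proof (cases "x \<in> {c<..<d}")
  case True
  define r where "r = min (x - c) (d - x)"
  have r: "r > 0" using True by (auto simp: r_def)
  obtain N :: nat where N: "1 / r < real N" using reals_Archimedean2 by blast
  have "hat n c d x = 1" if "n \<ge> N" for n
  proof -
    have "1 / r < real n" using N that by simp
    then have "1 \<le> real n * r" using r by (simp add: field_simps)
    then show ?thesis using r by (simp add: hat_def r_def[symmetric] max_def)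
  qed
  then have "\<forall>\<^sub>F n in sequentially. hat n c d x = 1" by (rule eventually_sequentiallyI)
  then have "(\<lambda>n. hat n c d x) \<longlonglongrightarrow> 1" by (rule tendsto_eventually)
  then show ?thesis using True by simp
next
  case False
  then have "hat n c d x = 0" for n using hat_eq_0[of x c d n] by (auto simp: not_less)
  moreover have "(if x \<in> {c<..<d} then 1 else 0 :: real) = 0" using False by simp
  ultimately show ?thesis by (simp only: tendsto_const)
qed

lemma hat_integral_tendsto:
  fixes w :: "real \<Rightarrow> real"
  assumes i: "\<And>n. (\<lambda>x. w x * hat n c d x) integrable_on {-N..N}" and B: "\<And>x. x \<in> {-N..N} \<Longrightarrow> \<bar>w x\<bar> \<le> B"
    and N: "-N \<le> c" "c \<le> d" "d \<le> N"
  shows "(\<lambda>n. integral {-N..N} (\<lambda>x. w x * hat n c d x)) \<longlonglongrightarrow> integral {c..d} w"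
proof -
  have "(\<lambda>n. integral {-N..N} (\<lambda>x. w x * hat n c d x)) \<longlonglongrightarrow> integral {-N..N} (\<lambda>x. w x * (if x \<in> {c<..<d} then 1 else 0))"
  proof (rule dominated_convergence[where h="\<lambda>_. B"])
    fix n x assume x: "x \<in> {-N..N}"
    have "\<bar>w x\<bar> * \<bar>hat n c d x\<bar> \<le> B * 1"
      by (intro mult_mono B x) (use hat_bounds[of n c d x] B[OF x] in auto)
    then show "norm (w x * hat n c d x) \<le> B" by (simp add: abs_mult)
  next
    fix x show "(\<lambda>k. w x * hat k c d x) \<longlonglongrightarrow> w x * (if x \<in> {c<..<d} then 1 else 0)"
      by (intro tendsto_intros hat_tendsto)
  qed (use i in auto)
  also have "integral {-N..N} (\<lambda>x. w x * (if x \<in> {c<..<d} then 1 else 0)) = integral {-N..N} (\<lambda>x. if x \<in> {c..d} then w x else 0)"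
    by (rule integral_spike[of "{c,d}"]) auto
  also have "\<dots> = integral {c..d} w"
    using integral_restrict_Int[of "{-N..N}" "{c..d}" w] N by (simp add: Int_absorb1)
  finally show ?thesis .
qed

section \<open>Joint continuity of averaged solutions in time and space\<close>

lemma jointly_continuous:
  fixes q :: "real \<Rightarrow> real \<Rightarrow> real"
  assumes t: "\<And>x. continuous_on {0..} (\<lambda>t. q t x)" and x: "\<And>t x y. 0 \<le> t \<Longrightarrow> \<bar>q t x - q t y\<bar> \<le> C * \<bar>x - y\<bar>"
  shows "continuous_on ({0..} \<times> UNIV) (\<lambda>p. q (fst p) (snd p))"
proof -
  have "((\<lambda>p. q (fst p) (snd p)) \<longlongrightarrow> q t0 x0) (at (t0,x0) within {0..} \<times> UNIV)" if t0: "0 \<le> t0" for t0 x0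
  proof -
    let ?F = "at (t0,x0) within {0..} \<times> UNIV"
    have f: "(fst \<longlongrightarrow> t0) ?F" "(snd \<longlongrightarrow> x0) ?F" by (auto intro!: tendsto_eq_intros)
    have "((\<lambda>p. q (fst p) x0) \<longlongrightarrow> q t0 x0) ?F"
      by (rule continuous_on_tendsto_compose[OF t f(1)]) (use t0 in \<open>auto simp: eventually_at_filter intro!: always_eventually\<close>)
    then have "((\<lambda>p. \<bar>q (fst p) x0 - q t0 x0\<bar>) \<longlongrightarrow> 0) ?F" by (intro tendsto_rabs_zero LIM_zero)
    moreover have "((\<lambda>p. C * \<bar>snd p - x0\<bar>) \<longlongrightarrow> C * \<bar>x0 - x0\<bar>) ?F" by (intro tendsto_intros f)
    ultimately have lim: "((\<lambda>p. C * \<bar>snd p - x0\<bar> + \<bar>q (fst p) x0 - q t0 x0\<bar>) \<longlongrightarrow> 0) ?F" using tendsto_add by fastforce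
    show ?thesis
    proof (rule LIM_zero_cancel, rule Lim_null_comparison[OF _ lim])
      have "norm (q s y - q t0 x0) \<le> C * \<bar>y - x0\<bar> + \<bar>q s x0 - q t0 x0\<bar>" if "s \<ge> 0" for s y
        using x[OF that, of y x0] by simp
      then show "\<forall>\<^sub>F p in ?F. norm (q (fst p) (snd p) - q t0 x0) \<le> C * \<bar>snd p - x0\<bar> + \<bar>q (fst p) x0 - q t0 x0\<bar>"
        by (auto simp: eventually_at_filter intro!: always_eventually)
    qed
  qed
  then show ?thesis by (auto simp: continuous_on_def)
qed

lemma avg_lipschitz:
  assumes v: "bmeas B v" and h: "h > 0" shows "\<bar>avg h v x - avg h v y\<bar> \<le> B / h * \<bar>x - y\<bar>"
proof -
  have "avg h v x - avg h v y = ((pot v (x+h) - pot v (y+h)) - (pot v (x-h) - pot v (y-h))) / (2*h)"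
    by (simp add: avg_eq_pot[OF bmeas_integrable[OF v] h] diff_divide_distrib)
  also have "\<bar>\<dots>\<bar> = \<bar>(pot v (x+h) - pot v (y+h)) - (pot v (x-h) - pot v (y-h))\<bar> / (2*h)" using h by (simp add: abs_divide)
  also have "\<dots> \<le> (B * \<bar>x - y\<bar> + B * \<bar>x - y\<bar>) / (2*h)"
    using pot_lipschitz[OF v, of "x+h" "y+h"] pot_lipschitz[OF v, of "x-h" "y-h"] h
    by (intro divide_right_mono) auto
  also have "\<dots> = B / h * \<bar>x - y\<bar>" using h by (simp add: field_simps)
  finally show ?thesis .
qed

context evolution
begin

lemma slice_prod:
  fixes N q :: "real \<Rightarrow> real"
  assumes N: "continuous_on UNIV N" and q: "continuous_on UNIV q"
  shows "continuous_on ({0..} \<times> UNIV) (\<lambda>(t::real, x, v). N v * q x)"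
  unfolding case_prod_unfold
  by (intro continuous_intros continuous_on_compose2[OF N] continuous_on_compose2[OF q]) auto

lemma integrable_prod:
  fixes N q :: "real \<Rightarrow> real"
  assumes "continuous_on UNIV N" "continuous_on UNIV q" "0 \<le> t"
  shows "(\<lambda>x. N (u t x) * q x) integrable_on {a..b}"
  using integrable_slice[OF slice_prod[OF assms(1,2)] assms(3)] .

lemma continuous_prod:
  fixes N q :: "real \<Rightarrow> real"
  assumes "continuous_on UNIV N" "continuous_on UNIV q" "a \<le> b"
  shows "continuous_on {0..} (\<lambda>t. integral {a..b} (\<lambda>x. N (u t x) * q x))"
  using continuous_slice_integral[OF slice_prod[OF assms(1,2)] assms(3)] .

lemma integrable_comp:
  fixes N :: "real \<Rightarrow> real"
  assumes "continuous_on UNIV N" "0 \<le> t" shows "(\<lambda>x. N (u t x)) integrable_on {a..b}"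
  using integrable_prod[OF assms(1) continuous_on_const[of _ 1] assms(2)] by simp

lemma continuous_comp:
  fixes N :: "real \<Rightarrow> real"
  assumes "continuous_on UNIV N" "a \<le> b"
  shows "continuous_on {0..} (\<lambda>t. integral {a..b} (\<lambda>x. N (u t x)))"
  using continuous_prod[OF assms(1) continuous_on_const[of _ 1] assms(2)] by simp

lemma integrable_time:
  fixes F :: "real \<Rightarrow> real"
  shows "continuous_on {0..} F \<Longrightarrow> 0 \<le> s \<Longrightarrow> F integrable_on {s..t}"
  by (rule integrable_continuous_interval) (erule continuous_on_subset, auto)

lemma bmeas_comp:
  fixes N :: "real \<Rightarrow> real"
  assumes "continuous_on UNIV N" obtains B where "\<And>t. 0 \<le> t \<Longrightarrow> bmeas B (\<lambda>x. N (u t x))"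
proof -
  have "compact (N ` {-K..K})" by (intro compact_continuous_image continuous_on_subset[OF assms]) auto
  then obtain B where B: "\<forall>v\<in>{-K..K}. \<bar>N v\<bar> \<le> B" by (auto dest!: compact_imp_bounded simp: bounded_iff)
  have "bmeas B (\<lambda>x. N (u t x))" if t: "0 \<le> t" for t
  proof -
    have "\<bar>N (u t x)\<bar> \<le> B" for x
    proof -
      have "u t x \<in> {-K..K}" using u_bound[OF t, of x] by auto
      then show ?thesis using B by blast
    qed
    moreover have "(\<lambda>x. N (u t x)) \<in> borel_measurable lebesgue"
      using measurable_slice[OF slice_prod[OF assms continuous_on_const[of _ 1]] t] by simp
    ultimately show ?thesis by (simp add: bmeas_def)
  qed
  then show ?thesis by (rule that)
qed

lemma continuous_avg_time:
  fixes N :: "real \<Rightarrow> real"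
  assumes "continuous_on UNIV N" "h > 0"
  shows "continuous_on {0..} (\<lambda>t. avg h (\<lambda>y. N (u t y)) x)"
  unfolding avg_def divide_inverse using assms(2) by (intro continuous_intros continuous_comp[OF assms(1)]) auto

lemma continuous_avg_joint:
  fixes N :: "real \<Rightarrow> real"
  assumes "continuous_on UNIV N" "h > 0"
  shows "continuous_on ({0..} \<times> UNIV) (\<lambda>p. avg h (\<lambda>y. N (u (fst p) y)) (snd p))"
proof -
  obtain B where B: "\<And>t. 0 \<le> t \<Longrightarrow> bmeas B (\<lambda>x. N (u t x))" using bmeas_comp[OF assms(1)] by blast
  show ?thesis
    by (rule jointly_continuous[where q="\<lambda>t x. avg h (\<lambda>y. N (u t y)) x" and C="B/h"])
       (use continuous_avg_time[OF assms] avg_lipschitz[OF B assms(2)] in auto)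
qed

end

context kruzkov
begin

text \<open>For \<open>k = K\<close> and \<open>k = -K\<close> the modulus has no kink on the range
  of \<open>u\<close>, so the entropy inequality is affine in \<open>u\<close> and
  \<open>f(u)\<close>; the two choices give opposite inequalities, hence equality. The constants
  \<open>f(k)\<close> drop out because \<open>g\<close>, the derivative of a compactly supported
  function, has integral 0.\<close>

lemma conservation_nonneg:
  assumes r: "\<And>x. (\<rho> has_real_derivative g x) (at x)" and g: "continuous_on UNIV g" and nn: "\<And>x. 0 \<le> \<rho> x"
    and R: "0 \<le> R" and supp: "\<And>x. R \<le> \<bar>x\<bar> \<Longrightarrow> \<rho> x = 0 \<and> g x = 0" and st: "0 \<le> s" "s \<le> t"
  shows "integral {-R..R} (\<lambda>x. u t x * \<rho> x) = integral {-R..R} (\<lambda>x. u s x * \<rho> x)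
    + integral {s..t} (\<lambda>\<tau>. integral {-R..R} (\<lambda>x. f (u \<tau> x) * g x))"
proof -
  have c\<rho>: "continuous_on UNIV \<rho>" by (meson r DERIV_isCont continuous_at_imp_continuous_on)
  have t: "0 \<le> t" using st by simp
  have ci: "continuous_on UNIV (\<lambda>v::real. v)" by simp
  have cf: "continuous_on UNIV f" by (rule continuous_f)
  have K: "integral {-R..R} (\<lambda>x. \<bar>u t x - k\<bar> * \<rho> x) \<le> integral {-R..R} (\<lambda>x. \<bar>u s x - k\<bar> * \<rho> x)
     + integral {s..t} (\<lambda>\<tau>. integral {-R..R} (\<lambda>x. flux k (u \<tau> x) * g x))" for k
  proof -
    have d: "((\<lambda>p. \<rho> (snd p)) has_derivative (\<lambda>h. 0 * fst h + g x * snd h)) (at (t,x))" for t x :: real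
    proof -
      have "(\<rho> has_derivative (\<lambda>h. g x * h)) (at (snd (t,x)))" using r[of x] by (simp add: has_field_derivative_def)
      from has_derivative_compose[OF has_derivative_snd[OF has_derivative_ident] this] show ?thesis by simp
    qed
    have cc: "continuous_on S (\<lambda>p. \<rho> (snd p))" "continuous_on S (\<lambda>p. g (snd p))" for S :: "(real\<times>real) set"
      by (rule continuous_on_compose2[OF c\<rho>] continuous_on_compose2[OF g], auto intro!: continuous_intros)+
    show ?thesis
      using kruzkov_slices[of "\<lambda>p. \<rho> (snd p)" "\<lambda>_. 0" "\<lambda>p. g (snd p)" R s t k, OF _ cc(1) _ cc(2) _ R _ st] d nn supp
      by simp
  qed
  have int_g: "integral {-R..R} g = 0"
  proof -
    have "(g has_integral (\<rho> R - \<rho> (-R))) {-R..R}"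
      by (rule fundamental_theorem_of_calculus)
        (use R has_field_derivative_at_within[OF r] in \<open>auto simp: has_real_derivative_iff_has_vector_derivative[symmetric]\<close>)
    then show ?thesis using supp[of R] supp[of "-R"] R by (simp add: integral_unique)
  qed
  have eq: "\<sigma> * (integral {-R..R} (\<lambda>x. u s x * \<rho> x) - integral {-R..R} (\<lambda>x. u t x * \<rho> x))
    \<le> - \<sigma> * integral {s..t} (\<lambda>\<tau>. integral {-R..R} (\<lambda>x. f (u \<tau> x) * g x))" if \<sigma>: "\<sigma> = 1 \<or> \<sigma> = -1" for \<sigma>
  proof -
    have E: "integral {-R..R} (\<lambda>x. \<bar>u t x - \<sigma> * K\<bar> * \<rho> x) = K * integral {-R..R} \<rho> - \<sigma> * integral {-R..R} (\<lambda>x. u t x * \<rho> x)" if t: "0 \<le> t" for t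
    proof -
      have "\<bar>u t x - \<sigma> * K\<bar> * \<rho> x = K * \<rho> x - \<sigma> * (u t x * \<rho> x)" for x
      proof -
        have "\<bar>u t x - \<sigma> * K\<bar> = K - \<sigma> * u t x" using u_bound[OF t, of x] \<sigma> by auto
        then show ?thesis by (simp add: left_diff_distrib)
      qed
      then show ?thesis using integrable_prod[OF ci c\<rho> t] continuous_integrable_ivl[OF c\<rho>]
        by (simp add: integral_diff integrable_on_mult_right)
    qed
    have F: "integral {-R..R} (\<lambda>x. flux (\<sigma> * K) (u \<tau> x) * g x) = - \<sigma> * integral {-R..R} (\<lambda>x. f (u \<tau> x) * g x)" if \<tau>: "0 \<le> \<tau>" for \<tau>
    proof -
      have "flux (\<sigma> * K) (u \<tau> x) * g x = \<sigma> * f (\<sigma> * K) * g x - \<sigma> * (f (u \<tau> x) * g x)" for x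
      proof -
        have "-K \<le> u \<tau> x" "u \<tau> x \<le> K" using u_bound[OF \<tau>, of x] by auto
        then have "flux (\<sigma> * K) (u \<tau> x) = \<sigma> * (f (\<sigma> * K) - f (u \<tau> x))"
          using \<sigma> by (auto simp: flux_eq max_def min_def)
        then show ?thesis by (simp only: left_diff_distrib right_diff_distrib mult.assoc)
      qed
      then show ?thesis using integrable_prod[OF cf g \<tau>] continuous_integrable_ivl[OF g] int_g
        by (simp add: integral_diff integrable_on_mult_right)
    qed
    have "integral {s..t} (\<lambda>\<tau>. integral {-R..R} (\<lambda>x. flux (\<sigma> * K) (u \<tau> x) * g x)) = integral {s..t} (\<lambda>\<tau>. - \<sigma> * integral {-R..R} (\<lambda>x. f (u \<tau> x) * g x))"
      by (rule Henstock_Kurzweil_Integration.integral_cong) (use F st in auto)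
    then show ?thesis using K[of "\<sigma> * K"] unfolding E[OF t] E[OF st(1)] by (simp add: right_diff_distrib)
  qed
  show ?thesis using eq[of 1] eq[of "-1"] by simp
qed

text \<open>The entropy inequality admits only nonnegative weights. A signed \<open>\<rho>\<close>
  is written as \<open>(\<rho> + b) - b\<close> with a nonnegative C1 bump \<open>b\<close> that
  dominates \<open>|\<rho>|\<close>.\<close>

lemma conservation:
  assumes r: "\<And>x. (\<rho> has_real_derivative g x) (at x)" and g: "continuous_on UNIV g"
    and R: "0 \<le> R" and supp: "\<And>x. R \<le> \<bar>x\<bar> \<Longrightarrow> \<rho> x = 0 \<and> g x = 0" and st: "0 \<le> s" "s \<le> t"
  defines "N \<equiv> R + 1"
  shows "integral {-N..N} (\<lambda>x. u t x * \<rho> x) = integral {-N..N} (\<lambda>x. u s x * \<rho> x)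
    + integral {s..t} (\<lambda>\<tau>. integral {-N..N} (\<lambda>x. f (u \<tau> x) * g x))"
proof -
  have c\<rho>: "continuous_on UNIV \<rho>" by (meson r DERIV_isCont continuous_at_imp_continuous_on)
  have t: "0 \<le> t" using st by simp
  have ci: "continuous_on UNIV (\<lambda>v::real. v)" by simp
  have cf: "continuous_on UNIV f" by (rule continuous_f)
  have N: "0 \<le> N" "-N \<le> N" using R by (auto simp: N_def)
  obtain C where C: "\<forall>x\<in>{-R..R}. \<bar>\<rho> x\<bar> \<le> C"
    using compact_imp_bounded[OF compact_continuous_image[OF continuous_on_subset[OF c\<rho> subset_UNIV] compact_Icc[of "-R" R]]]
    by (auto simp: bounded_iff)
  have C0: "0 \<le> C" using C R by (force dest!: bspec[of _ _ 0])
  define b where "b x = C * max 0 (N^2 - x^2) ^ 2" for x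
  define b' where "b' x = C * (2 * max 0 (N^2 - x^2) * (0 - 2 * x))" for x
  have db: "(b has_real_derivative b' x) (at x)" for x
    unfolding b_def[abs_def] b'_def
    by (intro DERIV_cmult square_pos_part_deriv_comp DERIV_diff DERIV_const) (use DERIV_pow[of 2 x] in simp)
  have cb': "continuous_on UNIV b'" unfolding b'_def[abs_def] by (intro continuous_intros)
  have cb: "continuous_on UNIV b" unfolding b_def[abs_def] by (intro continuous_intros)
  have suppb: "b x = 0 \<and> b' x = 0" if "N \<le> \<bar>x\<bar>" for x
  proof -
    have "N^2 \<le> x^2" using power_mono[OF that N(1), of 2] by simp
    then show ?thesis by (simp add: b_def b'_def)
  qed
  have nb: "0 \<le> b x" for x using C0 by (simp add: b_def)
  have nrb: "0 \<le> \<rho> x + b x" for x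
  proof (cases "R \<le> \<bar>x\<bar>")
    case True then show ?thesis using supp nb by simp
  next
    case False
    then have x: "\<bar>x\<bar> \<le> R" by simp
    then have "x^2 \<le> R^2" by (simp add: abs_le_square_iff[symmetric])
    \<comment> \<open>Here \<open>N = R + 1\<close> pays off: the gap of at least 1 on
      \<open>|x| \<le> R\<close> makes \<open>b\<close> at least \<open>C\<close> there.\<close>
    then have 1: "1 \<le> N^2 - x^2" using R by (simp add: N_def power2_eq_square algebra_simps)
    then have "1 \<le> max 0 (N^2 - x^2) ^ 2" by simp
    then have "C * 1 \<le> b x" unfolding b_def using C0 by (intro mult_left_mono) auto
    moreover have "\<bar>\<rho> x\<bar> \<le> C" using C x by (auto simp: abs_le_iff)
    ultimately show ?thesis by linarith
  qed
  have e1: "integral {-N..N} (\<lambda>x. u t x * (\<rho> x + b x)) = integral {-N..N} (\<lambda>x. u s x * (\<rho> x + b x))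
    + integral {s..t} (\<lambda>\<tau>. integral {-N..N} (\<lambda>x. f (u \<tau> x) * (g x + b' x)))"
    by (rule conservation_nonneg[OF DERIV_add[OF r db] continuous_on_add[OF g cb'] nrb N(1) _ st])
      (use supp suppb in \<open>auto simp: N_def\<close>)
  have e2: "integral {-N..N} (\<lambda>x. u t x * b x) = integral {-N..N} (\<lambda>x. u s x * b x)
    + integral {s..t} (\<lambda>\<tau>. integral {-N..N} (\<lambda>x. f (u \<tau> x) * b' x))"
    by (rule conservation_nonneg[OF db cb' nb N(1) _ st]) (use suppb in auto)
  have a1: "integral {-N..N} (\<lambda>x. u t x * (\<rho> x + b x)) = integral {-N..N} (\<lambda>x. u t x * \<rho> x) + integral {-N..N} (\<lambda>x. u t x * b x)" if "0 \<le> t" for t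
    by (simp add: distrib_left integral_add integrable_prod[OF ci c\<rho> that] integrable_prod[OF ci cb that])
  have a2: "integral {-N..N} (\<lambda>x. f (u t x) * (g x + b' x)) = integral {-N..N} (\<lambda>x. f (u t x) * g x) + integral {-N..N} (\<lambda>x. f (u t x) * b' x)" if "0 \<le> t" for t
    by (simp add: distrib_left integral_add integrable_prod[OF cf g that] integrable_prod[OF cf cb' that])
  have "integral {s..t} (\<lambda>\<tau>. integral {-N..N} (\<lambda>x. f (u \<tau> x) * (g x + b' x))) = 
     integral {s..t} (\<lambda>\<tau>. integral {-N..N} (\<lambda>x. f (u \<tau> x) * g x) + integral {-N..N} (\<lambda>x. f (u \<tau> x) * b' x))"
    by (rule Henstock_Kurzweil_Integration.integral_cong) (use a2 st in auto)
  also have "\<dots> = integral {s..t} (\<lambda>\<tau>. integral {-N..N} (\<lambda>x. f (u \<tau> x) * g x)) + integral {s..t} (\<lambda>\<tau>. integral {-N..N} (\<lambda>x. f (u \<tau> x) * b' x))"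
    by (intro integral_add integrable_time continuous_prod[OF cf] g cb' N st)
  finally show ?thesis using e1 e2 unfolding a1[OF t] a1[OF st(1)] by linarith
qed

text \<open>Mean zero makes a primitive of \<open>g\<close> compactly supported, hence a weight for
  \<open>conservation\<close>; integration by parts then trades \<open>u\<close> and this primitive
  for the potential and \<open>g\<close>.\<close>

lemma pot_conservation:
  assumes g: "continuous_on UNIV g" and R: "0 \<le> R" and supp: "\<And>x. R \<le> \<bar>x\<bar> \<Longrightarrow> g x = 0"
    and ig: "integral {-R..R} g = 0" and t: "0 \<le> t"
  defines "N \<equiv> R + 1"
  shows "integral {-N..N} (\<lambda>x. (pot (u t) x - pot (u 0) x) * g x)
    + integral {0..t} (\<lambda>\<tau>. integral {-N..N} (\<lambda>x. f (u \<tau> x) * g x)) = 0"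
proof -
  note gi = continuous_integrable_ivl[OF g]
  define \<rho> where "\<rho> x = pot g x - pot g (-R)" for x
  have r: "(\<rho> has_real_derivative g x) (at x)" for x
    unfolding \<rho>_def[abs_def] using DERIV_diff[OF pot_deriv[OF g, of x] DERIV_const] by simp
  have z: "integral {p..q} g = 0" if "R \<le> p \<or> q \<le> -R" for p q
  proof -
    have "integral {p..q} g = integral {p..q} (\<lambda>_. 0)"
      by (rule Henstock_Kurzweil_Integration.integral_cong) (use that R supp in auto)
    then show ?thesis by simp
  qed
  have \<rho>0: "\<rho> x = 0" if "R \<le> \<bar>x\<bar>" for x
  proof (cases "R \<le> x")
    case True
    have "pot g R - pot g (-R) = 0" using pot_diff[OF gi, of "-R" R] R ig by simp
    moreover have "pot g x - pot g R = 0" using pot_diff[OF gi True] z by simp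
    ultimately show ?thesis by (simp add: \<rho>_def)
  next
    case False
    then have x: "x \<le> -R" using that by auto
    then show ?thesis using pot_diff[OF gi x] z[of x "-R"] by (simp add: \<rho>_def)
  qed
  have N: "-N \<le> N" "R \<le> \<bar>-N\<bar>" "R \<le> \<bar>N\<bar>" using R by (auto simp: N_def)
  have C: "integral {-N..N} (\<lambda>x. u t x * \<rho> x) = integral {-N..N} (\<lambda>x. u 0 x * \<rho> x)
    + integral {0..t} (\<lambda>\<tau>. integral {-N..N} (\<lambda>x. f (u \<tau> x) * g x))"
    unfolding N_def by (rule conservation[OF r g R _ order_refl t]) (use \<rho>0 supp in auto)
  have P: "integral {-N..N} (\<lambda>x. u t x * \<rho> x) = - integral {-N..N} (\<lambda>x. pot (u t) x * g x)" if "0 \<le> t" for t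
    by (rule pot_by_parts[OF bm[OF that] r g N(1) \<rho>0[OF N(2)] \<rho>0[OF N(3)]])
  have pi: "(\<lambda>x. pot (u t) x * g x) integrable_on {-N..N}" if "0 \<le> t" for t
    by (intro continuous_integrable_ivl continuous_intros continuous_pot[OF bm[OF that]] g)
  have "integral {-N..N} (\<lambda>x. (pot (u t) x - pot (u 0) x) * g x) = integral {-N..N} (\<lambda>x. pot (u t) x * g x) - integral {-N..N} (\<lambda>x. pot (u 0) x * g x)"
    by (simp add: left_diff_distrib integral_diff pi t)
  then show ?thesis using C unfolding P[OF t] P[OF order_refl] by linarith
qed

text \<open>The integrated residual of \<open>A_t + f(A_x) = 0\<close> for the potential
  \<open>pot (u t)\<close>. It need not vanish, because \<open>pot\<close> is pinned to 0 at the
  origin although mass may flow through the origin; but it will depend on the interval through its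
  length only.\<close>

definition defect :: "real \<Rightarrow> real \<Rightarrow> real \<Rightarrow> real" where
  "defect t c d = integral {c..d} (\<lambda>x. pot (u t) x - pot (u 0) x)
     + integral {0..t} (\<lambda>\<tau>. integral {c..d} (\<lambda>x. f (u \<tau> x)))"

text \<open>The functional annihilates all continuous densities of mean zero, so it is a multiple of
  the integral; the indicators of intervals are limits of such densities.\<close>

lemma defect_proportional:
  assumes t: "0 \<le> t" and cd: "c \<le> d" "c' \<le> d'"
  shows "(d' - c') * defect t c d = (d - c) * defect t c' d'"
proof -
  define R where "R = max (max \<bar>c\<bar> \<bar>d\<bar>) (max \<bar>c'\<bar> \<bar>d'\<bar>)"
  define N where "N = R + 1"
  have R: "0 \<le> R" "-R \<le> c" "d \<le> R" "-R \<le> c'" "d' \<le> R" unfolding R_def by (auto simp: max_def abs_if)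
  have N: "-N \<le> c" "d \<le> N" "-N \<le> c'" "d' \<le> N" "-N \<le> N" using R by (auto simp: N_def)
  define S where "S x = pot (u t) x - pot (u 0) x" for x
  have cS: "continuous_on UNIV S" unfolding S_def by (intro continuous_intros continuous_pot[OF bm] t order_refl)
  have cf: "continuous_on UNIV f" by (rule continuous_f)
  have "\<exists>B. \<forall>x\<in>{-N..N}. \<bar>S x\<bar> \<le> B"
    using compact_imp_bounded[OF compact_continuous_image[OF continuous_on_subset[OF cS subset_UNIV] compact_Icc]]
    by (simp add: bounded_iff)
  then obtain BS where BS: "\<And>x. x \<in> {-N..N} \<Longrightarrow> \<bar>S x\<bar> \<le> BS" by blast
  obtain Bf where Bf: "\<And>t. 0 \<le> t \<Longrightarrow> bmeas Bf (\<lambda>x. f (u t x))" using bmeas_comp[OF cf] by blast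
  define L where "L g = integral {-N..N} (\<lambda>x. S x * g x) + integral {0..t} (\<lambda>\<tau>. integral {-N..N} (\<lambda>x. f (u \<tau> x) * g x))" for g
  define m where "m n c d = integral {-N..N} (hat n c d)" for n c d
  have Llim: "(\<lambda>n. L (hat n c d)) \<longlonglongrightarrow> defect t c d" if cd: "-N \<le> c" "c \<le> d" "d \<le> N" for c d
    unfolding L_def defect_def
  proof (intro tendsto_add)
    show "(\<lambda>n. integral {-N..N} (\<lambda>x. S x * hat n c d x)) \<longlonglongrightarrow> integral {c..d} (\<lambda>x. pot (u t) x - pot (u 0) x)"
      unfolding S_def[symmetric]
      by (rule hat_integral_tendsto[OF _ BS cd]) (intro continuous_integrable_ivl continuous_intros cS continuous_hat)
    show "(\<lambda>n. integral {0..t} (\<lambda>\<tau>. integral {-N..N} (\<lambda>x. f (u \<tau> x) * hat n c d x))) \<longlonglongrightarrow>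
       integral {0..t} (\<lambda>\<tau>. integral {c..d} (\<lambda>x. f (u \<tau> x)))"
    proof (rule dominated_convergence[where h="\<lambda>_. Bf * (N - (-N))"])
      show "(\<lambda>\<tau>. integral {-N..N} (\<lambda>x. f (u \<tau> x) * hat n c d x)) integrable_on {0..t}" for n
        by (intro integrable_time continuous_prod[OF cf continuous_hat N(5)]) auto
      fix n :: nat and \<tau> assume "\<tau> \<in> {0..t}"
      then have \<tau>: "0 \<le> \<tau>" by simp
      have "norm (integral (cbox (-N) N) (\<lambda>x. f (u \<tau> x) * hat n c d x)) \<le> Bf * Henstock_Kurzweil_Integration.content (cbox (-N) N)"
      proof (rule has_integral_bound[OF _ integrable_integral])
        show "0 \<le> Bf" using bmeas_nonneg[OF Bf[OF \<tau>]] .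
        show "(\<lambda>x. f (u \<tau> x) * hat n c d x) integrable_on cbox (-N) N"
          using integrable_prod[OF cf continuous_hat \<tau>] by simp
        fix x
        have "\<bar>f (u \<tau> x)\<bar> * \<bar>hat n c d x\<bar> \<le> Bf * 1"
          using bmeas_bound[OF Bf[OF \<tau>], of x] hat_bounds[of n c d x] bmeas_nonneg[OF Bf[OF \<tau>]] by (intro mult_mono) auto
        then show "norm (f (u \<tau> x) * hat n c d x) \<le> Bf" by (simp add: abs_mult)
      qed
      then show "norm (integral {-N..N} (\<lambda>x. f (u \<tau> x) * hat n c d x)) \<le> Bf * (N - (-N))" using N by simp
    next
      fix \<tau> assume "\<tau> \<in> {0..t}"
      then have \<tau>: "0 \<le> \<tau>" by simp
      show "(\<lambda>n. integral {-N..N} (\<lambda>x. f (u \<tau> x) * hat n c d x)) \<longlonglongrightarrow> integral {c..d} (\<lambda>x. f (u \<tau> x))"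
        by (rule hat_integral_tendsto[OF integrable_prod[OF cf continuous_hat \<tau>] bmeas_bound[OF Bf[OF \<tau>]] cd])
    qed auto
  qed
  have mlim: "(\<lambda>n. m n c d) \<longlonglongrightarrow> d - c" if cd: "-N \<le> c" "c \<le> d" "d \<le> N" for c d
  proof -
    have "(\<lambda>n. integral {-N..N} (\<lambda>x. 1 * hat n c d x)) \<longlonglongrightarrow> integral {c..d} (\<lambda>_. 1::real)"
      by (rule hat_integral_tendsto[OF _ _ cd, where B=1]) (auto intro!: continuous_integrable_ivl continuous_hat)
    then show ?thesis using cd by (simp add: m_def)
  qed
  have "m n c' d' * L (hat n c d) = m n c d * L (hat n c' d')" for n
  proof -
    define g where "g x = m n c' d' * hat n c d x - m n c d * hat n c' d' x" for x
    have cg: "continuous_on UNIV g" unfolding g_def by (intro continuous_intros continuous_hat)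
    have hi: "hat n c d integrable_on {p..q}" for c d p q by (intro continuous_integrable_ivl continuous_hat)
    have supp: "g x = 0" if "R \<le> \<bar>x\<bar>" for x
      using that R hat_eq_0[of x c d n] hat_eq_0[of x c' d' n] unfolding g_def by force
    have "integral {-N..N} g = 0" unfolding g_def
      by (simp add: integral_diff integrable_on_mult_right hi m_def[symmetric])
    moreover have "integral {-N..N} g = integral {-R..R} g"
    proof -
      have "integral {-N..N} g = integral {-N..N} (\<lambda>x. if x \<in> {-R..R} then g x else 0)"
        by (rule Henstock_Kurzweil_Integration.integral_cong) (use supp in auto)
      then show ?thesis using integral_restrict_Int[of "{-N..N}" "{-R..R}" g] by (simp add: Int_absorb1 N_def)
    qed
    ultimately have "integral {-R..R} g = 0" by simp
    from pot_conservation[OF cg R(1) supp this t] have "L g = 0" by (simp add: L_def S_def N_def)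
    moreover have "L g = m n c' d' * L (hat n c d) - m n c d * L (hat n c' d')"
    proof -
      have Si: "(\<lambda>x. S x * hat n c d x) integrable_on {-N..N}" for c d
        by (intro continuous_integrable_ivl continuous_intros cS continuous_hat)
      have 1: "integral {-N..N} (\<lambda>x. S x * g x) = m n c' d' * integral {-N..N} (\<lambda>x. S x * hat n c d x) - m n c d * integral {-N..N} (\<lambda>x. S x * hat n c' d' x)"
      proof -
        have "(\<lambda>x. S x * g x) = (\<lambda>x. m n c' d' * (S x * hat n c d x) - m n c d * (S x * hat n c' d' x))"
          by (auto simp: g_def algebra_simps)
        then show ?thesis by (simp add: integral_diff integrable_on_mult_right Si)
      qed
      have 2: "integral {-N..N} (\<lambda>x. f (u \<tau> x) * g x) = m n c' d' * integral {-N..N} (\<lambda>x. f (u \<tau> x) * hat n c d x) - m n c d * integral {-N..N} (\<lambda>x. f (u \<tau> x) * hat n c' d' x)" if "0 \<le> \<tau>" for \<tau>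
      proof -
        have "(\<lambda>x. f (u \<tau> x) * g x) = (\<lambda>x. m n c' d' * (f (u \<tau> x) * hat n c d x) - m n c d * (f (u \<tau> x) * hat n c' d' x))"
          by (auto simp: g_def algebra_simps)
        then show ?thesis by (simp add: integral_diff integrable_on_mult_right integrable_prod[OF cf continuous_hat that])
      qed
      have 3: "integral {0..t} (\<lambda>\<tau>. integral {-N..N} (\<lambda>x. f (u \<tau> x) * g x)) = 
         integral {0..t} (\<lambda>\<tau>. m n c' d' * integral {-N..N} (\<lambda>x. f (u \<tau> x) * hat n c d x) - m n c d * integral {-N..N} (\<lambda>x. f (u \<tau> x) * hat n c' d' x))"
        by (rule Henstock_Kurzweil_Integration.integral_cong) (use 2 in auto)
      have 4: "(\<lambda>\<tau>. integral {-N..N} (\<lambda>x. f (u \<tau> x) * hat n c d x)) integrable_on {0..t}" for c d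
        by (intro integrable_time continuous_prod[OF cf continuous_hat N(5)]) auto
      show ?thesis unfolding L_def 1 3 by (simp add: integral_diff integrable_on_mult_right 4 algebra_simps)
    qed
    ultimately show ?thesis by simp
  qed
  moreover have "(\<lambda>n. m n c' d' * L (hat n c d)) \<longlonglongrightarrow> (d' - c') * defect t c d"
    by (intro tendsto_mult mlim Llim N cd)
  moreover have "(\<lambda>n. m n c d * L (hat n c' d')) \<longlonglongrightarrow> (d - c) * defect t c' d'"
    by (intro tendsto_mult mlim Llim N cd)
  ultimately show ?thesis using LIMSEQ_unique by simp
qed

text \<open>Subtracting the residual of the unit interval fixes the free function of time, so that
  the integrated equation holds on every interval (\<open>integral_A\<close>).\<close>

definition A :: "real \<Rightarrow> real \<Rightarrow> real" where
  "A t x = pot (u t) x - defect t 0 1"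

lemma A_0: "A 0 x = pot (u 0) x"
  by (simp add: A_def defect_def)

lemma A_diff: "0 \<le> t \<Longrightarrow> x \<le> y \<Longrightarrow> A t y - A t x = integral {x..y} (u t)"
  by (simp add: A_def pot_diff bmeas_integrable[OF bm])

lemma A_lipschitz: "0 \<le> t \<Longrightarrow> \<bar>A t y - A t x\<bar> \<le> K * \<bar>y - x\<bar>"
  using pot_lipschitz[OF bm] by (simp add: A_def)

lemma continuous_A: "0 \<le> t \<Longrightarrow> continuous_on S (A t)"
  by (rule lipschitz_imp_continuous) (rule A_lipschitz)

lemma integral_A:
  assumes t: "0 \<le> t" and cd: "c \<le> d"
  shows "integral {c..d} (A t) = integral {c..d} (A 0) - integral {0..t} (\<lambda>\<tau>. integral {c..d} (\<lambda>x. f (u \<tau> x)))"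
proof -
  have pi: "pot (u t) integrable_on {c..d}" if "0 \<le> t" for t
    by (intro continuous_integrable_ivl continuous_pot[OF bm[OF that]])
  have "defect t c d = (d - c) * defect t 0 1" using defect_proportional[OF t cd, of 0 1] by simp
  moreover have "defect t c d = integral {c..d} (pot (u t)) - integral {c..d} (pot (u 0)) + integral {0..t} (\<lambda>\<tau>. integral {c..d} (\<lambda>x. f (u \<tau> x)))"
    unfolding defect_def by (simp add: integral_diff pi t)
  moreover have "integral {c..d} (A t) = integral {c..d} (pot (u t)) - (d - c) * defect t 0 1"
    unfolding A_def[abs_def] using cd by (simp add: integral_diff pi t)
  moreover have "integral {c..d} (A 0) = integral {c..d} (pot (u 0))"
    by (simp add: A_0[abs_def])
  ultimately show ?thesis by linarith
qed

lemma avg_A: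
  assumes "0 \<le> t" "0 < h"
  shows "avg h (A t) x = avg h (A 0) x - integral {0..t} (\<lambda>\<tau>. avg h (\<lambda>y. f (u \<tau> y)) x)"
  unfolding avg_def using integral_A[OF assms(1), of "x-h" "x+h"] assms(2)
  by (simp add: diff_divide_distrib integral_divide)

lemma avg_A_close: "0 \<le> t \<Longrightarrow> 0 < h \<Longrightarrow> \<bar>avg h (A t) x - A t x\<bar> \<le> K * h"
proof (rule avg_bound)
  fix y assume "0 \<le> t" "0 < h" "x - h \<le> y" "y \<le> x + h"
  then have "\<bar>A t y - A t x\<bar> \<le> K * \<bar>y - x\<bar>" "\<bar>y - x\<bar> \<le> h" using A_lipschitz by auto
  then show "\<bar>A t y - A t x\<bar> \<le> K * h" using mult_left_mono[OF _ K_nonneg] by fastforce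
qed (auto intro!: continuous_integrable_ivl continuous_A)

lemma avg_A_deriv_x:
  assumes t: "0 \<le> t" and h: "0 < h"
  shows "(avg h (A t) has_real_derivative avg h (u t) x) (at x)"
proof -
  have cA: "continuous_on UNIV (A t)" by (rule continuous_A[OF t])
  note Ai = continuous_integrable_ivl[OF cA]
  have s: "((\<lambda>x. pot (A t) (x + c)) has_real_derivative A t (x + c)) (at x)" for c
    using DERIV_chain2[OF pot_deriv[OF cA, of "x+c"] DERIV_add[OF DERIV_ident DERIV_const[of c]]] by simp
  have "((\<lambda>x. (pot (A t) (x + h) - pot (A t) (x + (-h))) / (2*h)) has_real_derivative (A t (x + h) - A t (x + (-h))) / (2*h)) (at x)"
    by (intro DERIV_cdivide DERIV_diff s)
  moreover have "(A t (x + h) - A t (x + (-h))) / (2*h) = avg h (u t) x"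
    using A_diff[OF t, of "x-h" "x+h"] h by (simp add: avg_def)
  moreover have "avg h (A t) = (\<lambda>x. (pot (A t) (x + h) - pot (A t) (x + (-h))) / (2*h))"
    using avg_eq_pot[OF Ai h] by (simp add: fun_eq_iff)
  ultimately show ?thesis by simp
qed

lemma avg_A_deriv_t:
  assumes t: "0 < t" and h: "0 < h"
  shows "((\<lambda>t. avg h (A t) x) has_real_derivative - avg h (\<lambda>y. f (u t y)) x) (at t)"
proof -
  have "((\<lambda>t. avg h (A 0) x - integral {0..t} (\<lambda>\<tau>. avg h (\<lambda>y. f (u \<tau> y)) x)) has_real_derivative 0 - avg h (\<lambda>y. f (u t y)) x) (at t)"
    by (intro DERIV_diff DERIV_const continuous_antiderivative continuous_avg_time continuous_f h t)
  then show ?thesis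
    by (rule has_field_derivative_transform_within_open[where S="{0<..}", THEN DERIV_cong]) (use t h in \<open>auto simp: avg_A[symmetric]\<close>)
qed

text \<open>Differentiability in the plane follows from the two partial derivatives once one of
  them, here the one in \<open>x\<close>, is jointly continuous; L1 continuity in time provides this
  for the average of \<open>u\<close>.\<close>

lemma avg_A_has_derivative:
  assumes t: "0 < t" and h: "0 < h"
  shows "((\<lambda>p. avg h (A (fst p)) (snd p)) has_derivative
     (\<lambda>k. - avg h (\<lambda>y. f (u t y)) x * fst k + avg h (u t) x * snd k)) (at (t, x))"
proof -
  have "((\<lambda>(t, x). avg h (A t) x) has_derivative
      (\<lambda>(k, l). - avg h (\<lambda>y. f (u t y)) x * k + blinfun_mult_right (avg h (u t) x) l)) (at (t, x) within {0<..} \<times> UNIV)"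
  proof (rule has_derivative_partialsI)
    show "((\<lambda>t. avg h (A t) x) has_derivative (*) (- avg h (\<lambda>y. f (u t y)) x)) (at t within {0<..})"
      using avg_A_deriv_t[OF t h, of x] unfolding has_field_derivative_def by (rule has_derivative_at_withinI)
    show "((\<lambda>y. avg h (A s) y) has_derivative blinfun_apply (blinfun_mult_right (avg h (u s) y))) (at y within UNIV)"
      if "s \<in> {0<..}" for s y
      using avg_A_deriv_x[of s h y] that h by (simp add: has_field_derivative_def)
    have "continuous_on ({0..} \<times> UNIV) (\<lambda>p. avg h (u (fst p)) (snd p))"
      using continuous_avg_joint[of "\<lambda>v. v" h] h by simp
    then have "continuous_on ({0<..} \<times> UNIV) (\<lambda>p. avg h (u (fst p)) (snd p))"
      by (rule continuous_on_subset) auto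
    then have "continuous_on ({0<..} \<times> UNIV) (\<lambda>p. blinfun_mult_right (avg h (u (fst p)) (snd p)))"
      by (rule bounded_linear.continuous_on[OF bounded_linear_blinfun_mult_right])
    then show "continuous (at (t, x) within {0<..} \<times> UNIV) (\<lambda>(s, y). blinfun_mult_right (avg h (u s) y))"
      using t by (simp add: continuous_on_eq_continuous_within case_prod_unfold)
  qed auto
  moreover have "at (t, x) within {0<..} \<times> UNIV = at (t, x)"
    by (rule at_within_open) (use t in \<open>auto intro!: open_Times\<close>)
  ultimately show ?thesis by (simp add: case_prod_unfold)
qed

end

section \<open>Comparison with affine solutions\<close>

lemma square_pos_part_has_derivative:
  fixes q :: "real \<times> real \<Rightarrow> real"
  assumes "(q has_derivative q') (at p)"
  shows "((\<lambda>p. max 0 (q p) ^ 2) has_derivative (\<lambda>d. 2 * max 0 (q p) * q' d)) (at p)"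
proof -
  have "((\<lambda>z. max 0 z ^ 2) has_derivative (\<lambda>d. 2 * max 0 (q p) * d)) (at (q p))"
    using square_pos_part_deriv[of "q p"] by (simp add: has_field_derivative_def)
  from has_derivative_compose[OF assms this] show ?thesis .
qed

context kruzkov
begin

lemma avg_A_lipschitz:
  assumes "0 \<le> t" "0 < h" shows "\<bar>avg h (A t) x - avg h (A t) y\<bar> \<le> K * \<bar>x - y\<bar>"
proof -
  have "norm (avg h (A t) x - avg h (A t) y) \<le> K * norm (x - y)"
    by (rule field_differentiable_bound[where S=UNIV and f'="avg h (u t)"])
      (use avg_A_deriv_x[OF assms] avg_abs_le[OF bm[OF assms(1)] assms(2)] in auto)
  then show ?thesis by simp
qed

lemma continuous_avg_A:
  assumes h: "0 < h" shows "continuous_on ({0..} \<times> UNIV) (\<lambda>p. avg h (A (fst p)) (snd p))"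
proof (rule jointly_continuous[where q="\<lambda>t. avg h (A t)" and C=K])
  fix x
  have "continuous_on {0..} (\<lambda>t. avg h (A 0) x - integral {0..t} (\<lambda>\<tau>. avg h (\<lambda>y. f (u \<tau> y)) x))"
    by (intro continuous_intros continuous_antiderivative_on continuous_avg_time continuous_f h)
  then show "continuous_on {0..} (\<lambda>t. avg h (A t) x)"
    by (rule continuous_on_cong[THEN iffD1, OF refl, rotated]) (rule avg_A[OF _ h, symmetric], simp)
qed (use avg_A_lipschitz[OF _ h] in auto)

lemma A_upper:
  assumes c: "\<And>v. p * v - f v \<le> c" and t: "0 \<le> t"
  shows "A t (x + p * t) \<le> A 0 x + c * t"
proof (rule field_le_epsilon)
  fix e :: real assume e: "e > 0"
  \<comment> \<open>Two averaging errors of size \<open>K * h\<close> occur, at time 0 and at time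
    \<open>t\<close>; together they must not exceed \<open>e\<close>. The summand 1 covers
    \<open>K = 0\<close>.\<close>
  define h where "h = e / (2 * (K + 1))"
  have h: "h > 0" using e K_nonneg by (simp add: h_def)
  have Kh: "2 * (K * h) \<le> e"
  proof -
    have "K * h \<le> (K + 1) * h" using h by simp
    also have "\<dots> = e / 2" using K_nonneg unfolding h_def by (simp add: field_simps)
    finally show ?thesis by simp
  qed
  let ?g = "\<lambda>\<tau>. avg h (A \<tau>) (x + p * \<tau>) - c * \<tau>"
  have "?g t \<le> ?g 0" 
  proof (rule DERIV_nonpos_imp_decreasing_open[OF t])
    fix \<tau> assume "0 < \<tau>" "\<tau> < t"
    let ?x = "x + p * \<tau>"
    have lin: "((\<lambda>\<tau>. (\<tau>, x + p * \<tau>)) has_derivative (\<lambda>d. (d, p * d))) (at \<tau>)"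
      by (auto intro!: derivative_eq_intros)
    have der: "((\<lambda>\<tau>. avg h (A (fst (\<tau>, x + p * \<tau>))) (snd (\<tau>, x + p * \<tau>))) has_derivative
       (\<lambda>d. - avg h (\<lambda>y. f (u \<tau> y)) ?x * fst (d, p * d) + avg h (u \<tau>) ?x * snd (d, p * d))) (at \<tau>)"
      by (rule has_derivative_compose[OF lin avg_A_has_derivative[OF \<open>0 < \<tau>\<close> h]])
    have "((\<lambda>\<tau>. avg h (A \<tau>) (x + p * \<tau>)) has_real_derivative (- avg h (\<lambda>y. f (u \<tau> y)) ?x + avg h (u \<tau>) ?x * p)) (at \<tau>)"
    proof -
      have e: "(\<lambda>d. - avg h (\<lambda>y. f (u \<tau> y)) ?x * d + avg h (u \<tau>) ?x * (p * d)) = (*) (- avg h (\<lambda>y. f (u \<tau> y)) ?x + avg h (u \<tau>) ?x * p)"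
        by (auto simp: fun_eq_iff algebra_simps)
      show ?thesis using der unfolding has_field_derivative_def fst_conv snd_conv e .
    qed
    from DERIV_diff[OF this DERIV_cmult_Id[of c \<tau>]] have d: "(?g has_real_derivative (- avg h (\<lambda>y. f (u \<tau> y)) ?x + avg h (u \<tau>) ?x * p) - c) (at \<tau>)"
      .
    have fi: "(\<lambda>y. f (u \<tau> y)) integrable_on {a..b}" for a b
      using integrable_comp[OF continuous_f, of \<tau>] \<open>0 < \<tau>\<close> by simp
    have ui: "(\<lambda>y. p * u \<tau> y) integrable_on {a..b}" for a b
      using bmeas_integrable[OF bm, of \<tau>] \<open>0 < \<tau>\<close> by (simp add: integrable_on_mult_right)
    have "avg h (u \<tau>) ?x * p - avg h (\<lambda>y. f (u \<tau> y)) ?x = avg h (\<lambda>y. p * u \<tau> y - f (u \<tau> y)) ?x"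
      unfolding avg_diff[OF ui fi] by (simp add: avg_def mult.commute)
    also have "\<dots> \<le> avg h (\<lambda>_. c) ?x"
      by (intro avg_mono integrable_diff ui fi h integrable_const_Icc c)
    finally have "(- avg h (\<lambda>y. f (u \<tau> y)) ?x + avg h (u \<tau>) ?x * p) - c \<le> 0" using h by (simp add: avg_const)
    with d show "\<exists>y. (?g has_real_derivative y) (at \<tau>) \<and> y \<le> 0" by blast
  next
    have "continuous_on {0..t} (\<lambda>\<tau>. avg h (A (fst (\<tau>, x + p * \<tau>))) (snd (\<tau>, x + p * \<tau>)))"
      by (rule continuous_on_compose2[OF continuous_avg_A[OF h]]) (auto intro!: continuous_intros)
    then show "continuous_on {0..t} ?g" by (auto intro!: continuous_intros)
  qed
  then show "A t (x + p * t) \<le> A 0 x + c * t + e"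
    using avg_A_close[OF t h, of "x + p * t"] avg_A_close[OF order_refl h, of x] Kh by (simp add: abs_le_iff)
qed

end

text \<open>\<open>L\<close> is both a Lipschitz bound for \<open>f\<close> at \<open>k\<close> on
  the range of \<open>u\<close> and the speed at which the cone narrows. The cone starts at time
  \<open>s\<close> with radius \<open>L * (t - s) + r\<close> and still has radius
  \<open>r > 0\<close> at time \<open>t\<close>, so that integrals over it see a neighbourhood of
  \<open>x0\<close>.\<close>

locale comparison = kruzkov +
  fixes L k s t r x0 m :: real
  assumes L: "\<bar>v\<bar> \<le> K \<Longrightarrow> \<bar>f v - f k\<bar> \<le> L * \<bar>v - k\<bar>" and L0: "0 \<le> L"
    and s: "0 \<le> s" and st: "s < t" and r: "0 < r"
    and init: "\<bar>y - x0\<bar> \<le> L * (t - s) + r \<Longrightarrow> k * y + m \<le> A s y"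
begin

definition R where "R = L * (t - s) + r"
text \<open>\<open>al\<close> and \<open>be\<close> are both positive exactly inside the cone.
  Squaring their positive parts in \<open>chi\<close> makes the cut-off C1; \<open>chit\<close> and
  \<open>chix\<close> are its partial derivatives.\<close>

definition al where "al p = R - L * (fst p - s) + (snd p - x0)"
definition be where "be p = R - L * (fst p - s) - (snd p - x0)"
definition chi where "chi p = max 0 (al p) ^ 2 * max 0 (be p) ^ 2"
definition chit where "chit p = - L * (2 * max 0 (al p) * max 0 (be p) ^ 2 + max 0 (al p) ^ 2 * (2 * max 0 (be p)))"
definition chix where "chix p = 2 * max 0 (al p) * max 0 (be p) ^ 2 - max 0 (al p) ^ 2 * (2 * max 0 (be p))"
text \<open>\<open>kruzkov_slices\<close> wants one support bound for all nonnegative times. Traced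
  back from time \<open>s\<close> to time 0 the cone widens by \<open>L * s\<close>, whence the last
  summand.\<close>

definition N where "N = \<bar>x0\<bar> + R + L * s"

lemma R_pos: "0 < R"
  using L0 st r unfolding R_def by (intro add_nonneg_pos) auto

lemma N_pos: "0 < N"
  using R_pos L0 s unfolding N_def by (simp add: add_pos_nonneg add_nonneg_pos)

lemma chi_deriv: "(chi has_derivative (\<lambda>d. chit p * fst d + chix p * snd d)) (at p)"
proof -
  have a: "(al has_derivative (\<lambda>d. - L * fst d + snd d)) (at p)"
    unfolding al_def[abs_def] by (auto intro!: derivative_eq_intros)
  have b: "(be has_derivative (\<lambda>d. - L * fst d - snd d)) (at p)"
    unfolding be_def[abs_def] by (auto intro!: derivative_eq_intros)
  show ?thesis unfolding chi_def[abs_def] chit_def chix_def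
    by (rule has_derivative_eq_rhs[OF has_derivative_mult[OF square_pos_part_has_derivative[OF a] square_pos_part_has_derivative[OF b]]])
      (auto simp: fun_eq_iff algebra_simps)
qed

lemma continuous_chi: "continuous_on S chi" "continuous_on S chit" "continuous_on S chix"
  unfolding chi_def[abs_def] chit_def[abs_def] chix_def[abs_def] al_def[abs_def] be_def[abs_def]
  by (intro continuous_intros)+

lemma chi_nonneg: "0 \<le> chi p"
  by (simp add: chi_def)

lemma chi_supp:
  assumes "0 \<le> \<tau>" "N \<le> \<bar>x\<bar>" shows "chi (\<tau>,x) = 0 \<and> chit (\<tau>,x) = 0 \<and> chix (\<tau>,x) = 0"
proof -
  have "N \<le> \<bar>x0\<bar> + \<bar>x - x0\<bar>" using assms by linarith
  moreover have "0 \<le> L * \<tau>" using L0 assms by simp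
  ultimately have "R - L * (\<tau> - s) \<le> \<bar>x - x0\<bar>" by (simp add: N_def algebra_simps)
  then have "al (\<tau>,x) \<le> 0 \<or> be (\<tau>,x) \<le> 0" unfolding al_def be_def by auto
  then show ?thesis by (auto simp: chi_def chit_def chix_def max_def)
qed

lemma chi_init: "chi (s,x) \<noteq> 0 \<Longrightarrow> \<bar>x - x0\<bar> \<le> L * (t - s) + r"
  unfolding chi_def al_def be_def R_def by (auto simp: max_def abs_le_iff split: if_splits)

text \<open>The edges of the cone move inward at speed \<open>L\<close>. As the Kruzkov flux is at
  most \<open>L\<close> times the entropy, the decay of the cut-off in time absorbs whatever flows
  through its sides.\<close>

lemma chi_cone: "L * \<bar>chix p\<bar> \<le> - chit p"
proof -
  have "\<bar>chix p\<bar> \<le> 2 * max 0 (al p) * max 0 (be p) ^ 2 + max 0 (al p) ^ 2 * (2 * max 0 (be p))"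
    unfolding chix_def by (rule order_trans[OF abs_triangle_ineq4]) (simp add: abs_mult)
  from mult_left_mono[OF this L0] show ?thesis unfolding chit_def by simp
qed

lemma chit_nonpos: "chit p \<le> 0"
  using chi_cone[of p] L0 mult_nonneg_nonneg[OF L0 abs_ge_zero[of "chix p"]] by linarith

lemma chi_bounded: obtains C where "\<And>\<tau> x. \<tau> \<in> {s..t} \<Longrightarrow> x \<in> {-N..N} \<Longrightarrow> chi (\<tau>,x) \<le> C" "0 \<le> C"
proof -
  have "compact ({s..t} \<times> {-N..N})" by (intro compact_Times) auto
  from compact_imp_bounded[OF compact_continuous_image[OF continuous_chi(1) this]]
  obtain C where "\<forall>p\<in>{s..t} \<times> {-N..N}. \<bar>chi p\<bar> \<le> C" by (auto simp: bounded_iff)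
  then have C: "\<bar>chi (\<tau>,x)\<bar> \<le> C" if "\<tau> \<in> {s..t}" "x \<in> {-N..N}" for \<tau> x using that by blast
  show ?thesis by (rule that[of "max 0 C"]) (use C in \<open>force simp: le_max_iff_disj\<close>)+
qed

section \<open>Averaged potentials relative to an affine solution, and their weighted
  functionals\<close>

definition U where "U h p = avg h (u (fst p)) (snd p)"
definition F where "F h p = avg h (\<lambda>y. f (u (fst p) y)) (snd p)"
definition V where "V h p = avg h (A (fst p)) (snd p) - k * snd p + f k * (fst p - s)"
text \<open>The amount by which averaging spoils the exact cancellation in the weighted entropy
  inequality.\<close>

definition err where "err h \<tau> = integral {-N..N} (\<lambda>x. \<bar>F h (\<tau>,x) - f (u \<tau> x)\<bar> + \<bar>U h (\<tau>,x) - u \<tau> x\<bar>)"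

lemma continuous_UFV:
  assumes h: "0 < h"
  shows "continuous_on ({0..} \<times> UNIV) (U h)" "continuous_on ({0..} \<times> UNIV) (F h)" "continuous_on ({0..} \<times> UNIV) (V h)"
proof -
  show "continuous_on ({0..} \<times> UNIV) (U h)" unfolding U_def[abs_def]
    using continuous_avg_joint[of "\<lambda>v. v", OF _ h] by simp
  show "continuous_on ({0..} \<times> UNIV) (F h)" unfolding F_def[abs_def]
    by (rule continuous_avg_joint[OF continuous_f h])
  show "continuous_on ({0..} \<times> UNIV) (V h)" unfolding V_def[abs_def]
    by (intro continuous_intros continuous_avg_A h)
qed

lemma V_deriv:
  assumes "0 < \<tau>" "0 < h"
  shows "(V h has_derivative (\<lambda>d. (f k - F h (\<tau>,x)) * fst d + (U h (\<tau>,x) - k) * snd d)) (at (\<tau>,x))"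
proof -
  have 1: "((\<lambda>p. k * snd p) has_derivative (\<lambda>d. k * snd d)) (at (\<tau>,x))"
    by (auto intro!: derivative_eq_intros)
  have 2: "((\<lambda>p. f k * (fst p - s)) has_derivative (\<lambda>d. f k * fst d)) (at (\<tau>,x))"
    by (auto intro!: derivative_eq_intros)
  show ?thesis unfolding V_def[abs_def] F_def U_def
    by (rule has_derivative_eq_rhs[OF has_derivative_add[OF has_derivative_diff[OF avg_A_has_derivative[OF assms] 1] 2]])
       (simp add: fun_eq_iff algebra_simps)
qed

lemma slice_err:
  assumes h: "0 < h"
  shows "continuous_on ({0..} \<times> UNIV) (\<lambda>(\<tau>, x, v). \<bar>F h (\<tau>,x) - f v\<bar> + \<bar>U h (\<tau>,x) - v\<bar>)"
  unfolding case_prod_unfold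
  by (intro continuous_intros continuous_on_compose2[OF continuous_UFV(1)[OF h]]
     continuous_on_compose2[OF continuous_UFV(2)[OF h]] continuous_on_compose2[OF continuous_f[of UNIV]]) auto

lemma continuous_err: "0 < h \<Longrightarrow> continuous_on {0..} (err h)"
  unfolding err_def using continuous_slice_integral[OF slice_err] N_pos by simp

lemma err_nonneg: "0 < h \<Longrightarrow> 0 \<le> \<tau> \<Longrightarrow> 0 \<le> err h \<tau>"
  unfolding err_def by (rule integral_nonneg[OF integrable_slice[OF slice_err]]) auto

text \<open>At each fixed time this is L1 convergence of averages; the bounds on \<open>u\<close>
  and \<open>f(u)\<close> give a majorant constant in time for dominated convergence.\<close>

lemma err_tendsto: "(\<lambda>n. integral {s..t} (err (inverse (real (Suc n))))) \<longlonglongrightarrow> 0"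
proof -
  define H where "H n = inverse (real (Suc n))" for n
  have H: "0 < H n" for n by (simp add: H_def)
  have H0: "H \<longlonglongrightarrow> 0" unfolding H_def by (rule LIMSEQ_inverse_real_of_nat)
  obtain B where B: "\<And>t. 0 \<le> t \<Longrightarrow> bmeas B (\<lambda>x. f (u t x))" using bmeas_comp[OF continuous_f] by blast
  have av: "(\<lambda>n. integral {-N..N} (\<lambda>x. \<bar>avg (H n) v x - v x\<bar>)) \<longlonglongrightarrow> 0" if v: "bmeas D v" for v D
  proof (rule LIMSEQ_I)
    fix e :: real assume "0 < e"
    have "-N \<le> N" using N_pos by simp
    from avg_L1_tendsto[OF v this \<open>0 < e\<close>] obtain d where d: "0 < d"
      "\<And>h. 0 < h \<Longrightarrow> h < d \<Longrightarrow> integral {-N..N} (\<lambda>x. \<bar>avg h v x - v x\<bar>) < e" by metis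
    from LIMSEQ_D[OF H0 d(1)] obtain n0 where n0: "\<And>n. n \<ge> n0 \<Longrightarrow> norm (H n - 0) < d" by blast
    show "\<exists>n0. \<forall>n\<ge>n0. norm (integral {-N..N} (\<lambda>x. \<bar>avg (H n) v x - v x\<bar>) - 0) < e"
    proof (intro exI allI impI)
      fix n assume "n0 \<le> n"
      then have "integral {-N..N} (\<lambda>x. \<bar>avg (H n) v x - v x\<bar>) < e" using n0[of n] H[of n] by (intro d(2)) auto
      moreover have "0 \<le> integral {-N..N} (\<lambda>x. \<bar>avg (H n) v x - v x\<bar>)"
        by (rule integral_nonneg[OF bmeas_integrable[OF bmeas_diff_abs[OF bmeas_avg[OF v H] v]]]) auto
      ultimately show "norm (integral {-N..N} (\<lambda>x. \<bar>avg (H n) v x - v x\<bar>) - 0) < e" by simp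
    qed
  qed
  have err_eq: "err (H n) \<tau> = integral {-N..N} (\<lambda>x. \<bar>avg (H n) (\<lambda>y. f (u \<tau> y)) x - f (u \<tau> x)\<bar>) + integral {-N..N} (\<lambda>x. \<bar>avg (H n) (u \<tau>) x - u \<tau> x\<bar>)"
    if \<tau>: "0 \<le> \<tau>" for n \<tau>
    unfolding err_def F_def U_def
    by (simp add: integral_add bmeas_integrable[OF bmeas_diff_abs[OF bmeas_avg[OF B[OF \<tau>] H] B[OF \<tau>]]]
       bmeas_integrable[OF bmeas_diff_abs[OF bmeas_avg[OF bm[OF \<tau>] H] bm[OF \<tau>]]])
  have bnd: "integral {-N..N} v \<le> D * (2 * N)" if v: "bmeas D v" for v D
  proof -
    have "integral {-N..N} v \<le> integral {-N..N} (\<lambda>_. D)"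
      by (rule integral_le[OF bmeas_integrable[OF v]]) (use bmeas_bound[OF v] in \<open>auto simp: abs_le_iff\<close>)
    then show ?thesis using N_pos by (simp add: mult.commute)
  qed
  have "(\<lambda>n. integral {s..t} (err (H n))) \<longlonglongrightarrow> integral {s..t} (\<lambda>_. 0)"
  proof (rule dominated_convergence[where h="\<lambda>_. (B + B) * (2 * N) + (K + K) * (2 * N)"])
    show "err (H n) integrable_on {s..t}" for n by (rule integrable_time[OF continuous_err[OF H] s])
    fix \<tau> assume "\<tau> \<in> {s..t}"
    then have \<tau>: "0 \<le> \<tau>" using s by simp
    show "norm (err (H n) \<tau>) \<le> (B + B) * (2 * N) + (K + K) * (2 * N)" for n
      using err_nonneg[OF H \<tau>, of n] bnd[OF bmeas_diff_abs[OF bmeas_avg[OF B[OF \<tau>] H[of n]] B[OF \<tau>]]]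
        bnd[OF bmeas_diff_abs[OF bmeas_avg[OF bm[OF \<tau>] H[of n]] bm[OF \<tau>]]] err_eq[OF \<tau>, of n] by simp
    show "(\<lambda>n. err (H n) \<tau>) \<longlonglongrightarrow> 0" unfolding err_eq[OF \<tau>]
      using tendsto_add[OF av[OF B[OF \<tau>]] av[OF bm[OF \<tau>]]] by simp
  qed auto
  then show ?thesis by (simp add: H_def)
qed

definition E where "E h \<tau> = integral {-N..N} (\<lambda>x. \<bar>u \<tau> x - k\<bar> * (max 0 (m - V h (\<tau>,x)) ^ 2 * chi (\<tau>,x)))"

text \<open>\<open>E\<close> is insensitive to points where \<open>u = k\<close>; \<open>J\<close>
  detects every point of the cone with \<open>V < m\<close>. Its exponent is one higher because
  differentiation in time lowers it to that of the weight in \<open>E\<close>.\<close>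

definition J where "J h \<tau> = integral {-N..N} (\<lambda>x. max 0 (m - V h (\<tau>,x)) ^ 3 * chi (\<tau>,x))"

lemma slice_EJ:
  assumes h: "0 < h"
  shows "continuous_on ({0..} \<times> UNIV) (\<lambda>(\<tau>, x, v). \<bar>v - k\<bar> * (max 0 (m - V h (\<tau>,x)) ^ 2 * chi (\<tau>,x)))"
    "continuous_on ({0..} \<times> UNIV) (\<lambda>(\<tau>, x, v::real). max 0 (m - V h (\<tau>,x)) ^ 3 * chi (\<tau>,x))"
  unfolding case_prod_unfold
  by (intro continuous_intros continuous_on_compose2[OF continuous_UFV(3)[OF h]] continuous_on_compose2[OF continuous_chi(1)[of UNIV]]; auto)+

text \<open>The bound is uniform in \<open>h \<le> 1\<close>: the constants built from it multiply
  \<open>err\<close> and must survive \<open>h\<close> tending to 0.\<close>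

lemma V_bounded:
  obtains D where "\<And>h \<tau> x. 0 < h \<Longrightarrow> h \<le> 1 \<Longrightarrow> \<tau> \<in> {s..t} \<Longrightarrow> x \<in> {-N..N} \<Longrightarrow> max 0 (m - V h (\<tau>,x)) \<le> D" "0 \<le> D"
proof -
  obtain B where B: "\<And>t. 0 \<le> t \<Longrightarrow> bmeas B (\<lambda>x. f (u t x))" using bmeas_comp[OF continuous_f] by blast
  have B0: "0 \<le> B" using bmeas_nonneg[OF B[of 0]] by simp
  define D where "D = \<bar>m\<bar> + (K * N + K + B * t) + \<bar>k\<bar> * N + \<bar>f k\<bar> * t"
  have "max 0 (m - V h (\<tau>,x)) \<le> D" if h: "0 < h" "h \<le> 1" and \<tau>: "\<tau> \<in> {s..t}" and x: "x \<in> {-N..N}" for h \<tau> x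
  proof -
    have \<tau>0: "0 \<le> \<tau>" "\<tau> \<le> t" "\<bar>\<tau> - s\<bar> \<le> t" using \<tau> s by auto
    have xN: "\<bar>x\<bar> \<le> N" using x by auto
    have "\<bar>A 0 x\<bar> \<le> K * \<bar>x\<bar>" using A_lipschitz[of 0 x 0] by (simp add: A_0)
    also have "\<dots> \<le> K * N" using K_nonneg xN by (rule mult_left_mono[rotated])
    finally have 1: "\<bar>A 0 x\<bar> \<le> K * N" .
    have 2: "\<bar>avg h (A 0) x - A 0 x\<bar> \<le> K" using avg_A_close[OF order_refl h(1), of x] mult_left_mono[OF h(2) K_nonneg] by simp
    have "norm (integral (cbox 0 \<tau>) (\<lambda>\<tau>. avg h (\<lambda>y. f (u \<tau> y)) x)) \<le> B * Henstock_Kurzweil_Integration.content (cbox 0 \<tau>)"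
    proof (rule has_integral_bound[OF B0 integrable_integral])
      show "(\<lambda>\<tau>. avg h (\<lambda>y. f (u \<tau> y)) x) integrable_on cbox 0 \<tau>"
        using integrable_time[OF continuous_avg_time[OF continuous_f h(1)], of 0] by simp
      fix \<sigma> assume "\<sigma> \<in> cbox 0 \<tau>" then show "norm (avg h (\<lambda>y. f (u \<sigma> y)) x) \<le> B"
        using avg_abs_le[OF B h(1)] by simp
    qed
    then have "\<bar>integral {0..\<tau>} (\<lambda>\<tau>. avg h (\<lambda>y. f (u \<tau> y)) x)\<bar> \<le> B * \<tau>" using \<tau>0 by simp
    also have "\<dots> \<le> B * t" using B0 \<tau>0 by (intro mult_left_mono) auto
    finally have 3: "\<bar>avg h (A \<tau>) x\<bar> \<le> K * N + K + B * t" using 1 2 avg_A[OF \<tau>0(1) h(1), of x] by linarith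
    have 4: "\<bar>k * x\<bar> \<le> \<bar>k\<bar> * N" unfolding abs_mult using xN by (intro mult_left_mono) auto
    have 5: "\<bar>f k * (\<tau> - s)\<bar> \<le> \<bar>f k\<bar> * t" unfolding abs_mult using \<tau>0 by (intro mult_left_mono) auto
    have "m - V h (\<tau>,x) \<le> D" using 3 4 5 unfolding V_def D_def by simp
    moreover have "0 \<le> D" unfolding D_def using K_nonneg B0 N_pos s st by simp
    ultimately show ?thesis by simp
  qed
  moreover have "0 \<le> D" unfolding D_def using K_nonneg B0 N_pos s st by simp
  ultimately show ?thesis by (rule that)
qed

lemma flux_le: "\<bar>v\<bar> \<le> K \<Longrightarrow> \<bar>flux k v\<bar> \<le> L * \<bar>v - k\<bar>"
  using L[of v] by (auto simp: flux_def abs_mult sgn_if mult_nonneg_nonneg[OF L0])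

text \<open>The terms with the derivative of the cut-off of \<open>V\<close> would cancel if \<open>F\<close> and \<open>U\<close> were not
  averaged, and the terms with the derivatives of the cone cut-off have the good sign.\<close>

lemma integrand_le:
  assumes v: "\<bar>v\<bar> \<le> K" and Q: "0 \<le> Q" "Q \<le> D" and X: "0 \<le> X" "X \<le> C" and P: "0 \<le> P"
    and cone: "L * \<bar>xx\<bar> \<le> - xt" and CD: "0 \<le> D"
  shows "\<bar>v - k\<bar> * (2 * Q * (Fa - f k) * X + P * xt) + flux k v * (2 * Q * (k - Ua) * X + P * xx)
     \<le> 2 * D * C * ((1 + L) * (K + \<bar>k\<bar>)) * (\<bar>Fa - f v\<bar> + \<bar>Ua - v\<bar>)"
proof -
  let ?w = "v - k" and ?M = "(1 + L) * (K + \<bar>k\<bar>)"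
  have w: "\<bar>?w\<bar> \<le> K + \<bar>k\<bar>" using v by linarith
  then have "1 * \<bar>?w\<bar> \<le> ?M" using L0 by (intro mult_mono) auto
  then have w': "\<bar>?w\<bar> \<le> ?M" by simp
  have "L * \<bar>?w\<bar> \<le> ?M" using w L0 by (intro mult_mono) auto
  then have fl: "\<bar>flux k v\<bar> \<le> ?M" using flux_le[OF v] by linarith
  have "flux k v * xx \<le> \<bar>flux k v\<bar> * \<bar>xx\<bar>" by (metis abs_ge_self abs_mult)
  also have "\<dots> \<le> (L * \<bar>?w\<bar>) * \<bar>xx\<bar>" by (intro mult_right_mono flux_le v) auto
  also have "\<dots> = \<bar>?w\<bar> * (L * \<bar>xx\<bar>)" by simp
  also have "\<dots> \<le> \<bar>?w\<bar> * (- xt)" by (intro mult_left_mono cone) auto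
  finally have "\<bar>?w\<bar> * xt + flux k v * xx \<le> 0" by simp
  then have 1: "P * (\<bar>?w\<bar> * xt + flux k v * xx) \<le> 0" using P by (simp add: mult_nonneg_nonpos)
  have id: "\<bar>?w\<bar> * (f v - f k) = flux k v * ?w" by (simp add: flux_def abs_sgn mult.commute mult.left_commute)
  have "\<bar>?w\<bar> * (Fa - f k) + flux k v * (k - Ua) = \<bar>?w\<bar> * (Fa - f v) + flux k v * (v - Ua)"
    using id by (simp add: algebra_simps)
  also have "\<dots> \<le> \<bar>?w\<bar> * \<bar>Fa - f v\<bar> + \<bar>flux k v\<bar> * \<bar>v - Ua\<bar>"
    by (intro add_mono) (simp add: mult_left_mono, metis abs_ge_self abs_mult)
  also have "\<dots> \<le> ?M * \<bar>Fa - f v\<bar> + ?M * \<bar>v - Ua\<bar>"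
    by (intro add_mono mult_right_mono w' fl) auto
  finally have 2: "\<bar>?w\<bar> * (Fa - f k) + flux k v * (k - Ua) \<le> ?M * (\<bar>Fa - f v\<bar> + \<bar>Ua - v\<bar>)"
    by (simp add: distrib_left abs_minus_commute)
  have M0: "0 \<le> ?M" using w' by linarith
  have "2 * Q * X * (\<bar>?w\<bar> * (Fa - f k) + flux k v * (k - Ua)) \<le> 2 * Q * X * (?M * (\<bar>Fa - f v\<bar> + \<bar>Ua - v\<bar>))"
    using Q X by (intro mult_left_mono 2) auto
  also have "\<dots> \<le> 2 * D * C * (?M * (\<bar>Fa - f v\<bar> + \<bar>Ua - v\<bar>))"
    using Q X CD M0 by (intro mult_right_mono mult_mono) auto
  finally have 3: "2 * Q * X * (\<bar>?w\<bar> * (Fa - f k) + flux k v * (k - Ua)) \<le> 2 * D * C * (?M * (\<bar>Fa - f v\<bar> + \<bar>Ua - v\<bar>))" .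
  have "\<bar>?w\<bar> * (2 * Q * (Fa - f k) * X + P * xt) + flux k v * (2 * Q * (k - Ua) * X + P * xx)
    = 2 * Q * X * (\<bar>?w\<bar> * (Fa - f k) + flux k v * (k - Ua)) + P * (\<bar>?w\<bar> * xt + flux k v * xx)"
    by (simp add: algebra_simps)
  then show ?thesis using 1 3 by (simp add: mult.assoc)
qed

lemma slice_lift:
  fixes q :: "real \<times> real \<Rightarrow> real"
  assumes "continuous_on ({0..} \<times> UNIV) q"
  shows "continuous_on ({0..} \<times> UNIV) (\<lambda>(t, x, v::real). q (t, x))"
  unfolding case_prod_unfold
  by (rule continuous_on_compose2[OF assms]) (auto intro!: continuous_intros)

text \<open>The averaged weight is C1 and may be inserted into \<open>kruzkov_slices\<close>;
  \<open>integrand_le\<close> then charges the growth of \<open>E\<close> to \<open>err\<close>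
  alone.\<close>

lemma E_estimate:
  obtains C where "0 \<le> C"
    "\<And>h \<tau>. 0 < h \<Longrightarrow> h \<le> 1 \<Longrightarrow> \<tau> \<in> {s..t} \<Longrightarrow> E h \<tau> \<le> E h s + C * integral {s..t} (err h)"
proof -
  obtain D where D: "\<And>h \<tau> x. 0 < h \<Longrightarrow> h \<le> 1 \<Longrightarrow> \<tau> \<in> {s..t} \<Longrightarrow> x \<in> {-N..N} \<Longrightarrow> max 0 (m - V h (\<tau>,x)) \<le> D" "0 \<le> D"
    using V_bounded by blast
  obtain X where X: "\<And>\<tau> x. \<tau> \<in> {s..t} \<Longrightarrow> x \<in> {-N..N} \<Longrightarrow> chi (\<tau>,x) \<le> X" "0 \<le> X"
    using chi_bounded by blast
  define C where "C = 2 * D * X * ((1 + L) * (K + \<bar>k\<bar>))"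
  have C0: "0 \<le> C" unfolding C_def using D X L0 K_nonneg by simp
  have "E h \<tau> \<le> E h s + C * integral {s..t} (err h)" if h: "0 < h" "h \<le> 1" and \<tau>: "\<tau> \<in> {s..t}" for h \<tau>
  proof -
    define \<phi>t where "\<phi>t p = 2 * max 0 (m - V h p) * (F h p - f k) * chi p + max 0 (m - V h p) ^ 2 * chit p" for p
    define \<phi>x where "\<phi>x p = 2 * max 0 (m - V h p) * (k - U h p) * chi p + max 0 (m - V h p) ^ 2 * chix p" for p
    note cU = continuous_UFV[OF h(1)]
    have c\<phi>: "continuous_on ({0..} \<times> UNIV) (\<lambda>p. max 0 (m - V h p) ^ 2 * chi p)"
      by (intro continuous_intros cU continuous_chi)
    have c\<phi>t: "continuous_on ({0..} \<times> UNIV) \<phi>t" unfolding \<phi>t_def by (intro continuous_intros cU continuous_chi)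
    have c\<phi>x: "continuous_on ({0..} \<times> UNIV) \<phi>x" unfolding \<phi>x_def by (intro continuous_intros cU continuous_chi)
    have der: "((\<lambda>p. max 0 (m - V h p) ^ 2 * chi p) has_derivative (\<lambda>d. \<phi>t (a,x) * fst d + \<phi>x (a,x) * snd d)) (at (a,x))"
      if "0 < a" for a x
      by (rule has_derivative_eq_rhs[OF has_derivative_mult[OF square_pos_part_has_derivative[OF has_derivative_diff[OF has_derivative_const V_deriv[OF that h(1)]]] chi_deriv]])
        (auto simp: fun_eq_iff \<phi>t_def \<phi>x_def algebra_simps)
    have N0: "0 \<le> N" using N_pos by simp
    have s\<tau>: "s \<le> \<tau>" "0 \<le> \<tau>" "\<tau> \<le> t" using \<tau> s by auto
    have 1: "E h \<tau> \<le> E h s + integral {s..\<tau>} (\<lambda>\<sigma>. integral {-N..N} (\<lambda>x. \<bar>u \<sigma> x - k\<bar> * \<phi>t (\<sigma>,x) + flux k (u \<sigma> x) * \<phi>x (\<sigma>,x)))"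
      unfolding E_def
      by (rule kruzkov_slices[OF der c\<phi> c\<phi>t c\<phi>x _ N0 _ s s\<tau>(1)]) (use chi_nonneg chi_supp in \<open>auto simp: \<phi>t_def \<phi>x_def\<close>)
    have fl: "continuous_on ({0..} \<times> UNIV) (\<lambda>(t::real, x::real, v). flux k v)"
      unfolding case_prod_unfold by (rule continuous_on_compose2[OF continuous_flux[of UNIV]]) (auto intro!: continuous_intros)
    have ab: "continuous_on ({0..} \<times> UNIV) (\<lambda>(t::real, x::real, v). \<bar>v - k\<bar>)"
      unfolding case_prod_unfold by (intro continuous_intros)
    have HF: "continuous_on ({0..} \<times> UNIV) (\<lambda>(t, x, v). \<bar>v - k\<bar> * \<phi>t (t,x) + flux k v * \<phi>x (t,x))"
      using continuous_on_add[OF continuous_on_mult[OF ab slice_lift[OF c\<phi>t]] continuous_on_mult[OF fl slice_lift[OF c\<phi>x]]]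
      by (simp add: case_prod_unfold)
    have inner: "integral {-N..N} (\<lambda>x. \<bar>u \<sigma> x - k\<bar> * \<phi>t (\<sigma>,x) + flux k (u \<sigma> x) * \<phi>x (\<sigma>,x)) \<le> C * err h \<sigma>"
      if \<sigma>: "\<sigma> \<in> {s..t}" for \<sigma>
    proof -
      have \<sigma>0: "0 \<le> \<sigma>" using \<sigma> s by simp
      have "integral {-N..N} (\<lambda>x. \<bar>u \<sigma> x - k\<bar> * \<phi>t (\<sigma>,x) + flux k (u \<sigma> x) * \<phi>x (\<sigma>,x))
        \<le> integral {-N..N} (\<lambda>x. C * (\<bar>F h (\<sigma>,x) - f (u \<sigma> x)\<bar> + \<bar>U h (\<sigma>,x) - u \<sigma> x\<bar>))"
      proof (rule integral_le[OF integrable_slice[OF HF \<sigma>0]])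
        show "(\<lambda>x. C * (\<bar>F h (\<sigma>,x) - f (u \<sigma> x)\<bar> + \<bar>U h (\<sigma>,x) - u \<sigma> x\<bar>)) integrable_on {-N..N}"
          by (intro integrable_on_mult_right integrable_slice[OF slice_err[OF h(1)] \<sigma>0])
        fix x assume x: "x \<in> {-N..N}"
        show "\<bar>u \<sigma> x - k\<bar> * \<phi>t (\<sigma>,x) + flux k (u \<sigma> x) * \<phi>x (\<sigma>,x) \<le> C * (\<bar>F h (\<sigma>,x) - f (u \<sigma> x)\<bar> + \<bar>U h (\<sigma>,x) - u \<sigma> x\<bar>)"
          unfolding \<phi>t_def \<phi>x_def C_def
          by (rule integrand_le[OF u_bound[OF \<sigma>0] _ D(1)[OF h \<sigma> x] chi_nonneg X(1)[OF \<sigma> x] _ chi_cone D(2)]) auto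
      qed
      also have "\<dots> = C * err h \<sigma>" by (simp add: err_def)
      finally show ?thesis .
    qed
    have "integral {s..\<tau>} (\<lambda>\<sigma>. integral {-N..N} (\<lambda>x. \<bar>u \<sigma> x - k\<bar> * \<phi>t (\<sigma>,x) + flux k (u \<sigma> x) * \<phi>x (\<sigma>,x)))
      \<le> integral {s..\<tau>} (\<lambda>\<sigma>. C * err h \<sigma>)"
    proof (rule integral_le)
      show "(\<lambda>\<sigma>. integral {-N..N} (\<lambda>x. \<bar>u \<sigma> x - k\<bar> * \<phi>t (\<sigma>,x) + flux k (u \<sigma> x) * \<phi>x (\<sigma>,x))) integrable_on {s..\<tau>}"
        by (intro integrable_time continuous_slice_integral[OF HF] s) (use N_pos in auto)
      show "(\<lambda>\<sigma>. C * err h \<sigma>) integrable_on {s..\<tau>}"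
        by (intro integrable_on_mult_right integrable_time continuous_err h s)
    qed (use inner s\<tau> in auto)
    also have "\<dots> = C * integral {s..\<tau>} (err h)" by simp
    also have "\<dots> \<le> C * integral {s..t} (err h)"
      by (intro mult_left_mono C0 integral_subset_le integrable_time continuous_err h s) (use err_nonneg[OF h(1)] s s\<tau> in auto)
    finally show ?thesis using 1 by linarith
  qed
  with C0 show ?thesis by (rule that)
qed

text \<open>On the base of the cone \<open>A\<close> lies above the affine function, and averaging
  moves it by at most \<open>K * h\<close>. This is the source of the powers of \<open>h\<close> in
  \<open>E_init\<close> and \<open>J_init\<close>.\<close>

lemma init_V: "0 < h \<Longrightarrow> chi (s,x) \<noteq> 0 \<Longrightarrow> max 0 (m - V h (s,x)) \<le> K * h"
  using init[OF chi_init, of x] avg_A_close[OF s, of h x] K_nonneg unfolding V_def by auto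

lemma E_init: obtains C where "\<And>h. 0 < h \<Longrightarrow> E h s \<le> C * h ^ 2"
proof -
  obtain X where X: "\<And>\<tau> x. \<tau> \<in> {s..t} \<Longrightarrow> x \<in> {-N..N} \<Longrightarrow> chi (\<tau>,x) \<le> X" "0 \<le> X"
    using chi_bounded by blast
  have "E h s \<le> (2 * N * ((K + \<bar>k\<bar>) * (K ^ 2 * X))) * h ^ 2" if h: "0 < h" for h
  proof -
    note H = slice_EJ(1)[OF h]
    have "E h s \<le> integral {-N..N} (\<lambda>_. (K + \<bar>k\<bar>) * ((K * h) ^ 2 * X))" unfolding E_def
    proof (rule integral_le[OF integrable_slice[OF H s] integrable_const_Icc])
      fix x assume x: "x \<in> {-N..N}"
      have "max 0 (m - V h (s,x)) ^ 2 * chi (s,x) \<le> (K * h) ^ 2 * X"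
      proof (cases "chi (s,x) = 0")
        case False
        then show ?thesis using init_V[OF h False] X(1)[of s x] x st chi_nonneg by (intro mult_mono power_mono) auto
      qed (use X in auto)
      moreover have "\<bar>u s x - k\<bar> \<le> K + \<bar>k\<bar>" using u_bound[OF s, of x] by linarith
      ultimately show "\<bar>u s x - k\<bar> * (max 0 (m - V h (s,x)) ^ 2 * chi (s,x)) \<le> (K + \<bar>k\<bar>) * ((K * h) ^ 2 * X)"
        using chi_nonneg[of "(s,x)"] K_nonneg mult_mono[of "\<bar>u s x - k\<bar>" "K + \<bar>k\<bar>" "max 0 (m - V h (s,x)) ^ 2 * chi (s,x)" "(K * h) ^ 2 * X"] by simp
    qed
    also have "\<dots> = (2 * N * ((K + \<bar>k\<bar>) * (K ^ 2 * X))) * h ^ 2" using N_pos by (simp add: power_mult_distrib)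
    finally show ?thesis .
  qed
  then show ?thesis by (rule that)
qed

lemma J_init: obtains C where "\<And>h. 0 < h \<Longrightarrow> J h s \<le> C * h ^ 3"
proof -
  obtain X where X: "\<And>\<tau> x. \<tau> \<in> {s..t} \<Longrightarrow> x \<in> {-N..N} \<Longrightarrow> chi (\<tau>,x) \<le> X" "0 \<le> X"
    using chi_bounded by blast
  have "J h s \<le> (2 * N * (K ^ 3 * X)) * h ^ 3" if h: "0 < h" for h
  proof -
    note H = slice_EJ(2)[OF h]
    have "J h s \<le> integral {-N..N} (\<lambda>_. (K * h) ^ 3 * X)" unfolding J_def
    proof (rule integral_le[OF integrable_slice[OF H s] integrable_const_Icc])
      fix x assume x: "x \<in> {-N..N}"
      show "max 0 (m - V h (s,x)) ^ 3 * chi (s,x) \<le> (K * h) ^ 3 * X"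
      proof (cases "chi (s,x) = 0")
        case False
        then show ?thesis using init_V[OF h False] X(1)[of s x] x st chi_nonneg K_nonneg h by (intro mult_mono power_mono) auto
      next
        case True then show ?thesis using X K_nonneg h by simp
      qed
    qed
    also have "\<dots> = (2 * N * (K ^ 3 * X)) * h ^ 3" using N_pos by (simp add: power_mult_distrib)
    finally show ?thesis .
  qed
  then show ?thesis by (rule that)
qed

lemma continuous_sections:
  fixes q :: "real \<Rightarrow> real \<Rightarrow> real"
  assumes "continuous_on ({0..} \<times> UNIV) (\<lambda>p. q (fst p) (snd p))"
  shows "continuous_on {0..} (\<lambda>\<tau>. q \<tau> x)" "0 \<le> \<tau> \<Longrightarrow> continuous_on UNIV (q \<tau>)"
proof -
  have "continuous_on {0..} (\<lambda>\<tau>. q (fst (\<tau>,x)) (snd (\<tau>,x)))"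
    by (rule continuous_on_compose2[OF assms]) (auto intro!: continuous_intros)
  then show "continuous_on {0..} (\<lambda>\<tau>. q \<tau> x)" by simp
  assume "0 \<le> \<tau>"
  then have "continuous_on UNIV (\<lambda>x. q (fst (\<tau>,x)) (snd (\<tau>,x)))"
    by (intro continuous_on_compose2[OF assms]) (auto intro!: continuous_intros)
  then show "continuous_on UNIV (q \<tau>)" by simp
qed

text \<open>Obtained for each \<open>x\<close> by differentiating in time, which involves the
  equation for the averaged potential but no entropy inequality; the term with \<open>chit\<close>
  has the good sign. The order of integration is exchanged at the end, for a continuous
  integrand.\<close>

lemma J_estimate:
  assumes h: "0 < h"
  shows "J h t \<le> J h s + integral {s..t} (\<lambda>\<tau>. integral {-N..N} (\<lambda>x. 3 * max 0 (m - V h (\<tau>,x)) ^ 2 * \<bar>F h (\<tau>,x) - f k\<bar> * chi (\<tau>,x)))"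
proof -
  define G where "G \<tau> x = 3 * max 0 (m - V h (\<tau>,x)) ^ 2 * \<bar>F h (\<tau>,x) - f k\<bar> * chi (\<tau>,x)" for \<tau> x
  define Q where "Q \<tau> x = max 0 (m - V h (\<tau>,x)) ^ 3 * chi (\<tau>,x)" for \<tau> x
  note cU = continuous_UFV[OF h]
  have cG: "continuous_on ({0..} \<times> UNIV) (\<lambda>p. G (fst p) (snd p))"
    unfolding G_def prod.collapse by (intro continuous_intros cU continuous_chi)
  have cQ: "continuous_on ({0..} \<times> UNIV) (\<lambda>p. Q (fst p) (snd p))"
    unfolding Q_def prod.collapse by (intro continuous_intros cU continuous_chi)
  note cG1 = continuous_sections(1)[OF cG] and cQ1 = continuous_sections(1)[OF cQ]
    and cQ2 = continuous_sections(2)[OF cQ]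
  have pt: "Q t x \<le> Q s x + integral {s..t} (\<lambda>\<tau>. G \<tau> x)" for x
  proof -
    let ?g = "\<lambda>\<tau>. Q \<tau> x - integral {0..\<tau>} (\<lambda>\<tau>. G \<tau> x)"
    have "?g t \<le> ?g s"
    proof (rule DERIV_nonpos_imp_decreasing_open[where f="?g"])
      fix \<tau> assume \<tau>: "s < \<tau>" "\<tau> < t"
      then have \<tau>0: "0 < \<tau>" using s by simp
      have l: "((\<lambda>\<tau>. (\<tau>, x)) has_derivative (\<lambda>d. (d, 0))) (at \<tau>)" by (auto intro!: derivative_eq_intros)
      have dV: "((\<lambda>\<tau>. V h (\<tau>,x)) has_real_derivative (f k - F h (\<tau>,x))) (at \<tau>)"
        using has_derivative_compose[OF l V_deriv[OF \<tau>0 h, of x]] by (simp add: has_field_derivative_def)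
      have dchi: "((\<lambda>\<tau>. chi (\<tau>,x)) has_real_derivative chit (\<tau>,x)) (at \<tau>)"
        using has_derivative_compose[OF l chi_deriv[of "(\<tau>,x)"]] by (simp add: has_field_derivative_def)
      have "((\<lambda>\<tau>. Q \<tau> x) has_real_derivative
         (3 * max 0 (m - V h (\<tau>,x)) ^ 2 * (0 - (f k - F h (\<tau>,x))) * chi (\<tau>,x) + chit (\<tau>,x) * max 0 (m - V h (\<tau>,x)) ^ 3)) (at \<tau>)"
        unfolding Q_def by (intro DERIV_mult cube_pos_part_deriv_comp DERIV_diff DERIV_const dV dchi)
      then have d: "(?g has_real_derivative
         (3 * max 0 (m - V h (\<tau>,x)) ^ 2 * (0 - (f k - F h (\<tau>,x))) * chi (\<tau>,x) + chit (\<tau>,x) * max 0 (m - V h (\<tau>,x)) ^ 3) - G \<tau> x) (at \<tau>)"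
        by (intro DERIV_diff continuous_antiderivative cG1 \<tau>0)
      have "(3 * max 0 (m - V h (\<tau>,x)) ^ 2 * chi (\<tau>,x)) * (0 - (f k - F h (\<tau>,x))) \<le> (3 * max 0 (m - V h (\<tau>,x)) ^ 2 * chi (\<tau>,x)) * \<bar>F h (\<tau>,x) - f k\<bar>"
        using chi_nonneg by (intro mult_left_mono) auto
      moreover have "chit (\<tau>,x) * max 0 (m - V h (\<tau>,x)) ^ 3 \<le> 0"
        using chit_nonpos by (intro mult_nonpos_nonneg) auto
      ultimately have "(3 * max 0 (m - V h (\<tau>,x)) ^ 2 * (0 - (f k - F h (\<tau>,x))) * chi (\<tau>,x) + chit (\<tau>,x) * max 0 (m - V h (\<tau>,x)) ^ 3) - G \<tau> x \<le> 0"
        unfolding G_def by (simp add: mult_ac)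
      with d show "\<exists>y. (?g has_real_derivative y) (at \<tau>) \<and> y \<le> 0" by blast
    next
      have "continuous_on {0..} ?g" by (intro continuous_on_diff cQ1 continuous_antiderivative_on cG1)
      then show "continuous_on {s..t} ?g" by (rule continuous_on_subset) (use s in auto)
    qed (use st in simp)
    moreover have "integral {0..s} (\<lambda>\<tau>. G \<tau> x) + integral {s..t} (\<lambda>\<tau>. G \<tau> x) = integral {0..t} (\<lambda>\<tau>. G \<tau> x)"
      by (rule Henstock_Kurzweil_Integration.integral_combine[OF _ _ integrable_time[OF cG1]]) (use s st in auto)
    ultimately show ?thesis by linarith
  qed
  have cGb: "continuous_on (cbox (-N, s) (N, t)) (\<lambda>(x, \<tau>). G \<tau> x)"
  proof -
    have "continuous_on (cbox (-N, s) (N, t)) (\<lambda>q. G (fst (snd q, fst q)) (snd (snd q, fst q)))"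
      by (rule continuous_on_compose2[OF cG]) (use s in \<open>auto intro!: continuous_intros simp: cbox_Pair_eq\<close>)
    then show ?thesis by (simp add: case_prod_unfold)
  qed
  have Gx: "(\<lambda>x. integral {s..t} (\<lambda>\<tau>. G \<tau> x)) integrable_on {-N..N}"
  proof -
    have "continuous_on (cbox (-N) N) (\<lambda>x. integral (cbox s t) (\<lambda>\<tau>. G \<tau> x))"
      by (rule integral_continuous_on_param) (use cGb in \<open>simp add: cbox_Pair_eq case_prod_unfold\<close>)
    then show ?thesis by (intro integrable_continuous_interval) simp
  qed
  have "J h t \<le> integral {-N..N} (\<lambda>x. Q s x + integral {s..t} (\<lambda>\<tau>. G \<tau> x))"
    unfolding J_def Q_def[symmetric]
    by (intro integral_le integrable_add continuous_integrable_ivl cQ2 Gx pt) (use s st in auto)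
  also have "\<dots> = J h s + integral {-N..N} (\<lambda>x. integral {s..t} (\<lambda>\<tau>. G \<tau> x))"
    unfolding J_def Q_def[symmetric] by (intro integral_add continuous_integrable_ivl cQ2 Gx s)
  also have "integral {-N..N} (\<lambda>x. integral {s..t} (\<lambda>\<tau>. G \<tau> x)) = integral {s..t} (\<lambda>\<tau>. integral {-N..N} (\<lambda>x. G \<tau> x))"
    using integral_swap_continuous[OF cGb] by simp
  finally show ?thesis by (simp add: G_def)
qed

text \<open>The bound of \<open>J_estimate\<close> is split by inserting
  \<open>f (u \<tau> x)\<close>: its distance from \<open>f k\<close> is at most
  \<open>L * |u - k|\<close> and produces \<open>E\<close>, small by \<open>E_init\<close> and
  \<open>E_estimate\<close>; its distance from the average produces \<open>err\<close>.\<close>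

lemma J_tendsto: "(\<lambda>n. J (inverse (real (Suc n))) t) \<longlonglongrightarrow> 0"
proof -
  define H where "H n = inverse (real (Suc n))" for n
  have H: "0 < H n" "H n \<le> 1" for n by (auto simp: H_def field_simps)
  have H0: "H \<longlonglongrightarrow> 0" unfolding H_def by (rule LIMSEQ_inverse_real_of_nat)
  obtain D where D: "\<And>h \<tau> x. 0 < h \<Longrightarrow> h \<le> 1 \<Longrightarrow> \<tau> \<in> {s..t} \<Longrightarrow> x \<in> {-N..N} \<Longrightarrow> max 0 (m - V h (\<tau>,x)) \<le> D" "0 \<le> D"
    using V_bounded by blast
  obtain X where X: "\<And>\<tau> x. \<tau> \<in> {s..t} \<Longrightarrow> x \<in> {-N..N} \<Longrightarrow> chi (\<tau>,x) \<le> X" "0 \<le> X"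
    using chi_bounded by blast
  obtain C1 where C1: "0 \<le> C1" "\<And>h \<tau>. 0 < h \<Longrightarrow> h \<le> 1 \<Longrightarrow> \<tau> \<in> {s..t} \<Longrightarrow> E h \<tau> \<le> E h s + C1 * integral {s..t} (err h)"
    using E_estimate by blast
  obtain C2 where C2: "\<And>h. 0 < h \<Longrightarrow> E h s \<le> C2 * h ^ 2" using E_init by blast
  obtain C3 where C3: "\<And>h. 0 < h \<Longrightarrow> J h s \<le> C3 * h ^ 3" using J_init by blast
  define W where "W n = integral {s..t} (err (H n))" for n
  have W0: "W \<longlonglongrightarrow> 0" unfolding W_def H_def by (rule err_tendsto)
  define bound where "bound n = C3 * H n ^ 3 + (3 * L * (C2 * H n ^ 2 + C1 * W n) * (t - s) + 3 * D ^ 2 * X * W n)" for n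
  have "bound \<longlonglongrightarrow> C3 * 0 ^ 3 + (3 * L * (C2 * 0 ^ 2 + C1 * 0) * (t - s) + 3 * D ^ 2 * X * 0)"
    unfolding bound_def by (intro tendsto_intros H0 W0)
  then have b0: "bound \<longlonglongrightarrow> 0" by simp
  have J0: "0 \<le> J (H n) t" for n
  proof (cases "(\<lambda>x. max 0 (m - V (H n) (t,x)) ^ 3 * chi (t,x)) integrable_on {-N..N}")
    case True then show ?thesis unfolding J_def using chi_nonneg by (intro integral_nonneg) auto
  qed (simp add: J_def not_integrable_integral)
  have "J (H n) t \<le> bound n" for n
  proof -
    let ?h = "H n"
    note h = H[of n]
    have HG: "continuous_on ({0..} \<times> UNIV) (\<lambda>(\<tau>, x, v::real). 3 * max 0 (m - V ?h (\<tau>,x)) ^ 2 * \<bar>F ?h (\<tau>,x) - f k\<bar> * chi (\<tau>,x))"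
      unfolding case_prod_unfold
      by (intro continuous_intros continuous_on_compose2[OF continuous_UFV(3)[OF h(1)]] continuous_on_compose2[OF continuous_UFV(2)[OF h(1)]]
          continuous_on_compose2[OF continuous_chi(1)[of UNIV]]) auto
    note HE = slice_EJ(1)[OF h(1)]
    have inner: "integral {-N..N} (\<lambda>x. 3 * max 0 (m - V ?h (\<tau>,x)) ^ 2 * \<bar>F ?h (\<tau>,x) - f k\<bar> * chi (\<tau>,x))
       \<le> 3 * L * (C2 * ?h ^ 2 + C1 * W n) + 3 * D ^ 2 * X * err ?h \<tau>" if \<tau>: "\<tau> \<in> {s..t}" for \<tau>
    proof -
      have \<tau>0: "0 \<le> \<tau>" using \<tau> s by simp
      have "integral {-N..N} (\<lambda>x. 3 * max 0 (m - V ?h (\<tau>,x)) ^ 2 * \<bar>F ?h (\<tau>,x) - f k\<bar> * chi (\<tau>,x)) \<le>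
         integral {-N..N} (\<lambda>x. 3 * L * (\<bar>u \<tau> x - k\<bar> * (max 0 (m - V ?h (\<tau>,x)) ^ 2 * chi (\<tau>,x))) + 3 * D ^ 2 * X * (\<bar>F ?h (\<tau>,x) - f (u \<tau> x)\<bar> + \<bar>U ?h (\<tau>,x) - u \<tau> x\<bar>))"
      proof (rule integral_le[OF integrable_slice[OF HG \<tau>0] integrable_add[OF
           integrable_on_mult_right[OF integrable_slice[OF HE \<tau>0]]
           integrable_on_mult_right[OF integrable_slice[OF slice_err[OF h(1)] \<tau>0]]]])
        fix x assume x: "x \<in> {-N..N}"
        define Q where "Q = max 0 (m - V ?h (\<tau>,x)) ^ 2"
        have Q: "0 \<le> Q" "Q \<le> D ^ 2" unfolding Q_def using D(1)[OF h \<tau> x] by (auto intro!: power_mono)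
        have c: "0 \<le> chi (\<tau>,x)" "chi (\<tau>,x) \<le> X" using chi_nonneg X(1)[OF \<tau> x] by auto
        have "\<bar>F ?h (\<tau>,x) - f k\<bar> \<le> L * \<bar>u \<tau> x - k\<bar> + \<bar>F ?h (\<tau>,x) - f (u \<tau> x)\<bar>"
          using L[OF u_bound[OF \<tau>0, of x]] by linarith
        then have "(3 * Q * chi (\<tau>,x)) * \<bar>F ?h (\<tau>,x) - f k\<bar> \<le> (3 * Q * chi (\<tau>,x)) * (L * \<bar>u \<tau> x - k\<bar> + \<bar>F ?h (\<tau>,x) - f (u \<tau> x)\<bar>)"
          using Q c by (intro mult_left_mono) auto
        also have "\<dots> = 3 * L * (\<bar>u \<tau> x - k\<bar> * (Q * chi (\<tau>,x))) + 3 * (Q * chi (\<tau>,x)) * \<bar>F ?h (\<tau>,x) - f (u \<tau> x)\<bar>"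
          by (simp add: algebra_simps)
        also have "\<dots> \<le> 3 * L * (\<bar>u \<tau> x - k\<bar> * (Q * chi (\<tau>,x))) + 3 * (D ^ 2 * X) * (\<bar>F ?h (\<tau>,x) - f (u \<tau> x)\<bar> + \<bar>U ?h (\<tau>,x) - u \<tau> x\<bar>)"
          using Q c by (intro add_left_mono mult_mono) auto
        finally show "3 * max 0 (m - V ?h (\<tau>,x)) ^ 2 * \<bar>F ?h (\<tau>,x) - f k\<bar> * chi (\<tau>,x) \<le>
           3 * L * (\<bar>u \<tau> x - k\<bar> * (max 0 (m - V ?h (\<tau>,x)) ^ 2 * chi (\<tau>,x))) + 3 * D ^ 2 * X * (\<bar>F ?h (\<tau>,x) - f (u \<tau> x)\<bar> + \<bar>U ?h (\<tau>,x) - u \<tau> x\<bar>)"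
          by (simp add: Q_def mult_ac)
      qed
      also have "\<dots> = 3 * L * E ?h \<tau> + 3 * D ^ 2 * X * err ?h \<tau>"
        unfolding E_def err_def using integrable_slice[OF HE \<tau>0] integrable_slice[OF slice_err[OF h(1)] \<tau>0]
        by (subst integral_add) (auto intro!: integrable_on_mult_right)
      also have "3 * L * E ?h \<tau> \<le> 3 * L * (C2 * ?h ^ 2 + C1 * W n)"
        using C1(2)[OF h \<tau>] C2[OF h(1)] L0 by (intro mult_left_mono) (auto simp: W_def)
      finally show ?thesis by simp
    qed
    have "integral {s..t} (\<lambda>\<tau>. integral {-N..N} (\<lambda>x. 3 * max 0 (m - V ?h (\<tau>,x)) ^ 2 * \<bar>F ?h (\<tau>,x) - f k\<bar> * chi (\<tau>,x)))
      \<le> integral {s..t} (\<lambda>\<tau>. 3 * L * (C2 * ?h ^ 2 + C1 * W n) + 3 * D ^ 2 * X * err ?h \<tau>)"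
      by (intro integral_le integrable_time continuous_slice_integral[OF HG] s integrable_add integrable_on_mult_right continuous_err h integrable_const_Icc inner) (use N_pos in auto)
    also have "\<dots> = 3 * L * (C2 * ?h ^ 2 + C1 * W n) * (t - s) + 3 * D ^ 2 * X * W n"
      unfolding W_def using integrable_time[OF continuous_err[OF h(1)] s] st
      by (subst integral_add) (auto intro!: integrable_on_mult_right)
    finally show ?thesis using J_estimate[OF h(1)] C3[OF h(1)] unfolding bound_def by linarith
  qed
  then have "\<forall>n. norm (J (H n) t) \<le> bound n" using J0 by simp
  then have "(\<lambda>n. J (H n) t) \<longlonglongrightarrow> 0" by (intro Lim_null_comparison[OF _ b0] always_eventually)
  then show ?thesis by (simp add: H_def)
qed

lemma affine_lower_bound: "k * x0 + m - f k * (t - s) \<le> A t x0"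
proof (rule ccontr)
  assume neg: "\<not> ?thesis"
  \<comment> \<open>A third of the gap at \<open>x0\<close>: one third is given up for moving away
    from \<open>x0\<close>, another for averaging, so a gap of \<open>\<eta>\<close> remains on a
    whole interval and keeps \<open>J\<close> away from 0.\<close>
  define \<eta> where "\<eta> = (k * x0 + m - f k * (t - s) - A t x0) / 3"
  have \<eta>: "0 < \<eta>" using neg by (simp add: \<eta>_def)
  have t0: "0 \<le> t" using s st by simp
  define d where "d = min (r / 2) (\<eta> / (K + \<bar>k\<bar> + 1))"
  have Kk: "0 < K + \<bar>k\<bar> + 1" using K_nonneg by linarith
  have d: "0 < d" "d \<le> r / 2" "(K + \<bar>k\<bar>) * d \<le> \<eta>"
  proof -
    show "0 < d" using r \<eta> Kk by (simp add: d_def)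
    show "d \<le> r / 2" unfolding d_def by (rule min.cobounded1)
    have "(K + \<bar>k\<bar>) * d \<le> (K + \<bar>k\<bar> + 1) * d" using \<open>0 < d\<close> by simp
    also have "\<dots> \<le> (K + \<bar>k\<bar> + 1) * (\<eta> / (K + \<bar>k\<bar> + 1))" using Kk unfolding d_def by (intro mult_left_mono min.cobounded2) auto
    also have "\<dots> = \<eta>" using Kk by simp
    finally show "(K + \<bar>k\<bar>) * d \<le> \<eta>" .
  qed
  have sub: "{x0-d..x0+d} \<subseteq> {-N..N}"
  proof -
    have "r \<le> R" using L0 st by (simp add: R_def)
    then have "\<bar>x0\<bar> + d \<le> N" using d(1,2) r L0 s mult_nonneg_nonneg[OF L0 s] unfolding N_def by linarith
    then show ?thesis by auto
  qed
  \<comment> \<open>At time \<open>t\<close> the cone has radius \<open>r\<close>, so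
    \<open>al\<close> and \<open>be\<close> are at least \<open>r/2\<close> on the interval of
    radius \<open>d \<le> r/2\<close> around \<open>x0\<close>.\<close>
  define c where "c = \<eta> ^ 3 * ((r/2) ^ 2 * (r/2) ^ 2)"
  have lower: "2 * d * c \<le> J h t" if h: "0 < h" "K * h \<le> \<eta>" for h
  proof -
    note H = slice_EJ(2)[OF h(1)]
    have "2 * d * c = integral {x0-d..x0+d} (\<lambda>_. c)" using d by simp
    also have "\<dots> \<le> integral {x0-d..x0+d} (\<lambda>x. max 0 (m - V h (t,x)) ^ 3 * chi (t,x))"
    proof (rule integral_le[OF integrable_const_Icc integrable_slice[OF H t0]])
      fix x assume x: "x \<in> {x0-d..x0+d}"
      then have xd: "\<bar>x - x0\<bar> \<le> d" by auto
      have "\<bar>A t x - A t x0\<bar> \<le> K * \<bar>x - x0\<bar>" by (rule A_lipschitz[OF t0])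
      moreover have "\<bar>k * x - k * x0\<bar> \<le> \<bar>k\<bar> * \<bar>x - x0\<bar>" by (simp add: abs_mult[symmetric] right_diff_distrib)
      moreover have "(K + \<bar>k\<bar>) * \<bar>x - x0\<bar> \<le> (K + \<bar>k\<bar>) * d" using xd K_nonneg by (intro mult_left_mono) auto
      ultimately have "\<bar>A t x - A t x0\<bar> + \<bar>k * x - k * x0\<bar> \<le> \<eta>" using d(3) by (simp add: distrib_right)
      then have "\<eta> \<le> m - V h (t,x)" using avg_A_close[OF t0 h(1), of x] h(2) unfolding V_def \<eta>_def by simp argo
      then have 1: "\<eta> \<le> max 0 (m - V h (t,x))" by simp
      have "r/2 \<le> al (t,x)" "r/2 \<le> be (t,x)" using xd d(2) unfolding al_def be_def R_def by auto
      then have 2: "r/2 \<le> max 0 (al (t,x))" "r/2 \<le> max 0 (be (t,x))" by auto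
      show "c \<le> max 0 (m - V h (t,x)) ^ 3 * chi (t,x)"
        unfolding c_def chi_def using 1 2 \<eta> r by (intro mult_mono power_mono) auto
    qed
    also have "\<dots> \<le> J h t" unfolding J_def
      by (rule integral_subset_le[OF sub integrable_slice[OF H t0] integrable_slice[OF H t0]]) (simp add: chi_nonneg)
    finally show ?thesis .
  qed
  have "\<forall>\<^sub>F n in sequentially. K * inverse (real (Suc n)) < \<eta>"
  proof (rule order_tendstoD(2)[OF _ \<eta>])
    show "(\<lambda>n. K * inverse (real (Suc n))) \<longlonglongrightarrow> 0" using tendsto_mult_right_zero[OF LIMSEQ_inverse_real_of_nat] .
  qed
  then have "\<forall>\<^sub>F n in sequentially. 2 * d * c \<le> J (inverse (real (Suc n))) t"
    by eventually_elim (rule lower, auto)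
  then have "2 * d * c \<le> 0" using tendsto_lowerbound[OF J_tendsto] by simp
  moreover have "0 < 2 * d * c" using d(1) \<eta> r by (simp add: c_def)
  ultimately show False by simp
qed

end

context kruzkov
begin

lemma affine_comparison:
  assumes "\<And>v. \<bar>v\<bar> \<le> K \<Longrightarrow> \<bar>f v - f k\<bar> \<le> L * \<bar>v - k\<bar>" "0 \<le> L" "0 \<le> s" "s < t" "0 < r"
    and "\<And>y. \<bar>y - x\<bar> \<le> L * (t - s) + r \<Longrightarrow> k * y + m \<le> A s y"
  shows "k * x + m - f k * (t - s) \<le> A t x"
proof -
  interpret comparison K u f L k s t r x m by unfold_locales (use assms in auto)
  show ?thesis by (rule affine_lower_bound)
qed

end

section \<open>The Hopf-Lax formula\<close>

lemma subgradient_exists: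
  fixes f :: "real \<Rightarrow> real"
  assumes "convex_on UNIV f" obtains p where "\<And>v. f k + p * (v - k) \<le> f v"
  using convex_le_Inf_differential[OF assms, of k] that by auto

locale flux_function =
  fixes f :: "real \<Rightarrow> real"
  assumes convex: "convex_on UNIV f" and superlin: "superlinear f" and zero: "f 0 = 0" and nonneg: "0 \<le> f w"
begin

text \<open>Superlinearity with slope \<open>|p|\<close> controls large arguments, the sign of
  \<open>f\<close> the bounded rest.\<close>

lemma legendre_bdd: "bdd_above (range (\<lambda>v. p * v - f v))"
proof -
  have "\<forall>\<^sub>F v in at_infinity. \<bar>p\<bar> \<le> f v / \<bar>v\<bar>"
    using superlin unfolding superlinear_def filterlim_at_top by blast
  then obtain b where b: "\<And>v. b \<le> norm v \<Longrightarrow> \<bar>p\<bar> \<le> f v / \<bar>v\<bar>"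
    unfolding eventually_at_infinity by blast
  have "p * v - f v \<le> \<bar>p\<bar> * \<bar>b\<bar>" for v
  proof (cases "b \<le> \<bar>v\<bar> \<and> v \<noteq> 0")
    case True
    then have "\<bar>p\<bar> * \<bar>v\<bar> \<le> f v" using b[of v] by (simp add: pos_le_divide_eq)
    moreover have "p * v \<le> \<bar>p\<bar> * \<bar>v\<bar>" by (metis abs_ge_self abs_mult)
    moreover have "0 \<le> \<bar>p\<bar> * \<bar>b\<bar>" by simp
    ultimately show ?thesis by linarith
  next
    case False
    then have "\<bar>v\<bar> \<le> \<bar>b\<bar>" by auto
    then have "\<bar>p\<bar> * \<bar>v\<bar> \<le> \<bar>p\<bar> * \<bar>b\<bar>" by (intro mult_left_mono) auto
    moreover have "p * v \<le> \<bar>p\<bar> * \<bar>v\<bar>" by (metis abs_ge_self abs_mult)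
    ultimately show ?thesis using nonneg[of v] by linarith
  qed
  then show ?thesis by (intro bdd_aboveI) auto
qed

lemma legendre_upper: "p * v - f v \<le> legendre f p"
  unfolding legendre_def by (rule cSUP_upper[OF _ legendre_bdd]) simp

lemma legendre_least: "(\<And>v. p * v - f v \<le> c) \<Longrightarrow> legendre f p \<le> c"
  unfolding legendre_def by (rule cSUP_least) auto

lemma legendre_nonneg: "0 \<le> legendre f p"
  using legendre_upper[of p 0] zero by simp

lemma legendre_0: "legendre f 0 = 0"
  using legendre_least[of 0 0] nonneg legendre_nonneg[of 0] by (intro antisym) auto

lemma legendre_mono: "0 \<le> p \<Longrightarrow> p \<le> q \<Longrightarrow> legendre f p \<le> legendre f q"
proof (rule legendre_least)
  fix v assume "0 \<le> p" "p \<le> q"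
  show "p * v - f v \<le> legendre f q"
  proof (cases "0 \<le> v")
    case True
    then have "p * v \<le> q * v" using \<open>p \<le> q\<close> by (simp add: mult_right_mono)
    then show ?thesis using legendre_upper[of q v] by simp
  next
    case False
    then have "p * v \<le> 0" using \<open>0 \<le> p\<close> by (simp add: mult_nonneg_nonpos)
    then show ?thesis using nonneg[of v] legendre_nonneg[of q] by simp
  qed
qed

lemma legendre_convex:
  assumes "0 \<le> a" "0 \<le> b" "a + b = 1"
  shows "legendre f (a * p + b * q) \<le> a * legendre f p + b * legendre f q"
proof (rule legendre_least)
  fix v
  have "(a * p + b * q) * v - f v = (a * p + b * q) * v - (a + b) * f v" using assms by simp
  also have "\<dots> = a * (p * v - f v) + b * (q * v - f v)" by (simp add: algebra_simps)
  also have "\<dots> \<le> a * legendre f p + b * legendre f q"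
    by (intro add_mono mult_left_mono legendre_upper assms)
  finally show "(a * p + b * q) * v - f v \<le> a * legendre f p + b * legendre f q" .
qed

lemma continuous_legendre: "continuous_on S (legendre f)"
proof -
  have "convex_on UNIV (legendre f)"
    by (rule convex_onI) (use legendre_convex[of "1 - _" _] in auto)
  from convex_on_continuous[OF open_UNIV this] show ?thesis using continuous_on_subset by blast
qed

text \<open>A Galois connection, valid also where the transform is constant: the sublevel set is
  closed because the transform is continuous, so its supremum is attained.\<close>

lemma legendre_inv_iff:
  assumes "0 \<le> p" "0 \<le> q"
  shows "legendre f p \<le> q \<longleftrightarrow> p \<le> legendre_inv f q"
proof -
  define S where "S = {p. 0 \<le> p \<and> legendre f p \<le> q}"
  \<comment> \<open>Testing the transform with the argument 1 bounds the sublevel set.\<close>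
  have ub: "x \<le> q + f 1" if "x \<in> S" for x using legendre_upper[of x 1] that by (simp add: S_def)
  have bdd: "bdd_above S" using ub by (rule bdd_aboveI)
  have ne: "S \<noteq> {}" using legendre_0 assms(2) by (auto simp: S_def)
  have "closed ({0..} \<inter> {p. legendre f p \<le> q})"
    by (intro closed_Int closed_Collect_le continuous_legendre continuous_on_const) simp
  moreover have "{0..} \<inter> {p. legendre f p \<le> q} = S" by (auto simp: S_def)
  ultimately have "Sup S \<in> S" using closed_contains_Sup[OF ne bdd] by simp
  then have "legendre f p \<le> q" if "p \<le> Sup S" using legendre_mono[OF assms(1) that] by (simp add: S_def)
  moreover have "p \<le> Sup S" if "legendre f p \<le> q"
    by (rule cSup_upper[OF _ bdd]) (use that assms(1) in \<open>simp add: S_def\<close>)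
  ultimately show ?thesis by (auto simp: legendre_inv_def S_def)
qed

end

text \<open>At \<open>t = 0\<close> division by zero would turn the infimum into that of
  \<open>U0\<close> over the whole line, so the initial value is set separately.\<close>

definition hopf_lax :: "(real \<Rightarrow> real) \<Rightarrow> (real \<Rightarrow> real) \<Rightarrow> real \<Rightarrow> real \<Rightarrow> real" where
  "hopf_lax f U0 t x = (if t = 0 then U0 x else (INF y. U0 y + t * legendre f ((x - y) / t)))"

locale hopf_lax_data = flux_function +
  fixes U0 :: "real \<Rightarrow> real" and c K :: real
  assumes lower: "c \<le> U0 y" and lip: "\<bar>U0 x - U0 y\<bar> \<le> K * \<bar>x - y\<bar>"
begin

lemma hopf_lax_0: "hopf_lax f U0 0 x = U0 x"
  by (simp add: hopf_lax_def)

lemma term_lower: "0 \<le> t \<Longrightarrow> c \<le> U0 y + t * legendre f p"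
  using lower[of y] legendre_nonneg[of p] by (simp add: add_increasing2)

lemma hopf_lax_le: "0 < t \<Longrightarrow> hopf_lax f U0 t x \<le> U0 y + t * legendre f ((x - y) / t)"
  unfolding hopf_lax_def using term_lower[of t]
  by (auto intro!: cINF_lower2[of _ _ y] bdd_belowI[of _ c])

lemma hopf_lax_greatest:
  "0 < t \<Longrightarrow> (\<And>y. b \<le> U0 y + t * legendre f ((x - y) / t)) \<Longrightarrow> b \<le> hopf_lax f U0 t x"
  unfolding hopf_lax_def by (auto intro!: cINF_greatest)

lemma hopf_lax_less:
  assumes "0 < t" "hopf_lax f U0 t x < b"
  obtains y where "U0 y + t * legendre f ((x - y) / t) < b"
  using assms hopf_lax_greatest[of t b x] by (meson not_le)

lemma hopf_lax_le_init: "0 \<le> t \<Longrightarrow> hopf_lax f U0 t x \<le> U0 x"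
  using hopf_lax_le[of t x x] legendre_0 hopf_lax_0 by (cases "t = 0") auto

lemma hopf_lax_lower: "0 \<le> t \<Longrightarrow> c \<le> hopf_lax f U0 t x"
  using hopf_lax_greatest[of t c x] term_lower lower hopf_lax_0 by (cases "t = 0") auto

lemma hopf_lax_lipschitz:
  assumes t: "0 \<le> t" shows "\<bar>hopf_lax f U0 t x - hopf_lax f U0 t y\<bar> \<le> K * \<bar>x - y\<bar>"
proof (cases "t = 0")
  case False
  then have t: "0 < t" using t by simp
  have *: "hopf_lax f U0 t x - K * \<bar>x - y\<bar> \<le> hopf_lax f U0 t y" for x y
  proof (rule hopf_lax_greatest[OF t])
    fix z
    have "hopf_lax f U0 t x \<le> U0 (z + (x - y)) + t * legendre f ((x - (z + (x - y))) / t)"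
      by (rule hopf_lax_le[OF t])
    moreover have "x - (z + (x - y)) = y - z" by simp
    moreover have "\<bar>U0 (z + (x - y)) - U0 z\<bar> \<le> K * \<bar>x - y\<bar>" using lip[of "z + (x - y)" z] by simp
    ultimately show "hopf_lax f U0 t x - K * \<bar>x - y\<bar> \<le> U0 z + t * legendre f ((y - z) / t)" by simp
  qed
  show ?thesis using *[of x y] *[of y x] by (simp add: abs_le_iff abs_minus_commute)
qed (use lip hopf_lax_0 in simp)

lemma continuous_hopf_lax: "0 \<le> t \<Longrightarrow> continuous_on S (hopf_lax f U0 t)"
  by (rule lipschitz_imp_continuous) (rule hopf_lax_lipschitz)

text \<open>One half of the semigroup property, from convexity: the mean slope
  \<open>(x - y) / (s + d)\<close> is the convex combination of the slope during the time
  \<open>s\<close> and of \<open>p\<close> during the time \<open>d\<close>, weighted by the two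
  durations.\<close>

lemma hopf_lax_semigroup_le:
  assumes s: "0 \<le> s" and d: "0 < d"
  shows "hopf_lax f U0 (s + d) x \<le> hopf_lax f U0 s (x - p * d) + d * legendre f p"
proof (cases "s = 0")
  case True
  then show ?thesis using hopf_lax_le[OF d, of x "x - p * d"] d by (simp add: hopf_lax_0)
next
  case False
  then have s: "0 < s" using s by simp
  have "hopf_lax f U0 (s + d) x - d * legendre f p \<le> hopf_lax f U0 s (x - p * d)"
  proof (rule hopf_lax_greatest[OF s])
    fix y
    let ?a = "s / (s + d)" and ?b = "d / (s + d)"
    have ab: "0 \<le> ?a" "0 \<le> ?b" "?a + ?b = 1" using s d by (auto simp: add_divide_distrib[symmetric])
    have "?a * ((x - p * d - y) / s) + ?b * p = (x - p * d - y) / (s + d) + d * p / (s + d)"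
      using s by simp
    also have "\<dots> = ((x - p * d - y) + d * p) / (s + d)" by (rule add_divide_distrib[symmetric])
    also have "(x - p * d - y) + d * p = x - y" by simp
    finally have "legendre f ((x - y) / (s + d)) \<le> ?a * legendre f ((x - p * d - y) / s) + ?b * legendre f p"
      using legendre_convex[OF ab, of "(x - p * d - y) / s" p] by simp
    then have "(s + d) * legendre f ((x - y) / (s + d)) \<le> (s + d) * (?a * legendre f ((x - p * d - y) / s) + ?b * legendre f p)"
      using s d by (intro mult_left_mono) auto
    also have "\<dots> = s * legendre f ((x - p * d - y) / s) + d * legendre f p"
      using s d by (simp add: distrib_left)
    finally show "hopf_lax f U0 (s + d) x - d * legendre f p \<le> U0 y + s * legendre f ((x - p * d - y) / s)"
      using hopf_lax_le[of "s + d" x y] s d by simp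
  qed
  then show ?thesis by simp
qed

lemma hopf_lax_shift:
  assumes "0 \<le> t" shows "hopf_lax f (\<lambda>y. U0 y + b) t x = hopf_lax f U0 t x + b"
proof (cases "t = 0")
  case False
  then have t: "0 < t" using assms by simp
  interpret S: hopf_lax_data f "\<lambda>y. U0 y + b" "c + b" K
    by unfold_locales (use lower lip in auto)
  show ?thesis
  proof (rule antisym)
    have "hopf_lax f (\<lambda>y. U0 y + b) t x - b \<le> hopf_lax f U0 t x"
      by (rule hopf_lax_greatest[OF t]) (use S.hopf_lax_le[OF t, of x] in \<open>simp add: algebra_simps\<close>)
    then show "hopf_lax f (\<lambda>y. U0 y + b) t x \<le> hopf_lax f U0 t x + b" by simp
    show "hopf_lax f U0 t x + b \<le> hopf_lax f (\<lambda>y. U0 y + b) t x"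
      by (rule S.hopf_lax_greatest[OF t]) (use hopf_lax_le[OF t, of x] in \<open>simp add: algebra_simps\<close>)
  qed
qed (simp add: hopf_lax_def)

end

section \<open>Tangents of averaged functions, and the lower bound by time steps\<close>

lemma avg_deriv:
  assumes v: "continuous_on UNIV v" and h: "0 < h"
  shows "(avg h v has_real_derivative (v (x + h) - v (x - h)) / (2 * h)) (at x)"
proof -
  have s: "((\<lambda>x. pot v (x + c)) has_real_derivative v (x + c)) (at x)" for c
    using DERIV_chain2[OF pot_deriv[OF v, of "x+c"] DERIV_add[OF DERIV_ident DERIV_const[of c]]] by simp
  have "((\<lambda>x. (pot v (x + h) - pot v (x + (-h))) / (2*h)) has_real_derivative (v (x + h) - v (x + (-h))) / (2*h)) (at x)"
    by (intro DERIV_cdivide DERIV_diff s)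
  moreover have "avg h v = (\<lambda>x. (pot v (x + h) - pot v (x + (-h))) / (2*h))"
    using avg_eq_pot[OF continuous_integrable_ivl[OF v] h] by (simp add: fun_eq_iff)
  ultimately show ?thesis by simp
qed

text \<open>The derivative of the average of a \<open>K\<close>-Lipschitz function is itself
  Lipschitz with constant \<open>K / h\<close>, so the average leaves its tangents at most
  quadratically. The constant degenerates as \<open>h\<close> tends to 0.\<close>

lemma avg_above_tangent:
  assumes lip: "\<And>x y. \<bar>v x - v y\<bar> \<le> K * \<bar>x - y\<bar>" and h: "0 < h"
  shows "avg h v x + (v (x + h) - v (x - h)) / (2 * h) * (y - x) - K / h * (y - x) ^ 2 \<le> avg h v y"
proof -
  have cv: "continuous_on UNIV v" by (rule lipschitz_imp_continuous[of v K]) (use lip in auto)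
  let ?d = "\<lambda>x. (v (x + h) - v (x - h)) / (2 * h)"
  let ?q = "\<lambda>z. avg h v z - ?d x * z"
  have K0: "0 \<le> K" using lip[of 0 1] by simp
  have dd: "\<bar>?d z - ?d x\<bar> \<le> K / h * \<bar>y - x\<bar>" if "z \<in> closed_segment x y" for z
  proof -
    have "?d z - ?d x = ((v (z + h) - v (x + h)) - (v (z - h) - v (x - h))) / (2 * h)"
      by (simp add: diff_divide_distrib)
    also have "\<bar>\<dots>\<bar> = \<bar>(v (z + h) - v (x + h)) - (v (z - h) - v (x - h))\<bar> / (2 * h)" using h by (simp add: abs_divide)
    also have "\<dots> \<le> (K * \<bar>z - x\<bar> + K * \<bar>z - x\<bar>) / (2 * h)"
      using lip[of "z+h" "x+h"] lip[of "z-h" "x-h"] h by (intro divide_right_mono) auto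
    also have "\<dots> = K / h * \<bar>z - x\<bar>" using h by (simp add: field_simps)
    also have "\<dots> \<le> K / h * \<bar>y - x\<bar>"
      using that K0 h by (intro mult_left_mono) (auto simp: closed_segment_eq_real_ivl split: if_splits)
    finally show ?thesis .
  qed
  have "norm (?q y - ?q x) \<le> (K / h * \<bar>y - x\<bar>) * norm (y - x)"
  proof (rule field_differentiable_bound[where S="closed_segment x y" and f'="\<lambda>z. ?d z - ?d x"])
    fix z assume z: "z \<in> closed_segment x y"
    show "(?q has_field_derivative ?d z - ?d x) (at z within closed_segment x y)"
      by (rule has_field_derivative_at_within[OF DERIV_diff[OF avg_deriv[OF cv h] DERIV_cmult_Id]])
    show "norm (?d z - ?d x) \<le> K / h * \<bar>y - x\<bar>" using dd[OF z] by simp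
  qed auto
  moreover have "(K / h * \<bar>y - x\<bar>) * norm (y - x) = K / h * (y - x) ^ 2"
  proof -
    have e: "\<bar>y - x\<bar> * \<bar>y - x\<bar> = (y - x) ^ 2" by (simp add: power2_eq_square)
    show ?thesis unfolding real_norm_def mult.assoc e ..
  qed
  ultimately have "\<bar>?q y - ?q x\<bar> \<le> K / h * (y - x) ^ 2" by (simp only: real_norm_def)
  moreover have "?q y - ?q x = avg h v y - avg h v x - ?d x * (y - x)" by (simp add: right_diff_distrib)
  ultimately show ?thesis by linarith
qed

text \<open>The bound \<open>c\<close> keeps the Hopf-Lax infimum finite; for the solutions at hand
  it is minus the initial mass to the left of the origin.\<close>

locale kruzkov_flux = kruzkov K u f + flux_function f for K u f +
  fixes c :: real
  assumes A_lower: "c \<le> A 0 y"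
begin

sublocale HL: hopf_lax_data f "A 0" c K
  by unfold_locales (use A_lower A_lipschitz[OF order_refl] in auto)

lemma A_le_hopf_lax: "0 < t \<Longrightarrow> A t x \<le> hopf_lax f (A 0) t x"
proof (rule HL.hopf_lax_greatest)
  fix y assume t: "0 < t"
  show "A t x \<le> A 0 y + t * legendre f ((x - y) / t)"
    using A_upper[OF legendre_upper, of t y "(x - y) / t"] t by (simp add: mult.commute)
qed

text \<open>One constant bounds both the increments of \<open>f\<close> on \<open>[-K, K]\<close>
  and the slopes. A subgradient at \<open>k\<close> is bounded by the increments of \<open>f\<close>
  from \<open>k\<close> to \<open>k + 1\<close> and to \<open>k - 1\<close>, which is why
  \<open>f\<close> is bounded on a larger interval; the supremum defining its transform is attained
  at \<open>k\<close>.\<close>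

lemma subgradients:
  obtains L where "0 \<le> L" "\<And>v k. \<bar>v\<bar> \<le> K \<Longrightarrow> \<bar>k\<bar> \<le> K \<Longrightarrow> \<bar>f v - f k\<bar> \<le> L * \<bar>v - k\<bar>"
    "\<And>k. \<bar>k\<bar> \<le> K \<Longrightarrow> \<exists>p. \<bar>p\<bar> \<le> L \<and> legendre f p \<le> p * k - f k"
proof -
  have "compact (f ` {-K-1..K+1})" by (intro compact_continuous_image continuous_f) auto
  then obtain B where B: "\<forall>v\<in>{-K-1..K+1}. \<bar>f v\<bar> \<le> B" by (auto dest!: compact_imp_bounded simp: bounded_iff)
  define L where "L = 2 * B"
  have L0: "0 \<le> L" using B[rule_format, of 0] K_nonneg by (simp add: L_def)
  have sg: "\<exists>p. \<bar>p\<bar> \<le> L \<and> (\<forall>v. f k + p * (v - k) \<le> f v)" if k: "\<bar>k\<bar> \<le> K" for k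
  proof -
    obtain p where p: "\<And>v. f k + p * (v - k) \<le> f v" using subgradient_exists[OF convex] by blast
    have "\<bar>f k\<bar> \<le> B" "\<bar>f (k + 1)\<bar> \<le> B" "\<bar>f (k - 1)\<bar> \<le> B" using k by (auto intro!: B[rule_format])
    then have "\<bar>p\<bar> \<le> L" using p[of "k + 1"] p[of "k - 1"] by (simp add: L_def abs_le_iff)
    with p show ?thesis by blast
  qed
  show ?thesis
  proof (rule that[OF L0])
    fix v k assume "\<bar>v\<bar> \<le> K" "\<bar>k\<bar> \<le> K"
    then obtain p q where p: "\<bar>p\<bar> \<le> L" "f k + p * (v - k) \<le> f v" and q: "\<bar>q\<bar> \<le> L" "f v + q * (k - v) \<le> f k"
      using sg by metis
    have "\<bar>p * (v - k)\<bar> \<le> L * \<bar>v - k\<bar>" "\<bar>q * (k - v)\<bar> \<le> L * \<bar>v - k\<bar>"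
      using p(1) q(1) by (auto simp: abs_mult abs_minus_commute intro!: mult_right_mono)
    then show "\<bar>f v - f k\<bar> \<le> L * \<bar>v - k\<bar>" using p(2) q(2) by linarith
  next
    fix k assume "\<bar>k\<bar> \<le> K"
    then obtain p where p: "\<bar>p\<bar> \<le> L" "\<And>v. f k + p * (v - k) \<le> f v" using sg by blast
    have "p * v - f v \<le> p * k - f k" for v using p(2)[of v] by (simp add: right_diff_distrib)
    then have "legendre f p \<le> p * k - f k" by (rule legendre_least)
    with p(1) show "\<exists>p. \<bar>p\<bar> \<le> L \<and> legendre f p \<le> p * k - f k" by blast
  qed
qed

text \<open>The averaged Hopf-Lax function still satisfies the semigroup inequality, and it lies above
  its tangents up to a quadratic error. Hence one time step reduces to the comparison with an
  affine solution.\<close>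

lemma hopf_lax_le_A:
  assumes t: "0 < t" shows "hopf_lax f (A 0) t x \<le> A t x"
proof (rule field_le_epsilon)
  fix e :: real assume e: "0 < e"
  define \<delta> where "\<delta> = e / (2 * (K + 1))"
  have \<delta>: "0 < \<delta>" using e K_nonneg by (simp add: \<delta>_def)
  have K\<delta>: "2 * (K * \<delta>) \<le> e"
  proof -
    have "K * \<delta> \<le> (K + 1) * \<delta>" using \<delta> by simp
    also have "\<dots> = e / 2" using K_nonneg unfolding \<delta>_def by (simp add: field_simps)
    finally show ?thesis by simp
  qed
  obtain L where L: "0 \<le> L" "\<And>v k. \<bar>v\<bar> \<le> K \<Longrightarrow> \<bar>k\<bar> \<le> K \<Longrightarrow> \<bar>f v - f k\<bar> \<le> L * \<bar>v - k\<bar>"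
    "\<And>k. \<bar>k\<bar> \<le> K \<Longrightarrow> \<exists>p. \<bar>p\<bar> \<le> L \<and> legendre f p \<le> p * k - f k"
    using subgradients by blast
  define H where "H s = hopf_lax f (A 0) s" for s
  define W where "W s = avg \<delta> (H s)" for s
  have lipH: "\<bar>H s x - H s y\<bar> \<le> K * \<bar>x - y\<bar>" if "0 \<le> s" for s x y
    unfolding H_def by (rule HL.hopf_lax_lipschitz[OF that])
  have Hi: "H s integrable_on {a..b}" if "0 \<le> s" for s a b
    unfolding H_def by (intro continuous_integrable_ivl HL.continuous_hopf_lax that)
  have WH: "\<bar>W s x - H s x\<bar> \<le> K * \<delta>" if s: "0 \<le> s" for s x
    unfolding W_def
  proof (rule avg_bound[OF Hi[OF s] \<delta>])
    fix y assume "x - \<delta> \<le> y" "y \<le> x + \<delta>"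
    then have "\<bar>y - x\<bar> \<le> \<delta>" by auto
    then show "\<bar>H s y - H s x\<bar> \<le> K * \<delta>" using lipH[OF s, of y x] mult_left_mono[OF _ K_nonneg] by fastforce
  qed
  \<comment> \<open>The displacement \<open>p * d\<close> makes the semigroup inequality a pointwise
    comparison with a translate, so averaging preserves it.\<close>
  have lax: "W (s + d) (z + p * d) \<le> W s z + d * legendre f p" if s: "0 \<le> s" and d: "0 < d" for s d z p
  proof -
    have sd: "0 \<le> s + d" using s d by simp
    have c: "continuous_on UNIV (H s)" unfolding H_def by (rule HL.continuous_hopf_lax[OF s])
    have ci: "(\<lambda>y. H s y + d * legendre f p) integrable_on {a..b}" for a b
      by (intro continuous_integrable_ivl continuous_intros c)
    have "W (s + d) (z + p * d) = avg \<delta> (\<lambda>y. H (s + d) (y + p * d)) z"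
      unfolding W_def avg_def integral_shift_ivl by (simp add: algebra_simps)
    also have "\<dots> \<le> avg \<delta> (\<lambda>y. H s y + d * legendre f p) z"
    proof (rule avg_mono[OF _ ci \<delta>])
      have cd: "continuous_on UNIV (H (s + d))" unfolding H_def by (rule HL.continuous_hopf_lax[OF sd])
      show "(\<lambda>y. H (s + d) (y + p * d)) integrable_on {z - \<delta>..z + \<delta>}"
        by (intro continuous_integrable_ivl continuous_on_compose2[OF cd] continuous_intros) auto
      fix y show "H (s + d) (y + p * d) \<le> H s y + d * legendre f p"
        using HL.hopf_lax_semigroup_le[OF s d, of "y + p * d" p] by (simp add: H_def)
    qed
    also have "\<dots> = W s z + d * legendre f p"
      unfolding W_def avg_def using \<delta> by (simp add: integral_add Hi[OF s] add_divide_distrib)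
    finally show ?thesis .
  qed
  \<comment> \<open>\<open>K / \<delta>\<close> comes from \<open>avg_above_tangent\<close>.
    Tangents are used at points \<open>z + p * d\<close> with \<open>z\<close> in a base of radius
    \<open>L * d + d\<close> and \<open>|p| \<le> L\<close>, hence within
    \<open>(2 * L + 1) * d\<close> of \<open>x\<close>.\<close>
  define C where "C = K / \<delta> * (2 * L + 1) ^ 2"
  have step: "W (s + d) x - (b + C * d ^ 2) \<le> A (s + d) x"
    if s: "0 \<le> s" and d: "0 < d" and ih: "\<And>y. W s y - b \<le> A s y" for s d b x
  proof -
    have sd: "0 \<le> s + d" using s d by simp
    \<comment> \<open>The slope at \<open>x\<close> of the averaged Hopf-Lax function at the new
      time; \<open>p\<close> below is a subgradient of \<open>f\<close> at this slope.\<close>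
    define k where "k = (H (s + d) (x + \<delta>) - H (s + d) (x - \<delta>)) / (2 * \<delta>)"
    have k: "\<bar>k\<bar> \<le> K"
      using lipH[OF sd, of "x + \<delta>" "x - \<delta>"] \<delta> by (simp add: k_def abs_divide pos_divide_le_eq)
    obtain p where p: "\<bar>p\<bar> \<le> L" "legendre f p \<le> p * k - f k" using L(3)[OF k] by blast
    \<comment> \<open>Solved from the wish that \<open>affine_comparison\<close> return exactly
      \<open>W (s + d) x - C * d^2 - b\<close>.\<close>
    define m where "m = W (s + d) x - k * x + d * f k - C * d ^ 2 - b"
    have "k * x + m - f k * (s + d - s) \<le> A (s + d) x"
    proof (rule affine_comparison[OF L(2)[OF _ k] L(1) s _ d])
      show "s < s + d" using d by simp
      fix z assume z: "\<bar>z - x\<bar> \<le> L * (s + d - s) + d"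
      have "\<bar>p * d\<bar> \<le> L * d" using p(1) d by (simp add: abs_mult mult_right_mono)
      then have "\<bar>z + p * d - x\<bar> \<le> (2 * L + 1) * d" using z by (simp add: algebra_simps abs_le_iff)
      then have "(z + p * d - x) ^ 2 \<le> ((2 * L + 1) * d) ^ 2" using L(1) d by (simp add: abs_le_square_iff[symmetric] abs_mult)
      then have "K / \<delta> * (z + p * d - x) ^ 2 \<le> K / \<delta> * ((2 * L + 1) * d) ^ 2" using K_nonneg \<delta> by (intro mult_left_mono) auto
      then have 1: "K / \<delta> * (z + p * d - x) ^ 2 \<le> C * d ^ 2" by (simp add: C_def power_mult_distrib)
      have 2: "W (s + d) x + k * (z + p * d - x) - K / \<delta> * (z + p * d - x) ^ 2 \<le> W (s + d) (z + p * d)"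
        unfolding W_def k_def by (rule avg_above_tangent[OF lipH[OF sd] \<delta>])
      have 3: "W (s + d) (z + p * d) \<le> W s z + d * legendre f p" by (rule lax[OF s d])
      have 4: "d * legendre f p \<le> d * (p * k - f k)" using p(2) d by (intro mult_left_mono) auto
      have "k * (z + p * d - x) - d * (p * k - f k) = k * z - k * x + d * f k" by (simp add: algebra_simps)
      then show "k * z + m \<le> A s z" using 1 2 3 4 ih[of z] unfolding m_def by linarith
    qed
    then show ?thesis by (simp add: m_def mult.commute)
  qed
  \<comment> \<open>Each of the \<open>Suc n\<close> steps of length \<open>d\<close> loses
    \<open>C * d^2\<close>, in total \<open>C * t^2 / Suc n\<close>; the loss at the start is the
    averaging error \<open>K * \<delta>\<close>.\<close>
  have bound: "W t x - (K * \<delta> + C * t ^ 2 / real (Suc n)) \<le> A t x" for n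
  proof -
    define d where "d = t / real (Suc n)"
    have d: "0 < d" using t by (simp add: d_def)
    have "W (real j * d) y - (K * \<delta> + real j * (C * d ^ 2)) \<le> A (real j * d) y" for j y
    proof (induction j arbitrary: y)
      case 0
      have "W 0 y - H 0 y \<le> K * \<delta>" using WH[of 0 y] by simp
      then show ?case by (simp add: H_def HL.hopf_lax_0)
    next
      case (Suc j)
      have "W (real j * d + d) y - ((K * \<delta> + real j * (C * d ^ 2)) + C * d ^ 2) \<le> A (real j * d + d) y"
        by (rule step[OF _ d Suc]) (use d in simp)
      then show ?case by (simp add: algebra_simps)
    qed
    from this[of "Suc n" x] have "W t x - (K * \<delta> + real (Suc n) * (C * d ^ 2)) \<le> A t x" by (simp add: d_def)
    moreover have "real (Suc n) * (C * d ^ 2) = C * t ^ 2 / real (Suc n)"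
      by (simp add: d_def power2_eq_square divide_simps)
    ultimately show ?thesis by simp
  qed
  \<comment> \<open>The number of steps tends to infinity with \<open>\<delta>\<close> fixed, since
    \<open>C\<close> grows like \<open>1 / \<delta>\<close>. What remains is twice the averaging
    error, at most \<open>e\<close>.\<close>
  have "(\<lambda>n. W t x - (K * \<delta> + (C * t ^ 2) * inverse (real (Suc n)))) \<longlonglongrightarrow> W t x - (K * \<delta> + (C * t ^ 2) * 0)"
    by (intro tendsto_intros LIMSEQ_inverse_real_of_nat)
  then have "W t x - (K * \<delta> + (C * t ^ 2) * 0) \<le> A t x"
    by (rule LIMSEQ_le_const2) (use bound in \<open>auto simp: divide_inverse\<close>)
  then show "hopf_lax f (A 0) t x \<le> A t x + e" using WH[of t x] t K\<delta> by (simp add: H_def abs_le_iff)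
qed

lemma A_eq_hopf_lax: "0 < t \<Longrightarrow> A t x = hopf_lax f (A 0) t x"
  using A_le_hopf_lax hopf_lax_le_A by (intro antisym)

end

section \<open>The Wasserstein distance of two solutions\<close>

lemma measurable_from_intervals:
  assumes "\<And>R. set_integrable lebesgue {-R..R} v" shows "(v :: real \<Rightarrow> real) \<in> borel_measurable lebesgue"
proof (rule borel_measurable_LIMSEQ_real)
  show "(\<lambda>x. indicator {- real n..real n} x *\<^sub>R v x) \<in> borel_measurable lebesgue" for n
    using assms[of "real n"] unfolding set_integrable_def by (rule borel_measurable_integrable)
  fix x :: real
  obtain n0 :: nat where n0: "\<bar>x\<bar> \<le> real n0" using real_arch_simple by blast
  have "\<forall>\<^sub>F n in sequentially. indicator {- real n..real n} x *\<^sub>R v x = v x"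
  proof (rule eventually_sequentiallyI[of n0])
    fix n assume "n0 \<le> n"
    then have "\<bar>x\<bar> \<le> real n" using n0 by linarith
    then show "indicator {- real n..real n} x *\<^sub>R v x = v x" by (auto simp: indicator_def abs_le_iff)
  qed
  then show "(\<lambda>n. indicator {- real n..real n} x *\<^sub>R v x) \<longlonglongrightarrow> v x" by (rule tendsto_eventually)
qed

lemma Linf_bounded:
  assumes "v \<in> Linf S" obtains K where "0 \<le> K" "AE x in lebesgue_on S. \<bar>v x\<bar> \<le> K"
proof -
  have fin: "Linf_norm S v < \<infinity>" using assms by (simp add: Linf_def)
  have AE: "AE x in lebesgue_on S. ereal \<bar>v x\<bar> \<le> Linf_norm S v" unfolding Linf_norm_def by (rule esssup_AE)
  obtain r where r: "Linf_norm S v \<le> ereal r" using fin by (cases "Linf_norm S v") auto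
  have "AE x in lebesgue_on S. \<bar>v x\<bar> \<le> max 0 r"
    using AE
  proof eventually_elim
    case (elim x)
    then have "ereal \<bar>v x\<bar> \<le> ereal r" using r by (rule order_trans)
    then show ?case by simp
  qed
  then show ?thesis by (intro that[of "max 0 r"]) auto
qed

lemma AE_lborel_interval:
  assumes AE: "AE s in lborel. P s" and ab: "(a::real) < b" obtains s where "a < s" "s < b" "P s"
proof -
  have "\<exists>s\<in>{a<..<b}. P s"
  proof (rule ccontr)
    assume n: "\<not> ?thesis"
    from AE obtain N where N: "{s \<in> space lborel. \<not> P s} \<subseteq> N" "N \<in> null_sets lborel"
      unfolding eventually_ae_filter by auto
    then have "{a<..<b} \<subseteq> N" using n by auto
    then have "emeasure lborel {a<..<b} \<le> emeasure lborel N" using N by (intro emeasure_mono) auto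
    then have "emeasure lborel {a<..<b} = 0" using N by (auto simp: null_sets_def)
    then show False using ab by simp
  qed
  then show ?thesis using that by auto
qed

lemma half_plane_measurable: "{0<..} \<times> (UNIV::real set) \<in> sets (lebesgue :: (real \<times> real) measure)"
  using open_Times[of "{0::real<..}" "UNIV::real set"] by (auto intro: lmeasurable_open)

text \<open>Continuity in time with values in \<open>L\<^sup>1\<close>-\<open>loc\<close> carries the bound from almost every time to
  every time.\<close>

lemma solution_slice_bounded:
  assumes sol: "entropy_solution f u0 u" and K: "AE (t, x) in lebesgue_on ({0<..} \<times> UNIV). \<bar>u t x\<bar> \<le> K"
    and t: "0 \<le> t"
  shows "AE x in lebesgue. \<bar>u t x\<bar> \<le> K"
proof -
  have si: "set_integrable lebesgue {-R..R} (u s)" if "0 \<le> s" for s R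
    using sol that unfolding entropy_solution_def by blast
  have "AE p in lebesgue. p \<in> {0<..} \<times> UNIV \<longrightarrow> \<bar>u (fst p) (snd p)\<bar> \<le> K"
    using K half_plane_measurable by (simp add: AE_restrict_space_iff case_prod_unfold)
  then have "AE p in lborel. fst p \<in> {0<..} \<longrightarrow> \<bar>u (fst p) (snd p)\<bar> \<le> K"
    by (simp add: AE_completion_iff mem_Times_iff)
  from lborel_pair.AE_pair[OF this[folded lborel_prod]]
  have good: "AE s in lborel. 0 < s \<longrightarrow> (AE x in lborel. \<bar>u s x\<bar> \<le> K)" by simp
  have "AE x in lebesgue. x \<in> {-R..R} \<longrightarrow> \<bar>u t x\<bar> \<le> K" for R
  proof -
    \<comment> \<open>The excess of \<open>|u t x|\<close> over \<open>K\<close>. Compared with a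
      time \<open>s\<close> at which the bound holds, it is at most \<open>|u s x - u t x|\<close>,
      which is small in L1 for \<open>s\<close> near \<open>t\<close>.\<close>
    let ?m = "\<lambda>x. max 0 (\<bar>u t x\<bar> - K)"
    have mt: "u t \<in> borel_measurable lebesgue" by (rule measurable_from_intervals[OF si[OF t]])
    have mi: "set_integrable lebesgue {-R..R} ?m"
    proof (rule set_integrable_bound[where f="\<lambda>x. \<bar>u t x\<bar> + \<bar>K\<bar>"])
      show "set_integrable lebesgue {-R..R} (\<lambda>x. \<bar>u t x\<bar> + \<bar>K\<bar>)"
        by (intro set_integral_add set_integrable_abs si t absolutely_integrable_continuous_real continuous_on_const)
      show "set_borel_measurable lebesgue {-R..R} ?m"
        using mt unfolding set_borel_measurable_def by (intro borel_measurable_scaleR borel_measurable_max borel_measurable_diff borel_measurable_abs borel_measurable_indicator) auto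
    qed auto
    have le: "(LINT x:{-R..R}|lebesgue. ?m x) \<le> e" if e: "0 < e" for e
    proof -
      have "((\<lambda>s. LINT x:{-R..R}|lebesgue. \<bar>u s x - u t x\<bar>) \<longlongrightarrow> 0) (at t within {0..})"
        using sol t unfolding entropy_solution_def by blast
      from tendstoD[OF this e] obtain d where d: "0 < d"
        "\<And>s. 0 \<le> s \<Longrightarrow> s \<noteq> t \<Longrightarrow> \<bar>s - t\<bar> < d \<Longrightarrow> \<bar>LINT x:{-R..R}|lebesgue. \<bar>u s x - u t x\<bar>\<bar> < e"
        unfolding eventually_at by (auto simp: dist_real_def)
      obtain s where s: "t < s" "s < t + d" "0 < s \<longrightarrow> (AE x in lborel. \<bar>u s x\<bar> \<le> K)"
        using AE_lborel_interval[OF good, of t "t + d"] d(1) by auto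
      have s0: "0 \<le> s" using s t by simp
      have AEs: "AE x in lebesgue. \<bar>u s x\<bar> \<le> K" using s t by (simp add: AE_completion_iff)
      have "(LINT x:{-R..R}|lebesgue. ?m x) \<le> (LINT x:{-R..R}|lebesgue. \<bar>u s x - u t x\<bar>)"
      proof (rule set_integral_mono_AE[OF mi])
        show "set_integrable lebesgue {-R..R} (\<lambda>x. \<bar>u s x - u t x\<bar>)"
          by (intro set_integrable_abs set_integral_diff si s0 t)
        show "AE x\<in>{-R..R} in lebesgue. ?m x \<le> \<bar>u s x - u t x\<bar>" using AEs by eventually_elim auto
      qed
      also have "\<dots> \<le> e" using d(2)[of s] s s0 by (auto simp: abs_le_iff)
      finally show ?thesis .
    qed
    have z: "(LINT x:{-R..R}|lebesgue. ?m x) = 0"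
    proof (rule antisym)
      show "(LINT x:{-R..R}|lebesgue. ?m x) \<le> 0" using field_le_epsilon[of "LINT x:{-R..R}|lebesgue. ?m x" 0] le by simp
      show "0 \<le> (LINT x:{-R..R}|lebesgue. ?m x)" unfolding set_lebesgue_integral_def by (rule integral_nonneg_AE) (auto simp: indicator_def)
    qed
    have "AE x in lebesgue. indicator {-R..R} x *\<^sub>R ?m x = 0"
      using z mi unfolding set_lebesgue_integral_def set_integrable_def
      by (subst (asm) integral_nonneg_eq_0_iff_AE) (auto simp: indicator_def)
    then show ?thesis by eventually_elim (auto simp: indicator_def max_def split: if_splits)
  qed
  then have "AE x in lebesgue. \<forall>n::nat. x \<in> {- real n..real n} \<longrightarrow> \<bar>u t x\<bar> \<le> K"
    unfolding AE_all_countable by blast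
  then show ?thesis
  proof eventually_elim
    case (elim x)
    obtain n :: nat where "\<bar>x\<bar> \<le> real n" using real_arch_simple by blast
    then have "x \<in> {- real n..real n}" by (auto simp: abs_le_iff)
    then show ?case using elim by blast
  qed
qed

text \<open>Truncation turns the essential bound into a bound at every point. It changes
  \<open>u\<close> on null sets only, both in the half plane and, by
  \<open>solution_slice_bounded\<close>, at each single time; being a contraction, it keeps
  continuity in time.\<close>

lemma entropy_solution_kruzkov:
  assumes sol: "entropy_solution f u0 u" and f: "convex_on UNIV f"
  obtains K w where "kruzkov K w f" "\<And>t. 0 \<le> t \<Longrightarrow> AE x in lebesgue. w t x = u t x"
proof -
  let ?HP = "{0<..} \<times> (UNIV :: real set)"
  have joint: "(\<lambda>(t, x). u t x) \<in> borel_measurable (lebesgue_on ?HP)"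
    using sol unfolding entropy_solution_def Linf_def by blast
  have "(\<lambda>(t, x). u t x) \<in> Linf ?HP" using sol unfolding entropy_solution_def by blast
  from Linf_bounded[OF this] obtain K where K0: "0 \<le> K" and K: "AE (t, x) in lebesgue_on ?HP. \<bar>u t x\<bar> \<le> K"
    by (auto simp: case_prod_unfold)
  have si: "set_integrable lebesgue {-R..R} (u s)" if "0 \<le> s" for s R
    using sol that unfolding entropy_solution_def by blast
  have mt: "u t \<in> borel_measurable lebesgue" if "0 \<le> t" for t by (rule measurable_from_intervals[OF si[OF that]])
  define w where "w t x = max (-K) (min K (u t x))" for t x
  have wb: "\<bar>w t x\<bar> \<le> K" for t x using K0 by (auto simp: w_def)
  have wu: "w t x = u t x" if "\<bar>u t x\<bar> \<le> K" for t x using that by (auto simp: w_def)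
  have bm: "bmeas K (w t)" if "0 \<le> t" for t
    using wb mt[OF that] unfolding bmeas_def w_def[abs_def] by (auto intro!: borel_measurable_max borel_measurable_min)
  have "kruzkov K w f"
  proof unfold_locales
    show "0 \<le> t \<Longrightarrow> bmeas K (w t)" for t by (rule bm)
    show "((\<lambda>s. integral {-R..R} (\<lambda>x. \<bar>w s x - w t x\<bar>)) \<longlongrightarrow> 0) (at t within {0..})" if t: "0 \<le> t" for t R
    proof (rule Lim_null_comparison)
      show "((\<lambda>s. LINT x:{-R..R}|lebesgue. \<bar>u s x - u t x\<bar>) \<longlongrightarrow> 0) (at t within {0..})"
        using sol t unfolding entropy_solution_def by blast
      have "norm (integral {-R..R} (\<lambda>x. \<bar>w s x - w t x\<bar>)) \<le> (LINT x:{-R..R}|lebesgue. \<bar>u s x - u t x\<bar>)" if s: "0 \<le> s" for s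
      proof -
        have ui: "set_integrable lebesgue {-R..R} (\<lambda>x. \<bar>u s x - u t x\<bar>)"
          by (intro set_integrable_abs set_integral_diff si s t)
        have wi: "(\<lambda>x. \<bar>w s x - w t x\<bar>) integrable_on {-R..R}" by (rule bmeas_integrable[OF bmeas_diff_abs[OF bm[OF s] bm[OF t]]])
        have "0 \<le> integral {-R..R} (\<lambda>x. \<bar>w s x - w t x\<bar>)" by (rule integral_nonneg[OF wi]) auto
        moreover have "integral {-R..R} (\<lambda>x. \<bar>w s x - w t x\<bar>) \<le> integral {-R..R} (\<lambda>x. \<bar>u s x - u t x\<bar>)"
          by (rule integral_le[OF wi set_lebesgue_integral_eq_integral(1)[OF ui]]) (auto simp: w_def)
        ultimately show ?thesis using set_lebesgue_integral_eq_integral(2)[OF ui] by simp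
      qed
      then show "\<forall>\<^sub>F s in at t within {0..}. norm (integral {-R..R} (\<lambda>x. \<bar>w s x - w t x\<bar>)) \<le> (LINT x:{-R..R}|lebesgue. \<bar>u s x - u t x\<bar>)"
        by (auto simp: eventually_at_filter intro!: always_eventually)
    qed
    show "convex_on UNIV f" by (rule f)
    have mu: "(\<lambda>p. u (fst p) (snd p)) \<in> borel_measurable (lebesgue_on ?HP)" using joint by (simp add: case_prod_unfold)
    then have mw: "(\<lambda>p. w (fst p) (snd p)) \<in> borel_measurable (lebesgue_on ?HP)"
      unfolding w_def by (intro borel_measurable_max borel_measurable_min) auto
    then show "(\<lambda>(t, x). w t x) \<in> borel_measurable (lebesgue_on ?HP)" by (simp add: case_prod_unfold)
    fix \<phi> \<phi>t \<phi>x :: "real \<times> real \<Rightarrow> real" and k :: real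
    assume test: "test_function \<phi> \<phi>t \<phi>x"
    have [measurable]: "\<phi>t \<in> borel_measurable (lebesgue_on ?HP)" "\<phi>x \<in> borel_measurable (lebesgue_on ?HP)"
      using test unfolding test_function_def
      by (auto intro!: measurable_restrict_space1 borel_measurable_continuous_onI measurable_completion)
    have [measurable]: "f \<in> borel_measurable borel"
      by (rule borel_measurable_continuous_onI[OF convex_on_continuous[OF open_UNIV f]])
    note [measurable] = mu mw
    let ?I = "\<lambda>v p. \<bar>v (fst p) (snd p) - k\<bar> * \<phi>t p + sgn (v (fst p) (snd p) - k) * (f (v (fst p) (snd p)) - f k) * \<phi>x p"
    have "0 \<le> integral\<^sup>L (lebesgue_on ?HP) (?I u)"
      using sol test unfolding entropy_solution_def by (simp add: case_prod_unfold)
    also have "\<dots> = integral\<^sup>L (lebesgue_on ?HP) (?I w)"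
    proof (rule integral_cong_AE)
      show "?I u \<in> borel_measurable (lebesgue_on ?HP)" unfolding sgn_if by measurable
      show "?I w \<in> borel_measurable (lebesgue_on ?HP)" unfolding sgn_if by measurable
      show "AE p in lebesgue_on ?HP. ?I u p = ?I w p"
        using K by eventually_elim (auto simp: case_prod_unfold wu)
    qed
    finally show "0 \<le> (LINT (t, x)|lebesgue_on ?HP. \<bar>w t x - k\<bar> * \<phi>t (t, x) + sgn (w t x - k) * (f (w t x) - f k) * \<phi>x (t, x))"
      by (simp add: case_prod_unfold)
  qed
  moreover have "AE x in lebesgue. w t x = u t x" if "0 \<le> t" for t
    using solution_slice_bounded[OF sol K that] by eventually_elim (rule wu)
  ultimately show ?thesis by (rule that)
qed

section \<open>Primitives of the initial datum and of the solutions\<close>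

locale initial_datum =
  fixes u0 :: "real \<Rightarrow> real" and r :: real
  assumes int: "integrable lebesgue u0" and pos: "AE x in lebesgue. 0 \<le> u0 x"
    and supp: "AE x in lebesgue. r < \<bar>x\<bar> \<longrightarrow> u0 x = 0" and mass: "(LINT x|lebesgue. u0 x) = 1"
begin

lemma set_int: "S \<in> sets lebesgue \<Longrightarrow> set_integrable lebesgue S u0"
  unfolding set_integrable_def by (rule integrable_mult_indicator[OF _ int])

lemma primitive_mono: "x \<le> y \<Longrightarrow> primitive u0 x \<le> primitive u0 y"
  unfolding primitive_def set_lebesgue_integral_def
  by (rule integral_mono_AE) (use set_int[of "{..x}"] set_int[of "{..y}"] pos in \<open>auto simp: set_integrable_def indicator_def elim!: eventually_mono\<close>)

lemma primitive_nonneg: "0 \<le> primitive u0 x"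
  unfolding primitive_def set_lebesgue_integral_def
  by (rule integral_nonneg_AE) (use pos in \<open>auto simp: indicator_def elim!: eventually_mono\<close>)

lemma primitive_le_1: "primitive u0 x \<le> 1"
  unfolding primitive_def set_lebesgue_integral_def mass[symmetric]
  by (rule integral_mono_AE) (use set_int[of "{..x}"] int pos in \<open>auto simp: set_integrable_def indicator_def elim!: eventually_mono\<close>)

lemma primitive_left: "x < -r \<Longrightarrow> primitive u0 x = 0"
  unfolding primitive_def set_lebesgue_integral_def
  by (rule integral_eq_zero_AE) (use supp in \<open>auto simp: indicator_def elim!: eventually_mono\<close>)

lemma primitive_right:
  assumes "r \<le> x" shows "primitive u0 x = 1"
  unfolding primitive_def set_lebesgue_integral_def mass[symmetric]
proof (rule integral_cong_AE)
  show "(\<lambda>y. indicator {..x} y *\<^sub>R u0 y) \<in> borel_measurable lebesgue"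
    using set_int[of "{..x}"] by (simp add: set_integrable_def)
  show "AE y in lebesgue. indicator {..x} y *\<^sub>R u0 y = u0 y"
    using supp by eventually_elim (use assms in \<open>auto simp: indicator_def\<close>)
qed (use int in auto)

lemma primitive_diff:
  assumes "x \<le> y" shows "primitive u0 y - primitive u0 x = integral {x..y} u0"
proof -
  have "primitive u0 y - primitive u0 x = (LINT z|lebesgue. indicator {..y} z *\<^sub>R u0 z - indicator {..x} z *\<^sub>R u0 z)"
    unfolding primitive_def set_lebesgue_integral_def
    by (rule Bochner_Integration.integral_diff[symmetric]) (use set_int[of "{..x}"] set_int[of "{..y}"] in \<open>auto simp: set_integrable_def\<close>)
  also have "\<dots> = (LINT z:{x..y}|lebesgue. u0 z)" unfolding set_lebesgue_integral_def
  proof (rule integral_cong_AE)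
    show "AE z in lebesgue. indicator {..y} z *\<^sub>R u0 z - indicator {..x} z *\<^sub>R u0 z = indicator {x..y} z *\<^sub>R u0 z"
      using AE_completion[OF AE_lborel_singleton[of x]] by eventually_elim (use assms in \<open>auto simp: indicator_def\<close>)
  qed (use set_int[of "{..x}"] set_int[of "{..y}"] set_int[of "{x..y}"] in \<open>auto simp: set_integrable_def\<close>)
  also have "\<dots> = integral {x..y} u0" by (rule set_lebesgue_integral_eq_integral(2)[OF set_int]) simp
  finally show ?thesis .
qed

end

lemma BB_initial_datum:
  assumes "u0 \<in> BB" obtains r where "initial_datum u0 r" "0 \<le> r"
proof -
  obtain S where S: "compact S" "AE x in lebesgue. x \<notin> S \<longrightarrow> u0 x = 0" using assms unfolding BB_def by blast
  obtain r where r: "\<And>x. x \<in> S \<Longrightarrow> \<bar>x\<bar> \<le> r" using compact_imp_bounded[OF S(1)] by (auto simp: bounded_iff)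
  have m: "(LINT x|lebesgue. u0 x) = 1" using assms by (simp add: BB_def)
  have "initial_datum u0 (max 0 r)"
  proof
    \<comment> \<open>A function that is not integrable has Bochner integral 0, so mass 1 entails
      integrability.\<close>
    show "integrable lebesgue u0" using m not_integrable_integral_eq by fastforce
    show "AE x in lebesgue. 0 \<le> u0 x" using assms by (simp add: BB_def)
    show "AE x in lebesgue. max 0 r < \<bar>x\<bar> \<longrightarrow> u0 x = 0"
      using S(2) by eventually_elim (use r in force)
  qed (rule m)
  then show ?thesis by (rule that) simp
qed

text \<open>\<open>A\<close> is normalized at the origin at time 0, whereas the primitive starts at
  minus infinity; initially they differ by \<open>primitive u0 0\<close>. The same constant works at
  time \<open>t\<close>: the Hopf-Lax value lies between 0 and the initial primitive, so it vanishes
  to the left of the initial support, and \<open>u t\<close> has no mass there.\<close>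

lemma primitive_entropy_solution:
  assumes u0: "initial_datum u0 r" and f: "flux_function f" and sol: "entropy_solution f u0 u"
  obtains K where "hopf_lax_data f (primitive u0) 0 K"
    "\<And>t. 0 < t \<Longrightarrow> primitive (u t) = hopf_lax f (primitive u0) t"
proof -
  interpret initial_datum u0 r by (rule u0)
  interpret F: flux_function f by (rule f)
  obtain K w where kr: "kruzkov K w f" and wu: "\<And>t. 0 \<le> t \<Longrightarrow> AE x in lebesgue. w t x = u t x"
    using entropy_solution_kruzkov[OF sol F.convex] by blast
  interpret kruzkov K w f by (rule kr)
  let ?P = "primitive u0"
  have w0: "AE x in lborel. w 0 x = u0 x"
  proof -
    have "AE x in lebesgue. u 0 x = u0 x" using sol unfolding entropy_solution_def by blast
    with wu[OF order_refl] have "AE x in lebesgue. w 0 x = u0 x" by eventually_elim simp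
    then show ?thesis by (simp add: AE_completion_iff)
  qed
  have int0: "integral {x..y} (w 0) = ?P y - ?P x" if "x \<le> y" for x y
    using integral_AE_cong[OF w0] primitive_diff[OF that] by simp
  have A0: "A 0 x = ?P x + (- ?P 0)" for x
    using A_diff[OF order_refl, of 0 x] A_diff[OF order_refl, of x 0] int0[of 0 x] int0[of x 0]
    by (cases "0 \<le> x") (auto simp: A_0)
  interpret kruzkov_flux K w f "- ?P 0"
    by unfold_locales (simp add: A0 primitive_nonneg)
  interpret P: hopf_lax_data f ?P 0 K
  proof
    show "\<bar>?P x - ?P y\<bar> \<le> K * \<bar>x - y\<bar>" for x y using A_lipschitz[OF order_refl, of x y] by (simp add: A0)
  qed (rule primitive_nonneg)
  have "primitive (u t) x = hopf_lax f ?P t x" if t: "0 < t" for t x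
  proof -
    have t0: "0 \<le> t" using t by simp
    let ?H = "hopf_lax f ?P t"
    have AH: "A t x = ?H x + (- ?P 0)" for x
    proof -
      have "A 0 = (\<lambda>y. ?P y + (- ?P 0))" using A0 by blast
      then show ?thesis using A_eq_hopf_lax[OF t, of x] P.hopf_lax_shift[OF t0, of "- ?P 0" x] by simp
    qed
    have inc: "integral {x..y} (w t) = ?H y - ?H x" if "x \<le> y" for x y
      using A_diff[OF t0 that] by (simp add: AH)
    have left: "?H x = 0" if "x < -r" for x
      using P.hopf_lax_le_init[OF t0, of x] P.hopf_lax_lower[OF t0, of x] primitive_left[OF that] by simp
    \<comment> \<open>Two units of room: the Hopf-Lax function is known to vanish strictly left of
      \<open>-r\<close>, and \<open>integral_abs_eq_0\<close>, applied up to \<open>- r - 1\<close>,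
      wants an endpoint strictly below that.\<close>
    define b where "b = - r - 2"
    have wsi: "set_integrable lebesgue {a..c} (w t)" for a c
      using measurable_bounded_by_integrable_imp_absolutely_integrable[of "w t" "{a..c}" "\<lambda>_. K"] bm[OF t0]
      by (auto simp: bmeas_def intro: measurable_restrict_space1)
    have zero: "AE y in lebesgue. y \<le> b \<longrightarrow> w t y = 0"
    proof -
      have "AE y in lebesgue. y \<in> {b - real n..b} \<longrightarrow> w t y = 0" for n :: nat
      proof -
        have "integral {b - real n..b} (\<lambda>y. \<bar>w t y\<bar>) = 0"
          by (rule integral_abs_eq_0[OF bm[OF t0], of "- r - 1"]) (use inc left in \<open>auto simp: b_def\<close>)
        then have "(LINT y:{b - real n..b}|lebesgue. \<bar>w t y\<bar>) = 0"
          using set_lebesgue_integral_eq_integral(2)[OF set_integrable_abs[OF wsi]] by simp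
        then have "AE y in lebesgue. indicator {b - real n..b} y *\<^sub>R \<bar>w t y\<bar> = 0"
          unfolding set_lebesgue_integral_def using set_integrable_abs[OF wsi, of "b - real n" b]
          by (subst (asm) integral_nonneg_eq_0_iff_AE) (auto simp: indicator_def set_integrable_def)
        then show ?thesis by eventually_elim (auto simp: indicator_def)
      qed
      then have "AE y in lebesgue. \<forall>n::nat. y \<in> {b - real n..b} \<longrightarrow> w t y = 0"
        unfolding AE_all_countable by blast
      then show ?thesis
      proof eventually_elim
        case (elim y)
        obtain n :: nat where "b - y \<le> real n" using real_arch_simple by blast
        then show ?case using elim[rule_format, of n] by auto
      qed
    qed
    have ut: "u t \<in> borel_measurable lebesgue"
    proof (rule measurable_from_intervals)
      show "set_integrable lebesgue {-R..R} (u t)" for R using sol t0 unfolding entropy_solution_def by blast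
    qed
    have "primitive (u t) x = (LINT y:{b..x}|lebesgue. w t y)"
      unfolding primitive_def set_lebesgue_integral_def
    proof (rule integral_cong_AE)
      show "AE y in lebesgue. indicator {..x} y *\<^sub>R u t y = indicator {b..x} y *\<^sub>R w t y"
        using zero wu[OF t0] by eventually_elim (auto simp: indicator_def)
      show "(\<lambda>y. indicator {..x} y *\<^sub>R u t y) \<in> borel_measurable lebesgue"
        using ut by (intro borel_measurable_scaleR borel_measurable_indicator) auto
      show "(\<lambda>y. indicator {b..x} y *\<^sub>R w t y) \<in> borel_measurable lebesgue"
        using wsi[of b x] by (auto simp: set_integrable_def)
    qed
    also have "\<dots> = integral {b..x} (w t)" by (rule set_lebesgue_integral_eq_integral(2)[OF wsi])
    also have "\<dots> = ?H x"
    proof (cases "b \<le> x")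
      case True
      then show ?thesis using inc[OF True] left[of b] by (simp add: b_def)
    next
      case False
      then show ?thesis using left[of x] by (simp add: b_def)
    qed
    finally show ?thesis .
  qed
  then show ?thesis by (intro that[OF P.hopf_lax_data_axioms]) blast
qed

text \<open>A nearly optimal \<open>z\<close> for \<open>g\<close> at the shifted point has slope at
  most \<open>legendre_inv g (\<gamma> / t)\<close>, where \<open>\<gamma>\<close> is the budget
  left above \<open>P z\<close>. Exchanging the inverses costs at most \<open>D\<close> in slope,
  that is \<open>t * D\<close> in distance, and this is the shift; so the same \<open>z\<close>
  serves for \<open>f\<close> at \<open>x\<close>.\<close>

lemma hopf_lax_level:
  assumes f: "hopf_lax_data f P c K" and g: "hopf_lax_data g P c' K'"
    and P: "mono P" "\<And>y. 0 \<le> P y" "\<And>y. P y \<le> 1" and t: "0 < t"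
    and D: "\<And>\<gamma>. 0 \<le> \<gamma> \<Longrightarrow> \<gamma> \<le> 1 \<Longrightarrow> \<bar>legendre_inv f (\<gamma> / t) - legendre_inv g (\<gamma> / t)\<bar> \<le> D"
    and x: "\<xi> < hopf_lax f P t x"
  shows "\<xi> < hopf_lax g P t (x + t * D)"
proof (rule ccontr)
  interpret F: hopf_lax_data f P c K by (rule f)
  interpret G: hopf_lax_data g P c' K' by (rule g)
  assume neg: "\<not> \<xi> < hopf_lax g P t (x + t * D)"
  define x' where "x' = x + t * D"
  \<comment> \<open>The infimum need not be attained. An intermediate level leaves a competitor
    strictly below it on the side of \<open>g\<close>, while the value for \<open>f\<close> stays
    strictly above.\<close>
  define \<xi>' where "\<xi>' = (\<xi> + hopf_lax f P t x) / 2"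
  have \<xi>': "\<xi> < \<xi>'" "\<xi>' < hopf_lax f P t x" using x by (auto simp: \<xi>'_def)
  have "hopf_lax g P t x' < \<xi>'" using neg \<xi>' by (simp add: x'_def)
  from G.hopf_lax_less[OF t this] obtain y where y: "P y + t * legendre g ((x' - y) / t) < \<xi>'" .
  \<comment> \<open>\<open>legendre_inv_iff\<close> covers nonnegative slopes only. A competitor
    \<open>y > x'\<close> is replaced by \<open>x'\<close> itself: \<open>P\<close> does not grow
    and the transform becomes 0.\<close>
  obtain z where z: "z \<le> x'" "P z + t * legendre g ((x' - z) / t) < \<xi>'"
  proof (cases "y \<le> x'")
    case True then show ?thesis using y that by blast
  next
    case False
    then have "P x' \<le> P y" using P(1) by (simp add: monoD)
    moreover have "0 \<le> t * legendre g ((x' - y) / t)" using t G.legendre_nonneg by simp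
    ultimately have "P x' + t * legendre g ((x' - x') / t) < \<xi>'" using y G.legendre_0 by simp
    then show ?thesis using that by blast
  qed
  define \<gamma> where "\<gamma> = \<xi>' - P z"
  have "0 \<le> t * legendre g ((x' - z) / t)" using t G.legendre_nonneg by simp
  then have "P z < \<xi>'" using z(2) by linarith
  moreover have "hopf_lax f P t x \<le> 1" using F.hopf_lax_le_init[of t x] P(3)[of x] t by simp
  \<comment> \<open>This is the range of the supremum in the claim; the upper end holds because the
    Hopf-Lax function never exceeds the initial primitive, hence 1.\<close>
  ultimately have \<gamma>: "0 \<le> \<gamma>" "\<gamma> \<le> 1" using \<xi>' P(2)[of z] by (auto simp: \<gamma>_def)
  have "legendre g ((x' - z) / t) \<le> \<gamma> / t" using z(2) t by (simp add: \<gamma>_def pos_le_divide_eq mult.commute)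
  then have "(x' - z) / t \<le> legendre_inv g (\<gamma> / t)"
    using G.legendre_inv_iff[of "(x' - z) / t" "\<gamma> / t"] z(1) t \<gamma> by simp
  also have "\<dots> \<le> legendre_inv f (\<gamma> / t) + D" using D[OF \<gamma>] by linarith
  finally have 1: "(x - z) / t \<le> legendre_inv f (\<gamma> / t)" using t by (simp add: x'_def add_divide_distrib diff_divide_distrib)
  show False
  proof (cases "z \<le> x")
    case True
    then have "legendre f ((x - z) / t) \<le> \<gamma> / t" using F.legendre_inv_iff[of "(x - z) / t" "\<gamma> / t"] 1 t \<gamma> by simp
    then have "t * legendre f ((x - z) / t) \<le> \<gamma>" using t by (simp add: pos_le_divide_eq mult.commute)
    then show False using F.hopf_lax_le[OF t, of x z] \<xi>'(2) by (simp add: \<gamma>_def)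
  next
    case False
    \<comment> \<open>Here the slope from \<open>z\<close> to \<open>x\<close> is negative, but
      \<open>x\<close> itself is already a competitor below the level \<open>\<xi>'\<close>.\<close>
    then have "P x \<le> P z" using P(1) by (simp add: monoD)
    then show False using F.hopf_lax_le_init[of t x] t \<xi>'(2) \<open>P z < \<xi>'\<close> by simp
  qed
qed

section \<open>Pseudo-inverses and the final estimate\<close>

lemma pseudo_inv_shift:
  assumes "\<And>x. \<xi> < U x \<Longrightarrow> \<xi> < V (x + a)" "{x. \<xi> < U x} \<noteq> {}" "bdd_below {x. \<xi> < V x}"
  shows "pseudo_inv V \<xi> \<le> pseudo_inv U \<xi> + a"
proof -
  have "pseudo_inv V \<xi> - a \<le> pseudo_inv U \<xi>" unfolding pseudo_inv_def
  proof (rule cInf_greatest[OF assms(2)])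
    fix x assume "x \<in> {x. \<xi> < U x}"
    then have "Inf {x. \<xi> < V x} \<le> x + a" using assms(1) by (intro cInf_lower assms(3)) auto
    then show "Inf {x. \<xi> < V x} - a \<le> x" by simp
  qed
  then show ?thesis by simp
qed

text \<open>Monotonicity gives measurability on \<open>{0..<1}\<close>. At 1 nothing is known about
  the superlevel set, so this point is added by a term supported on a singleton.\<close>

lemma pseudo_inv_measurable:
  assumes ne: "\<And>\<xi>. 0 \<le> \<xi> \<Longrightarrow> \<xi> < 1 \<Longrightarrow> {x. \<xi> < U x} \<noteq> {}"
    and bdd: "\<And>\<xi>. 0 \<le> \<xi> \<Longrightarrow> \<xi> < 1 \<Longrightarrow> bdd_below {x. \<xi> < U x}"
  shows "pseudo_inv U \<in> borel_measurable (lebesgue_on {0..1})"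
proof -
  have "mono_on {0..<1} (pseudo_inv U)" unfolding pseudo_inv_def
    by (rule mono_onI, rule cInf_superset_mono) (use ne bdd in auto)
  then have m: "pseudo_inv U \<in> borel_measurable (restrict_space borel {0..<1})"
    by (rule borel_measurable_mono_on_fnc)
  have "pseudo_inv U \<in> borel_measurable (lebesgue_on {0..<1})"
  proof (rule borel_measurable_subalgebra[OF _ _ m])
    have "sets borel \<subseteq> sets (lebesgue :: real measure)" by force
    then show "sets (restrict_space borel {0..<1}) \<subseteq> sets (lebesgue_on {0..<1::real})" by (rule mono_restrict_space)
    show "space (restrict_space borel {0..<1}) = space (lebesgue_on {0..<1::real})"
      by (simp add: space_restrict_space)
  qed
  then have "(\<lambda>x. if x \<in> {0..<1} then pseudo_inv U x else 0) \<in> borel_measurable lebesgue"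
    by (subst borel_measurable_if) auto
  then have "(\<lambda>x. (if x \<in> {0..<1} then pseudo_inv U x else 0) + indicator {1} x * pseudo_inv U 1) \<in> borel_measurable lebesgue"
    by (intro borel_measurable_add borel_measurable_times borel_measurable_indicator) auto
  then have "(\<lambda>x. (if x \<in> {0..<1} then pseudo_inv U x else 0) + indicator {1} x * pseudo_inv U 1) \<in> borel_measurable (lebesgue_on {0..1})"
    by (rule measurable_restrict_space1)
  then show ?thesis
    by (rule measurable_cong[THEN iffD1, rotated]) (auto simp: indicator_def)
qed

theorem proposition4p4:
  fixes u0 f g :: "real \<Rightarrow> real" and u v :: "real \<Rightarrow> real \<Rightarrow> real" and M C t :: real
  assumes "u0 \<in> BB" and "ereal M = Linf_norm UNIV u0"
    and "convex_on UNIV f" and "superlinear f" and "f 0 = 0" and "\<And>w. f 0 \<le> f w"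
    and "convex_on UNIV g" and "superlinear g" and "g 0 = 0" and "\<And>w. g 0 \<le> g w"
    and "Linf_norm {0..M} (a_fun f) \<le> ereal C"
    and "Linf_norm {0..M} (a_fun g) \<le> ereal C"
    and "entropy_solution f u0 u" and "entropy_solution g u0 v"
    and "t > 0"
  shows "W_inf (u t) (v t) \<le>
    ereal t * (SUP \<gamma>\<in>{0..1}. ereal \<bar>legendre_inv f (\<gamma> / t) - legendre_inv g (\<gamma> / t)\<bar>)"
proof -
  obtain r where r: "initial_datum u0 r" "0 \<le> r" using BB_initial_datum[OF assms(1)] by blast
  interpret initial_datum u0 r by (rule r)
  let ?P = "primitive u0"
  have ff: "flux_function f" by unfold_locales (use assms(3-6) in auto)
  have fg: "flux_function g" by unfold_locales (use assms(7-10) in auto)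
  obtain K where f: "hopf_lax_data f ?P 0 K" and uf: "primitive (u t) = hopf_lax f ?P t"
    using primitive_entropy_solution[OF r(1) ff assms(13)] assms(15) by metis
  obtain K' where g: "hopf_lax_data g ?P 0 K'" and vg: "primitive (v t) = hopf_lax g ?P t"
    using primitive_entropy_solution[OF r(1) fg assms(14)] assms(15) by metis
  have t: "0 < t" "0 \<le> t" using assms(15) by auto
  have P: "mono ?P" by (rule monoI) (rule primitive_mono)
  have bdd: "bdd_below {x. \<xi> < hopf_lax h ?P t x}" if h: "hopf_lax_data h ?P 0 K" and \<xi>: "0 \<le> \<xi>" for h K \<xi>
  proof (rule bdd_belowI[of _ "-r"])
    interpret H: hopf_lax_data h ?P 0 K by (rule h)
    fix x assume "x \<in> {x. \<xi> < hopf_lax h ?P t x}"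
    then have "0 < ?P x" using H.hopf_lax_le_init[OF t(2), of x] \<xi> by simp
    then show "-r \<le> x" using primitive_left[of x] by (cases "x < -r") auto
  qed
  have ne: "{x. \<xi> < hopf_lax h ?P t x} \<noteq> {}" if h: "hopf_lax_data h ?P 0 K" and \<xi>: "\<xi> < 1" for h K \<xi>
  proof -
    interpret H: hopf_lax_data h ?P 0 K by (rule h)
    \<comment> \<open>Far enough to the right that every competitor costs at least 1: for
      \<open>y \<ge> r\<close> the primitive alone is 1, and for \<open>y < r\<close> the transform,
      tested with the argument 1, contributes at least \<open>x - y - t * h 1\<close>.\<close>
    define x where "x = r + t * h 1 + 1"
    have "1 \<le> hopf_lax h ?P t x"
    proof (rule H.hopf_lax_greatest[OF t(1)])
      fix y
      have l0: "0 \<le> t * legendre h ((x - y) / t)" using t H.legendre_nonneg by simp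
      show "1 \<le> ?P y + t * legendre h ((x - y) / t)"
      proof (cases "r \<le> y")
        case True then show ?thesis using primitive_right[OF True] l0 by simp
      next
        case False
        have "t * ((x - y) / t * 1 - h 1) \<le> t * legendre h ((x - y) / t)"
          using t by (intro mult_left_mono H.legendre_upper) auto
        moreover have "t * ((x - y) / t * 1 - h 1) = x - y - t * h 1" using t by (simp add: field_simps)
        ultimately show ?thesis using False primitive_nonneg[of y] by (simp add: x_def)
      qed
    qed
    then show ?thesis using \<xi> by (intro ex_in_conv[THEN iffD1] exI[of _ x]) simp
  qed
  let ?S = "SUP \<gamma>\<in>{0..1}. ereal \<bar>legendre_inv f (\<gamma> / t) - legendre_inv g (\<gamma> / t)\<bar>"
  have S: "ereal \<bar>legendre_inv f (\<gamma> / t) - legendre_inv g (\<gamma> / t)\<bar> \<le> ?S" if "0 \<le> \<gamma>" "\<gamma> \<le> 1" for \<gamma>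
    by (rule SUP_upper) (use that in auto)
  show ?thesis
  proof (cases "?S = \<infinity>")
    case True
    then show ?thesis using t by simp
  next
    case False
    have "0 \<le> ?S" by (rule order_trans[OF _ S[of 0]]) auto
    with False obtain D where D: "?S = ereal D" by (cases ?S) auto
    have Df: "\<bar>legendre_inv f (\<gamma> / t) - legendre_inv g (\<gamma> / t)\<bar> \<le> D" if "0 \<le> \<gamma>" "\<gamma> \<le> 1" for \<gamma>
      using S[OF that] D by simp
    then have Dg: "\<bar>legendre_inv g (\<gamma> / t) - legendre_inv f (\<gamma> / t)\<bar> \<le> D" if "0 \<le> \<gamma>" "\<gamma> \<le> 1" for \<gamma>
      using that by (simp add: abs_minus_commute)
    let ?q = "\<lambda>\<xi>. pseudo_inv (hopf_lax f ?P t) \<xi> - pseudo_inv (hopf_lax g ?P t) \<xi>"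
    \<comment> \<open>The bound \<open>D\<close> is symmetric in the two fluxes, so both signs
      follow from \<open>hopf_lax_level\<close> with the roles of \<open>f\<close> and
      \<open>g\<close> exchanged.\<close>
    have q: "\<bar>?q \<xi>\<bar> \<le> t * D" if \<xi>: "0 \<le> \<xi>" "\<xi> < 1" for \<xi>
    proof -
      have "pseudo_inv (hopf_lax g ?P t) \<xi> \<le> pseudo_inv (hopf_lax f ?P t) \<xi> + t * D"
        by (intro pseudo_inv_shift hopf_lax_level[OF f g P primitive_nonneg primitive_le_1 t(1) Df] ne[OF f] bdd[OF g] \<xi>)
      moreover have "pseudo_inv (hopf_lax f ?P t) \<xi> \<le> pseudo_inv (hopf_lax g ?P t) \<xi> + t * D"
        by (intro pseudo_inv_shift hopf_lax_level[OF g f P primitive_nonneg primitive_le_1 t(1) Dg] ne[OF g] bdd[OF f] \<xi>)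
      ultimately show ?thesis by linarith
    qed
    have "esssup (lebesgue_on {0..1}) (\<lambda>\<xi>. ereal \<bar>?q \<xi>\<bar>) \<le> ereal (t * D)"
    proof (rule esssup_I)
      have "pseudo_inv (hopf_lax f ?P t) \<in> borel_measurable (lebesgue_on {0..1})"
        "pseudo_inv (hopf_lax g ?P t) \<in> borel_measurable (lebesgue_on {0..1})"
        by (intro pseudo_inv_measurable ne[OF f] bdd[OF f] ne[OF g] bdd[OF g]; assumption)+
      then show "(\<lambda>\<xi>. ereal \<bar>?q \<xi>\<bar>) \<in> borel_measurable (lebesgue_on {0..1})"
        by (intro borel_measurable_ereal borel_measurable_abs borel_measurable_diff)
      \<comment> \<open>The endpoint 1, at which \<open>q\<close> gives no bound, is a null
        set.\<close>
      have "AE \<xi> in lebesgue. \<xi> \<in> {0..1} \<longrightarrow> ereal \<bar>?q \<xi>\<bar> \<le> ereal (t * D)"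
        using AE_completion[OF AE_lborel_singleton[of "1::real"]] by eventually_elim (use q in auto)
      then show "AE \<xi> in lebesgue_on {0..1}. ereal \<bar>?q \<xi>\<bar> \<le> ereal (t * D)"
        by (simp add: AE_restrict_space_iff)
    qed
    then show ?thesis unfolding W_inf_def Linf_norm_def uf vg D by simp
  qed
qed

end
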